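(* Let $h\in(0,h_0)$, let $(u,y,p)\in U_{ad}\times H_0^1(\Omega)\times H_0^1(\Omega)$ be the solution of the continuous optimal control problem and $(u_h,y_h,p_h)\in U_{ad}\times V_h\times V_h$ the solution of the discrete optimal control problem. Let $y^h:=Su_h$ and $p^h:=S^*(y_h-y_d)$. Then $$\|y-y_h\|_{a,\Omega}=\|y^h-y_h\|_{a,\Omega}+O(\kappa(h))\Big(\|y-y_h\|_{a,\Omega}+\|p-p_h\|_{a,\Omega}\Big),$$ $$\|p-p_h\|_{a,\Omega}=\|p^h-p_h\|_{a,\Omega}+O(\kappa(h))\Big(\|y-y_h\|_{a,\Omega}+\|p-p_h\|_{a,\Omega}\Big),$$ provided $h_0$ is sufficiently small ($h_0\ll1$).
   Context: Setting. $\Omega\subset\mathbb{R}^d$ ($d=2,3$) is a bounded polygonal or polyhedral domain. $Ly=-\sum_{i,j=1}^d\partial_{x_j}(a_{ij}\partial_{x_i}y)+cy$, where $A=(a_{ij})$ with $a_{ij}\in W^{1,\infty}(\Omega)$ is symmetric and positive definite and $0\le c<\infty$. $a(y,v)=\int_\Omega\sum_{i,j}a_{ij}\partial_{x_i}y\,\partial_{x_j}v+cyv$ on $H_0^1(\Omega)$; $\|v\|_{a,\Omega}=\sqrt{a(v,v)}$, a norm equivalent to the $H^1$ norm. $(\cdot,\cdot)$ is the $L^2(\Omega)$ inner product. $S:L^2(\Omega)\to H_0^1(\Omega)$ is the solution operator: $w=Sf$ satisfies $a(w,v)=(f,v)$ for all $v\in H_0^1(\Omega)$; $S^*$ is its adjoint: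 $q=S^*g$ satisfies $a(v,q)=(g,v)$ for all $v\in H_0^1(\Omega)$. Continuous problem. Fix $\alpha>0$, $y_d\in L^2(\Omega)$, reals $a<b$, and $U_{ad}=\{u\in L^2(\Omega): a\le u\le b \text{ a.e. in }\Omega\}$. Minimize $\frac12\|y-y_d\|_{0,\Omega}^2+\frac{\alpha}{2}\|u\|_{0,\Omega}^2$ over $u\in U_{ad}$ subject to $Ly=u$ in $\Omega$, $y=0$ on $\partial\Omega$. The unique solution $(u,y,p)$ is characterized by $a(y,v)=(u,v)$ and $a(w,p)=(y-y_d,w)$ for all $v,w\in H_0^1(\Omega)$, and $(\alpha u+p,v-u)\ge0$ for all $v\in U_{ad}$. Discrete problem. $\mathcal{T}_h$ is a triangulation from a uniformly shape-regular family of conforming triangulations of $\Omega$, $h=\max_{T}h_T$ ($h_T$ the diameter of $T$), and $V_h\subset C(\bar\Omega)\cap H_0^1(\Omega)$ is the space of continuous piecewise linear functions. $(u_h,y_h,p_h)\in U_{ad}\times V_h\times V_h$ is the unique triple with $a(y_h,v_h)=(u_h,v_h)$, $a(w_h,p_h)=(y_h-y_d,w_h)$ for all $v_h,w_h\in V_h$, and $(\alpha u_h+p_h,v-u_h)\ge0$ for all $v\in U_{ad}$ (the control is not discretized). Notation. $\kappa(h)=\sup_{f\in L^2(\Omega),\|f\|_{0,\Omega}=1}\inf_{v_h\in V_h}\|Sf-v_h\|_{a,\Omega}$ (one has $\kappa(h)\ll1$ for $h\in(0,h_0)$ if $h_0\ll1$). $O(\kappa(h))$ denotes a quantity bounded in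 absolute value by $C\kappa(h)$ with $C$ independent of the mesh size. "$h_0\ll1$" means that $h_0$ lies below some sufficiently small positive threshold. *)

theory Defs
  imports "HOL-Analysis.Analysis"
begin

text \<open>Elements of \<open>L\<^sup>2\<close>, \<open>H\<^sup>1\<close>, etc. are represented by functions on the whole space; their values
  outside \<open>\<Omega>\<close> and on null sets are irrelevant. All integrals are Lebesgue integrals over \<open>\<Omega>\<close>.\<close>

definition L2 :: "(real ^ 'd) set \<Rightarrow> (real ^ 'd \<Rightarrow> real) set" where
  "L2 \<Omega> = {f \<in> borel_measurable (lebesgue_on \<Omega>). integrable (lebesgue_on \<Omega>) (\<lambda>x. (f x)\<^sup>2)}"

definition L2_inner :: "(real ^ 'd) set \<Rightarrow> (real ^ 'd \<Rightarrow> real) \<Rightarrow> (real ^ 'd \<Rightarrow> real) \<Rightarrow> real" where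
  "L2_inner \<Omega> f g = (\<integral>x. f x * g x \<partial>lebesgue_on \<Omega>)"

definition L2_norm :: "(real ^ 'd) set \<Rightarrow> (real ^ 'd \<Rightarrow> real) \<Rightarrow> real" where
  "L2_norm \<Omega> f = sqrt (L2_inner \<Omega> f f)"

definition Linf :: "(real ^ 'd) set \<Rightarrow> (real ^ 'd \<Rightarrow> real) set" where
  "Linf \<Omega> = {f \<in> borel_measurable (lebesgue_on \<Omega>). \<exists>M. AE x in lebesgue_on \<Omega>. \<bar>f x\<bar> \<le> M}"

definition partial :: "'d::finite \<Rightarrow> (real ^ 'd \<Rightarrow> real) \<Rightarrow> real ^ 'd \<Rightarrow> real" where
  "partial i f x = frechet_derivative f (at x) (axis i 1)"

primrec Ck :: "nat \<Rightarrow> (real ^ 'd::finite \<Rightarrow> real) \<Rightarrow> bool" where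
  "Ck 0 f \<longleftrightarrow> continuous_on UNIV f"
| "Ck (Suc k) f \<longleftrightarrow> (\<forall>x. f differentiable (at x)) \<and> (\<forall>i. Ck k (partial i f))"

definition test_functions :: "(real ^ 'd::finite) set \<Rightarrow> (real ^ 'd \<Rightarrow> real) set" where
  "test_functions \<Omega> =
     {\<phi>. (\<forall>k. Ck k \<phi>) \<and> compact (closure {x. \<phi> x \<noteq> 0}) \<and> closure {x. \<phi> x \<noteq> 0} \<subseteq> \<Omega>}"

definition locally_integrable :: "(real ^ 'd) set \<Rightarrow> (real ^ 'd \<Rightarrow> real) \<Rightarrow> bool" where
  "locally_integrable \<Omega> v \<longleftrightarrow> (\<forall>K. compact K \<and> K \<subseteq> \<Omega> \<longrightarrow> v absolutely_integrable_on K)"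

definition is_weak_partial ::
    "(real ^ 'd::finite) set \<Rightarrow> 'd \<Rightarrow> (real ^ 'd \<Rightarrow> real) \<Rightarrow> (real ^ 'd \<Rightarrow> real) \<Rightarrow> bool" where
  "is_weak_partial \<Omega> i v g \<longleftrightarrow>
     locally_integrable \<Omega> v \<and> locally_integrable \<Omega> g \<and>
     (\<forall>\<phi> \<in> test_functions \<Omega>. L2_inner \<Omega> v (partial i \<phi>) = - L2_inner \<Omega> g \<phi>)"

text \<open>The weak derivative is unique up to null sets; the choice of a representative does not
  affect any of the integrals below.\<close>

definition weak_partial :: "(real ^ 'd::finite) set \<Rightarrow> 'd \<Rightarrow> (real ^ 'd \<Rightarrow> real) \<Rightarrow> real ^ 'd \<Rightarrow> real" where
  "weak_partial \<Omega> i v = (SOME g. is_weak_partial \<Omega> i v g)"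

definition W1inf :: "(real ^ 'd::finite) set \<Rightarrow> (real ^ 'd \<Rightarrow> real) set" where
  "W1inf \<Omega> = {v \<in> Linf \<Omega>. \<forall>i. \<exists>g \<in> Linf \<Omega>. is_weak_partial \<Omega> i v g}"

definition H1 :: "(real ^ 'd::finite) set \<Rightarrow> (real ^ 'd \<Rightarrow> real) set" where
  "H1 \<Omega> = {v \<in> L2 \<Omega>. \<forall>i. \<exists>g \<in> L2 \<Omega>. is_weak_partial \<Omega> i v g}"

definition H1_norm :: "(real ^ 'd::finite) set \<Rightarrow> (real ^ 'd \<Rightarrow> real) \<Rightarrow> real" where
  "H1_norm \<Omega> v = sqrt ((L2_norm \<Omega> v)\<^sup>2 + (\<Sum>i\<in>UNIV. (L2_norm \<Omega> (weak_partial \<Omega> i v))\<^sup>2))"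

definition H10 :: "(real ^ 'd::finite) set \<Rightarrow> (real ^ 'd \<Rightarrow> real) set" where
  "H10 \<Omega> = {v \<in> H1 \<Omega>. \<forall>\<epsilon>>0. \<exists>\<phi> \<in> test_functions \<Omega>. H1_norm \<Omega> (\<lambda>x. v x - \<phi> x) < \<epsilon>}"

text \<open>Positive definiteness is uniform: this is what makes the energy norm equivalent to the
  \<open>H\<^sup>1\<close> norm.\<close>

definition elliptic_matrix :: "(real ^ 'd::finite) set \<Rightarrow> (real ^ 'd \<Rightarrow> real ^ 'd ^ 'd) \<Rightarrow> bool" where
  "elliptic_matrix \<Omega> A \<longleftrightarrow>
     (\<forall>i j. (\<lambda>x. A x $ i $ j) \<in> W1inf \<Omega>) \<and>
     (AE x in lebesgue_on \<Omega>. transpose (A x) = A x) \<and>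
     (\<exists>\<theta>>0. AE x in lebesgue_on \<Omega>. \<forall>\<xi>. \<xi> \<bullet> (A x *v \<xi>) \<ge> \<theta> * (norm \<xi>)\<^sup>2)"

definition bform ::
    "(real ^ 'd::finite) set \<Rightarrow> (real ^ 'd \<Rightarrow> real ^ 'd ^ 'd) \<Rightarrow> (real ^ 'd \<Rightarrow> real)
      \<Rightarrow> (real ^ 'd \<Rightarrow> real) \<Rightarrow> (real ^ 'd \<Rightarrow> real) \<Rightarrow> real" where
  "bform \<Omega> A c y v =
     (\<integral>x. (\<Sum>i\<in>UNIV. \<Sum>j\<in>UNIV. A x $ i $ j * weak_partial \<Omega> i y x * weak_partial \<Omega> j v x)
            + c x * y x * v x \<partial>lebesgue_on \<Omega>)"

definition energy_norm ::
    "(real ^ 'd::finite) set \<Rightarrow> (real ^ 'd \<Rightarrow> real ^ 'd ^ 'd) \<Rightarrow> (real ^ 'd \<Rightarrow> real)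
      \<Rightarrow> (real ^ 'd \<Rightarrow> real) \<Rightarrow> real" where
  "energy_norm \<Omega> A c v = sqrt (bform \<Omega> A c v v)"

definition is_state ::
    "(real ^ 'd::finite) set \<Rightarrow> (real ^ 'd \<Rightarrow> real ^ 'd ^ 'd) \<Rightarrow> (real ^ 'd \<Rightarrow> real)
      \<Rightarrow> (real ^ 'd \<Rightarrow> real) \<Rightarrow> (real ^ 'd \<Rightarrow> real) \<Rightarrow> bool" where
  "is_state \<Omega> A c f w \<longleftrightarrow> w \<in> H10 \<Omega> \<and> (\<forall>v \<in> H10 \<Omega>. bform \<Omega> A c w v = L2_inner \<Omega> f v)"

definition is_adjoint_state ::
    "(real ^ 'd::finite) set \<Rightarrow> (real ^ 'd \<Rightarrow> real ^ 'd ^ 'd) \<Rightarrow> (real ^ 'd \<Rightarrow> real)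
      \<Rightarrow> (real ^ 'd \<Rightarrow> real) \<Rightarrow> (real ^ 'd \<Rightarrow> real) \<Rightarrow> bool" where
  "is_adjoint_state \<Omega> A c g q \<longleftrightarrow> q \<in> H10 \<Omega> \<and> (\<forall>v \<in> H10 \<Omega>. bform \<Omega> A c v q = L2_inner \<Omega> g v)"

text \<open>The operators \<open>S\<close> and \<open>S\<^sup>*\<close>; for \<open>f \<in> L\<^sup>2\<close> the chosen function exists and is unique up to null
  sets by the Lax--Milgram theorem.\<close>

definition sol_op ::
    "(real ^ 'd::finite) set \<Rightarrow> (real ^ 'd \<Rightarrow> real ^ 'd ^ 'd) \<Rightarrow> (real ^ 'd \<Rightarrow> real)
      \<Rightarrow> (real ^ 'd \<Rightarrow> real) \<Rightarrow> real ^ 'd \<Rightarrow> real" where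
  "sol_op \<Omega> A c f = (SOME w. is_state \<Omega> A c f w)"

definition adj_sol_op ::
    "(real ^ 'd::finite) set \<Rightarrow> (real ^ 'd \<Rightarrow> real ^ 'd ^ 'd) \<Rightarrow> (real ^ 'd \<Rightarrow> real)
      \<Rightarrow> (real ^ 'd \<Rightarrow> real) \<Rightarrow> real ^ 'd \<Rightarrow> real" where
  "adj_sol_op \<Omega> A c g = (SOME q. is_adjoint_state \<Omega> A c g q)"

text \<open>A polygonal or polyhedral domain is automatically open and bounded here. Taking an interior
  rules out slits.\<close>

definition polyhedral_domain :: "(real ^ 'd::finite) set \<Rightarrow> bool" where
  "polyhedral_domain \<Omega> \<longleftrightarrow>
     \<Omega> \<noteq> {} \<and> connected \<Omega> \<and>
     (\<exists>P. finite P \<and> (\<forall>K\<in>P. polytope K) \<and> \<Omega> = interior (\<Union>P))"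

text \<open>Conformity (two elements meet in a common face) is part of the library notion \<^const>\<open>triangulation\<close>.\<close>

definition triangulation_of :: "(real ^ 'd::finite) set \<Rightarrow> (real ^ 'd) set set \<Rightarrow> bool" where
  "triangulation_of \<Omega> \<T> \<longleftrightarrow>
     triangulation \<T> \<and> (\<forall>T\<in>\<T>. int CARD('d) simplex T) \<and> \<Union>\<T> = closure \<Omega>"

definition mesh_size :: "(real ^ 'd::finite) set set \<Rightarrow> real" where
  "mesh_size \<T> = Max (diameter ` \<T>)"

definition inball_diameter :: "(real ^ 'd::finite) set \<Rightarrow> real" where
  "inball_diameter T = Sup {2 * r | r z. 0 \<le> r \<and> cball z r \<subseteq> T}"

definition uniformly_shape_regular :: "(real ^ 'd::finite) set set set \<Rightarrow> bool" where
  "uniformly_shape_regular \<F> \<longleftrightarrow>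
     (\<exists>\<sigma>. \<forall>\<T>\<in>\<F>. \<forall>T\<in>\<T>. diameter T \<le> \<sigma> * inball_diameter T)"

definition FE_space :: "(real ^ 'd::finite) set \<Rightarrow> (real ^ 'd) set set \<Rightarrow> (real ^ 'd \<Rightarrow> real) set" where
  "FE_space \<Omega> \<T> =
     {v \<in> H10 \<Omega>. continuous_on (closure \<Omega>) v \<and> (\<forall>T\<in>\<T>. \<exists>g k. \<forall>x\<in>T. v x = g \<bullet> x + k)}"

definition kappa ::
    "(real ^ 'd::finite) set \<Rightarrow> (real ^ 'd \<Rightarrow> real ^ 'd ^ 'd) \<Rightarrow> (real ^ 'd \<Rightarrow> real)
      \<Rightarrow> (real ^ 'd) set set \<Rightarrow> real" where
  "kappa \<Omega> A c \<T> =
     (SUP f \<in> {f \<in> L2 \<Omega>. L2_norm \<Omega> f = 1}.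
        INF v \<in> FE_space \<Omega> \<T>. energy_norm \<Omega> A c (\<lambda>x. sol_op \<Omega> A c f x - v x))"

definition U_ad :: "(real ^ 'd) set \<Rightarrow> real \<Rightarrow> real \<Rightarrow> (real ^ 'd \<Rightarrow> real) set" where
  "U_ad \<Omega> a b = {u \<in> L2 \<Omega>. AE x in lebesgue_on \<Omega>. a \<le> u x \<and> u x \<le> b}"

definition cost ::
    "(real ^ 'd) set \<Rightarrow> real \<Rightarrow> (real ^ 'd \<Rightarrow> real) \<Rightarrow> (real ^ 'd \<Rightarrow> real) \<Rightarrow> (real ^ 'd \<Rightarrow> real) \<Rightarrow> real" where
  "cost \<Omega> \<alpha> yd y u = 1/2 * (L2_norm \<Omega> (\<lambda>x. y x - yd x))\<^sup>2 + \<alpha>/2 * (L2_norm \<Omega> u)\<^sup>2"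

definition ocp_solution ::
    "(real ^ 'd::finite) set \<Rightarrow> (real ^ 'd \<Rightarrow> real ^ 'd ^ 'd) \<Rightarrow> (real ^ 'd \<Rightarrow> real)
      \<Rightarrow> real \<Rightarrow> (real ^ 'd \<Rightarrow> real) \<Rightarrow> real \<Rightarrow> real
      \<Rightarrow> (real ^ 'd \<Rightarrow> real) \<Rightarrow> (real ^ 'd \<Rightarrow> real) \<Rightarrow> (real ^ 'd \<Rightarrow> real) \<Rightarrow> bool" where
  "ocp_solution \<Omega> A c \<alpha> yd a b u y p \<longleftrightarrow>
     u \<in> U_ad \<Omega> a b \<and> is_state \<Omega> A c u y \<and>
     (\<forall>v z. v \<in> U_ad \<Omega> a b \<and> is_state \<Omega> A c v z \<longrightarrow> cost \<Omega> \<alpha> yd y u \<le> cost \<Omega> \<alpha> yd z v) \<and>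
     is_adjoint_state \<Omega> A c (\<lambda>x. y x - yd x) p"

definition discrete_solution ::
    "(real ^ 'd::finite) set \<Rightarrow> (real ^ 'd \<Rightarrow> real ^ 'd ^ 'd) \<Rightarrow> (real ^ 'd \<Rightarrow> real)
      \<Rightarrow> real \<Rightarrow> (real ^ 'd \<Rightarrow> real) \<Rightarrow> real \<Rightarrow> real \<Rightarrow> (real ^ 'd) set set
      \<Rightarrow> (real ^ 'd \<Rightarrow> real) \<Rightarrow> (real ^ 'd \<Rightarrow> real) \<Rightarrow> (real ^ 'd \<Rightarrow> real) \<Rightarrow> bool" where
  "discrete_solution \<Omega> A c \<alpha> yd a b \<T> uh yh ph \<longleftrightarrow>
     uh \<in> U_ad \<Omega> a b \<and> yh \<in> FE_space \<Omega> \<T> \<and> ph \<in> FE_space \<Omega> \<T> \<and>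
     (\<forall>v \<in> FE_space \<Omega> \<T>. bform \<Omega> A c yh v = L2_inner \<Omega> uh v) \<and>
     (\<forall>w \<in> FE_space \<Omega> \<T>. bform \<Omega> A c w ph = L2_inner \<Omega> (\<lambda>x. yh x - yd x) w) \<and>
     (\<forall>v \<in> U_ad \<Omega> a b. L2_inner \<Omega> (\<lambda>x. \<alpha> * uh x + ph x) (\<lambda>x. v x - uh x) \<ge> 0)"

end

theory Submission
  imports Defs
begin

text \<open>Write \<open>y\<^sup>h = S u\<^sub>h\<close> and \<open>p\<^sup>h = S\<^sup>*(y\<^sub>h - y\<^sub>d)\<close>. Since \<open>y - y\<^sup>h = S (u - u\<^sub>h)\<close> and
  \<open>p - p\<^sup>h = S\<^sup>*(y - y\<^sub>h)\<close>, the reverse triangle inequality leaves the task of bounding \<open>u - u\<^sub>h\<close> and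
  \<open>y - y\<^sub>h\<close> in \<open>L\<^sup>2\<close> by \<open>\<kappa>(h)\<close> times the energy errors. The discrete solutions \<open>y\<^sub>h\<close>, \<open>p\<^sub>h\<close> are the Galerkin
  projections of \<open>y\<^sup>h\<close>, \<open>p\<^sup>h\<close>, so the Aubin--Nitsche duality argument gains the factor \<open>\<kappa>(h)\<close> for
  \<open>y\<^sup>h - y\<^sub>h\<close> and \<open>p\<^sup>h - p\<^sub>h\<close>, and the two variational inequalities transfer it to \<open>u - u\<^sub>h\<close>.

  The weak derivative and the operator \<open>S\<close> are arbitrary choices, so two foundations are needed: the
  fundamental lemma of the calculus of variations, which makes weak derivatives unique and the energy form
  bilinear, and the Riesz representation theorem on \<open>H\<^sup>1\<^sub>0\<close>, which rests on the completeness of \<open>L\<^sup>2\<close> and the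
  Poincare inequality.\<close>

section \<open>Positive semidefinite forms\<close>

text \<open>Functions are not identified up to null sets, so the \<open>L2\<close> and energy
  pairings are only semidefinite on sets of functions. The Hilbert space arguments are therefore
  carried out for a semidefinite form, and the representation theorem claims existence alone, which
  is what an operator defined by \<open>SOME\<close> needs. Symmetry of the energy form makes the
  defining predicates of \<open>S\<close> and its adjoint coincide, so the two choices agree and one
  operator serves both equations.

  The obstacle in the estimate is that duality bounds \<open>Y - yh\<close> and
  \<open>P - ph\<close> in \<open>L2\<close> by \<open>kappa\<close> times their own energy norms,
  whereas the remainder is measured by \<open>err\<close>, the energy errors of \<open>y\<close> and
  \<open>p\<close>. A crude estimate without \<open>kappa\<close> bridges this: stability of
  \<open>S\<close> and, for \<open>Y - yh\<close>, the variational inequalities bound these energy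
  norms by a constant times \<open>err\<close>. The factor \<open>kappa\<close> enters afterwards,
  and no term is absorbed into the left side. All constants are built from \<alpha> and the constant
  of the embedding of \<open>H10\<close> into \<open>L2\<close>, hence do not depend on the
  mesh.\<close>

lemma linear_term_nonneg:
  fixes d s :: real
  assumes "\<And>t. 0 < t \<Longrightarrow> t \<le> 1 \<Longrightarrow> 0 \<le> t * d + t\<^sup>2 * s"
  shows "0 \<le> d"
proof (rule ccontr)
  assume "\<not> 0 \<le> d"
  \<comment> \<open>The second bound makes \<open>t * s\<close> at most \<open>- d / 2\<close>, so
    the quadratic term cannot compensate the negative linear one; adding 1 to
    \<open>\<bar>s\<bar>\<close> keeps the denominator positive when \<open>s\<close> is
    zero.\<close>
  define t where "t = min 1 (- d / (2 * (\<bar>s\<bar> + 1)))"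
  have t: "0 < t" "t \<le> 1" using \<open>\<not> 0 \<le> d\<close> by (auto simp: t_def divide_less_0_iff)
  have "t * s \<le> t * (\<bar>s\<bar> + 1)" using t by (intro mult_left_mono) auto
  also have "\<dots> \<le> (- d / (2 * (\<bar>s\<bar> + 1))) * (\<bar>s\<bar> + 1)"
    by (intro mult_right_mono) (auto simp: t_def)
  also have "\<dots> = - d / 2" by (simp add: field_simps)
  finally have "t * s < - d" using \<open>\<not> 0 \<le> d\<close> by simp
  then have "t * (d + t * s) < 0" using t by (simp add: mult_less_0_iff)
  moreover have "0 \<le> t * (d + t * s)"
    using assms[OF t] by (simp add: algebra_simps power2_eq_square)
  ultimately show False by simp
qed

text \<open>The laws are phrased for pointwise lambda terms so that they rewrite expressions such as
  \<open>\<lambda>x. y x - yh x\<close> directly. Linearity is required in the first argument;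
  symmetry carries it to the second. Instances are \<open>L2_inner\<close> on \<open>L2\<close> and
  energy forms on \<open>H1\<close> and \<open>H10\<close>.\<close>

locale psd_form =
  fixes V :: "('a \<Rightarrow> real) set" and B :: "('a \<Rightarrow> real) \<Rightarrow> ('a \<Rightarrow> real) \<Rightarrow> real"
  assumes zero_mem: "(\<lambda>x. 0) \<in> V"
    and add_mem: "v \<in> V \<Longrightarrow> w \<in> V \<Longrightarrow> (\<lambda>x. v x + w x) \<in> V"
    and scale_mem: "v \<in> V \<Longrightarrow> (\<lambda>x. r * v x) \<in> V"
    and form_add: "u \<in> V \<Longrightarrow> v \<in> V \<Longrightarrow> w \<in> V \<Longrightarrow> B (\<lambda>x. u x + v x) w = B u w + B v w"
    and form_scale: "v \<in> V \<Longrightarrow> w \<in> V \<Longrightarrow> B (\<lambda>x. r * v x) w = r * B v w"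
    and form_sym: "v \<in> V \<Longrightarrow> w \<in> V \<Longrightarrow> B v w = B w v"
    and form_nonneg: "v \<in> V \<Longrightarrow> 0 \<le> B v v"
begin

definition nrm :: "('a \<Rightarrow> real) \<Rightarrow> real" where
  "nrm v = sqrt (B v v)"

lemma nrm_nonneg: "v \<in> V \<Longrightarrow> 0 \<le> nrm v"
  by (simp add: nrm_def form_nonneg)

lemma nrm_sq: "v \<in> V \<Longrightarrow> (nrm v)\<^sup>2 = B v v"
  by (simp add: nrm_def form_nonneg)

lemma diff_mem: "v \<in> V \<Longrightarrow> w \<in> V \<Longrightarrow> (\<lambda>x. v x - w x) \<in> V"
  using add_mem[of v "\<lambda>x. -1 * w x"] scale_mem[of w "-1"] by simp

lemma form_diff: "u \<in> V \<Longrightarrow> v \<in> V \<Longrightarrow> w \<in> V \<Longrightarrow> B (\<lambda>x. u x - v x) w = B u w - B v w"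
  using form_add[of u "\<lambda>x. -1 * v x" w] form_scale[of v w "-1"] scale_mem[of v "-1"] by simp

lemma form_add_right: "u \<in> V \<Longrightarrow> v \<in> V \<Longrightarrow> w \<in> V \<Longrightarrow> B w (\<lambda>x. u x + v x) = B w u + B w v"
  using form_add[of u v w] by (simp add: form_sym add_mem)

lemma form_diff_right: "u \<in> V \<Longrightarrow> v \<in> V \<Longrightarrow> w \<in> V \<Longrightarrow> B w (\<lambda>x. u x - v x) = B w u - B w v"
  using form_diff[of u v w] by (simp add: form_sym diff_mem)

lemma form_scale_right: "v \<in> V \<Longrightarrow> w \<in> V \<Longrightarrow> B w (\<lambda>x. r * v x) = r * B w v"
  using form_scale[of v w r] by (simp add: form_sym scale_mem)

lemmas form_simps = zero_mem add_mem scale_mem diff_mem form_add form_add_right form_diff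
  form_diff_right form_scale form_scale_right

lemma form_expand:
  assumes "v \<in> V" "w \<in> V"
  shows "B (\<lambda>x. v x + t * w x) (\<lambda>x. v x + t * w x) = B v v + 2 * t * B v w + t\<^sup>2 * B w w"
  using assms by (simp add: form_simps form_sym[of w v] power2_eq_square algebra_simps)

text \<open>The quadratic \<open>t \<mapsto> B (v + t w) (v + t w)\<close> is nonnegative. Its value
  at the minimiser gives the bound unless \<open>B w w = 0\<close>, which may happen for nonzero
  \<open>w\<close>; then the quadratic is affine in \<open>t\<close> and must be constant.\<close>

lemma cauchy_schwarz:
  assumes v: "v \<in> V" and w: "w \<in> V"
  shows "\<bar>B v w\<bar> \<le> nrm v * nrm w"
proof -
  have q: "0 \<le> B v v + 2 * t * B v w + t\<^sup>2 * B w w" for t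
    using form_nonneg[of "\<lambda>x. v x + t * w x"] form_expand[OF v w] v w by (simp add: form_simps)
  have "(B v w)\<^sup>2 \<le> B v v * B w w"
  proof (cases "B w w = 0")
    case True
    have "B v w = 0"
    proof (rule ccontr)
      assume "B v w \<noteq> 0"
      then show False
        \<comment> \<open>At this \<open>t\<close> the affine function takes the value -1.\<close>
        using q[of "- (B v v + 1) / (2 * B v w)"] True by (simp add: field_simps)
    qed
    then show ?thesis using True by simp
  next
    case False
    then have "B w w > 0" using form_nonneg[OF w] by simp
    then show ?thesis
      using q[of "- B v w / B w w"] by (simp add: field_simps power2_eq_square)
  qed
  then have "sqrt ((B v w)\<^sup>2) \<le> sqrt (B v v * B w w)" by (rule real_sqrt_le_mono)
  then show ?thesis by (simp add: nrm_def real_sqrt_mult)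
qed

lemma nrm_triangle:
  assumes "v \<in> V" "w \<in> V"
  shows "nrm (\<lambda>x. v x + w x) \<le> nrm v + nrm w"
proof (rule power2_le_imp_le)
  have "(nrm (\<lambda>x. v x + w x))\<^sup>2 = B v v + 2 * B v w + B w w"
    using form_expand[OF assms, of 1] assms by (simp add: nrm_sq form_simps)
  also have "\<dots> \<le> (nrm v)\<^sup>2 + 2 * (nrm v * nrm w) + (nrm w)\<^sup>2"
    using cauchy_schwarz[OF assms] assms by (simp add: nrm_sq)
  also have "\<dots> = (nrm v + nrm w)\<^sup>2" by (simp add: power2_sum)
  finally show "(nrm (\<lambda>x. v x + w x))\<^sup>2 \<le> (nrm v + nrm w)\<^sup>2" .
qed (use assms in \<open>simp add: nrm_nonneg\<close>)

lemma nrm_scale: "v \<in> V \<Longrightarrow> nrm (\<lambda>x. r * v x) = \<bar>r\<bar> * nrm v"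
  by (simp add: nrm_def form_simps flip: mult.assoc power2_eq_square)
    (simp add: real_sqrt_mult)

lemma nrm_diff_commute: "v \<in> V \<Longrightarrow> w \<in> V \<Longrightarrow> nrm (\<lambda>x. v x - w x) = nrm (\<lambda>x. w x - v x)"
  using nrm_scale[of "\<lambda>x. w x - v x" "-1"] by (simp add: form_simps)

lemma nrm_triangle_diff:
  assumes "u \<in> V" "v \<in> V" "w \<in> V"
  shows "nrm (\<lambda>x. u x - w x) \<le> nrm (\<lambda>x. u x - v x) + nrm (\<lambda>x. v x - w x)"
  using nrm_triangle[of "\<lambda>x. u x - v x" "\<lambda>x. v x - w x"] assms by (simp add: form_simps)

lemma nrm_reverse_triangle:
  assumes "v \<in> V" "w \<in> V"
  shows "\<bar>nrm v - nrm w\<bar> \<le> nrm (\<lambda>x. v x - w x)"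
  using nrm_triangle[of "\<lambda>x. v x - w x" w] nrm_triangle[of "\<lambda>x. w x - v x" v]
    nrm_diff_commute[OF assms] assms by (simp add: form_simps)

lemma form_tendsto:
  assumes "\<And>n. X n \<in> V" "v \<in> V" "w \<in> V" and lim: "(\<lambda>n. nrm (\<lambda>x. X n x - v x)) \<longlonglongrightarrow> 0"
  shows "(\<lambda>n. B (X n) w) \<longlonglongrightarrow> B v w"
proof (rule LIM_zero_cancel)
  have lim': "(\<lambda>n. nrm (\<lambda>x. X n x - v x) * nrm w) \<longlonglongrightarrow> 0"
    using tendsto_mult_left_zero[OF lim] by simp
  have "norm (B (X n) w - B v w) \<le> nrm (\<lambda>x. X n x - v x) * nrm w" for n
    using cauchy_schwarz[of "\<lambda>x. X n x - v x" w] assms(1-3) by (simp add: form_simps)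
  then show "(\<lambda>n. B (X n) w - B v w) \<longlonglongrightarrow> 0"
    by (intro Lim_null_comparison[OF always_eventually lim'] allI)
qed

lemma nrm_zero: "nrm (\<lambda>x. 0) = 0"
  using nrm_scale[OF zero_mem, of 0] by simp

text \<open>Dirichlet principle: a minimising sequence of \<open>J\<close> is Cauchy by the
  parallelogram law, and the vanishing first variation at its limit is the claimed identity.
  Completeness is a premise in the seminorm \<open>nrm\<close>, to be supplied for
  \<open>H10\<close>.\<close>

theorem riesz_representation:
  fixes F :: "('a \<Rightarrow> real) \<Rightarrow> real"
  assumes F_add: "\<And>v w. v \<in> V \<Longrightarrow> w \<in> V \<Longrightarrow> F (\<lambda>x. v x + w x) = F v + F w"
    and F_scale: "\<And>v r. v \<in> V \<Longrightarrow> F (\<lambda>x. r * v x) = r * F v"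
    and F_bound: "\<And>v. v \<in> V \<Longrightarrow> \<bar>F v\<bar> \<le> M * nrm v"
    and complete: "\<And>X. (\<And>n::nat. X n \<in> V) \<Longrightarrow>
        (\<And>e. 0 < e \<Longrightarrow> \<exists>k. \<forall>m\<ge>k. \<forall>n\<ge>k. nrm (\<lambda>x. X m x - X n x) < e) \<Longrightarrow>
        \<exists>v\<in>V. (\<lambda>n. nrm (\<lambda>x. X n x - v x)) \<longlonglongrightarrow> 0"
  shows "\<exists>w\<in>V. \<forall>v\<in>V. B w v = F v"
proof -
  define J where "J w = B w w - 2 * F w" for w
  define m where "m = Inf (J ` V)"
  \<comment> \<open>Completing the square: \<open>J w\<close> is at least
    \<open>(nrm w - M)\<^sup>2 - M\<^sup>2\<close>.\<close>
  have J_ge: "- M\<^sup>2 \<le> J w" if "w \<in> V" for w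
    using F_bound[OF that] nrm_sq[OF that] zero_le_power2[of "nrm w - M"]
    by (simp add: J_def power2_diff mult.commute)
  have bdd: "bdd_below (J ` V)" using J_ge by (auto intro!: bdd_belowI)
  have m_le: "m \<le> J w" if "w \<in> V" for w
    unfolding m_def using bdd that by (auto intro: cInf_lower)
  have "\<exists>w\<in>V. J w < m + 1 / real (Suc n)" for n
    using cInf_lessD[of "J ` V" "m + 1 / real (Suc n)"] zero_mem unfolding m_def by auto
  then obtain X where X: "\<And>n. X n \<in> V" and JX: "\<And>n. J (X n) < m + 1 / real (Suc n)"
    by metis
  \<comment> \<open>Parallelogram law at the midpoint \<open>(1/2) * h\<close>, where
    \<open>J\<close> is at least \<open>m\<close>; at the two endpoints \<open>J\<close> exceeds
    \<open>m\<close> by less than \<open>1 / Suc i\<close> and \<open>1 / Suc j\<close>.\<close>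
  have step: "(nrm (\<lambda>x. X i x - X j x))\<^sup>2 \<le> 2 / real (Suc i) + 2 / real (Suc j)" for i j
  proof -
    define h where "h = (\<lambda>x. X i x + X j x)"
    have h: "h \<in> V" using X by (simp add: h_def add_mem)
    have "J (\<lambda>x. (1/2) * h x) = (1/4) * B h h - F h"
      unfolding J_def form_scale_right[OF h scale_mem[OF h]] form_scale[OF h h] F_scale[OF h]
      by simp
    then have "(nrm (\<lambda>x. X i x - X j x))\<^sup>2 = 2 * J (X i) + 2 * J (X j) - 4 * J (\<lambda>x. (1/2) * h x)"
      using X[of i] X[of j]
      by (simp add: nrm_sq J_def h_def form_simps F_add form_sym[of "X j" "X i"] field_simps)
    moreover have "m \<le> J (\<lambda>x. (1/2) * h x)" using h by (intro m_le scale_mem)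
    ultimately show ?thesis using JX[of i] JX[of j] by simp
  qed
  have "\<exists>k. \<forall>i\<ge>k. \<forall>j\<ge>k. nrm (\<lambda>x. X i x - X j x) < e" if "0 < e" for e
  proof -
    obtain k where k: "4 / e\<^sup>2 < real k" using reals_Archimedean2 by blast
    have "nrm (\<lambda>x. X i x - X j x) < e" if "k \<le> i" "k \<le> j" for i j
    proof (rule power2_less_imp_less)
      have k0: "0 < real (Suc k)" by simp
      have "(nrm (\<lambda>x. X i x - X j x))\<^sup>2 \<le> 2 / real (Suc i) + 2 / real (Suc j)" by (rule step)
      also have "\<dots> \<le> 2 / real (Suc k) + 2 / real (Suc k)"
        using that by (intro add_mono divide_left_mono) auto
      also have "\<dots> = 4 / real (Suc k)" by simp
      also have "\<dots> < e\<^sup>2" using k \<open>0 < e\<close> k0 by (simp add: field_simps add_strict_increasing)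
      finally show "(nrm (\<lambda>x. X i x - X j x))\<^sup>2 < e\<^sup>2" .
    qed (use \<open>0 < e\<close> in simp)
    then show ?thesis by blast
  qed
  from complete[OF X this] obtain w where w: "w \<in> V"
    and lim: "(\<lambda>n. nrm (\<lambda>x. X n x - w x)) \<longlonglongrightarrow> 0" by blast
  \<comment> \<open>The variation is performed at \<open>X n\<close>, where \<open>J\<close> is
    within \<open>1 / Suc n\<close> of the infimum, and the resulting inequality is passed to the
    limit. This uses only convergence of \<open>B (X n) v\<close>.\<close>
  have half: "F v \<le> B w v" if v: "v \<in> V" for v
  proof -
    have conv: "(\<lambda>n. B (X n) v) \<longlonglongrightarrow> B w v"
      by (rule form_tendsto[OF X w v lim])
    have "0 \<le> t * (2 * (B w v - F v)) + t\<^sup>2 * B v v" for t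
    proof (rule LIMSEQ_le_const)
      have "(\<lambda>n. 1 / real (Suc n) + (t * (2 * (B (X n) v - F v)) + t\<^sup>2 * B v v))
            \<longlonglongrightarrow> 0 + (t * (2 * (B w v - F v)) + t\<^sup>2 * B v v)"
        by (intro tendsto_intros conv LIMSEQ_Suc lim_1_over_n)
      then show "(\<lambda>n. 1 / real (Suc n) + (t * (2 * (B (X n) v - F v)) + t\<^sup>2 * B v v))
            \<longlonglongrightarrow> t * (2 * (B w v - F v)) + t\<^sup>2 * B v v" by simp
      have "0 \<le> 1 / real (Suc n) + (t * (2 * (B (X n) v - F v)) + t\<^sup>2 * B v v)" for n
      proof -
        have "m \<le> J (\<lambda>x. X n x + t * v x)" using X v by (intro m_le) (simp add: form_simps)
        also have "\<dots> = J (X n) + t * (2 * (B (X n) v - F v)) + t\<^sup>2 * B v v"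
          unfolding J_def form_expand[OF X v]
          using X v by (simp add: F_add F_scale form_simps algebra_simps)
        finally show ?thesis using JX[of n] by simp
      qed
      then show "\<exists>N. \<forall>n\<ge>N. 0 \<le> 1 / real (Suc n) + (t * (2 * (B (X n) v - F v)) + t\<^sup>2 * B v v)"
        by blast
    qed
    from linear_term_nonneg[OF this] show ?thesis by simp
  qed
  have "B w v = F v" if v: "v \<in> V" for v
    using half[OF v] half[OF scale_mem[OF v, of "-1"]] v w form_scale_right[OF v w, of "-1"]
      F_scale[OF v, of "-1"] by simp
  then show ?thesis using w by blast
qed

end

section \<open>The space of square integrable functions\<close>

text \<open>Lebesgue measure is complete, so a change on a null set keeps measurability; extension
  by zero moves the question from \<open>S\<close> to the whole space. The purpose is that the
  representative selected by \<open>weak_partial\<close> is only known almost everywhere.\<close>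

lemma borel_measurable_lebesgue_on_AE:
  fixes f g :: "'a::euclidean_space \<Rightarrow> real"
  assumes S: "S \<in> sets lebesgue" and f: "f \<in> borel_measurable (lebesgue_on S)"
    and eq: "AE x in lebesgue_on S. f x = g x"
  shows "g \<in> borel_measurable (lebesgue_on S)"
proof -
  have "(\<lambda>x. if x \<in> S then f x else 0) \<in> borel_measurable lebesgue"
    using f S by (simp add: borel_measurable_if)
  moreover have "AE x in lebesgue. (if x \<in> S then f x else 0) = (if x \<in> S then g x else 0)"
    using eq S by (simp add: AE_restrict_space_iff)
  ultimately have "(\<lambda>x. if x \<in> S then g x else 0) \<in> borel_measurable lebesgue"
    by (rule borel_measurable_AE)
  then show ?thesis using S by (simp add: borel_measurable_if)
qed

lemma integrable_L2_mult:
  assumes "f \<in> L2 \<Omega>" "g \<in> L2 \<Omega>"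
  shows "integrable (lebesgue_on \<Omega>) (\<lambda>x. f x * g x)"
proof (rule Bochner_Integration.integrable_bound)
  show "integrable (lebesgue_on \<Omega>) (\<lambda>x. (f x)\<^sup>2 + (g x)\<^sup>2)"
    using assms by (simp add: L2_def)
  show "(\<lambda>x. f x * g x) \<in> borel_measurable (lebesgue_on \<Omega>)"
    using assms by (intro borel_measurable_times) (auto simp: L2_def)
  have "\<bar>s * t\<bar> \<le> s\<^sup>2 + t\<^sup>2" for s t :: real
    using zero_le_power2[of "s - t"] zero_le_power2[of "s + t"] zero_le_power2[of s] zero_le_power2[of t]
    unfolding power2_diff power2_sum abs_le_iff by linarith
  then show "AE x in lebesgue_on \<Omega>. norm (f x * g x) \<le> norm ((f x)\<^sup>2 + (g x)\<^sup>2)"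
    by simp
qed

lemma L2_measurable: "f \<in> L2 \<Omega> \<Longrightarrow> f \<in> borel_measurable (lebesgue_on \<Omega>)"
  by (simp add: L2_def)

interpretation L2: psd_form "L2 \<Omega>" "L2_inner \<Omega>"
  rewrites "psd_form.nrm (L2_inner \<Omega>) = L2_norm \<Omega>"
  for \<Omega> :: "(real ^ 'd) set"
proof -
  show "psd_form (L2 \<Omega>) (L2_inner \<Omega>)"
  proof
    fix v w u :: "real ^ 'd \<Rightarrow> real" and r :: real
    show "(\<lambda>x. 0) \<in> L2 \<Omega>" by (simp add: L2_def)
    {
      assume vw: "v \<in> L2 \<Omega>" "w \<in> L2 \<Omega>"
      have "integrable (lebesgue_on \<Omega>) (\<lambda>x. (v x)\<^sup>2 + 2 * (v x * w x) + (w x)\<^sup>2)"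
        using vw integrable_L2_mult[OF vw]
        by (intro Bochner_Integration.integrable_add integrable_mult_right) (auto simp: L2_def)
      then show "(\<lambda>x. v x + w x) \<in> L2 \<Omega>" using borel_measurable_add[OF L2_measurable[OF vw(1)] L2_measurable[OF vw(2)]]
        by (simp add: L2_def power2_sum algebra_simps)
    }
    show "v \<in> L2 \<Omega> \<Longrightarrow> (\<lambda>x. r * v x) \<in> L2 \<Omega>"
      using borel_measurable_times[OF borel_measurable_const L2_measurable]
      by (simp add: L2_def power_mult_distrib)
    show "v \<in> L2 \<Omega> \<Longrightarrow> w \<in> L2 \<Omega> \<Longrightarrow> L2_inner \<Omega> (\<lambda>x. r * v x) w = r * L2_inner \<Omega> v w"
      by (simp add: L2_inner_def mult.assoc)
    show "u \<in> L2 \<Omega> \<Longrightarrow> v \<in> L2 \<Omega> \<Longrightarrow> w \<in> L2 \<Omega> \<Longrightarrow>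
        L2_inner \<Omega> (\<lambda>x. u x + v x) w = L2_inner \<Omega> u w + L2_inner \<Omega> v w"
      by (simp add: L2_inner_def distrib_right integrable_L2_mult)
    show "L2_inner \<Omega> v w = L2_inner \<Omega> w v"
      by (simp add: L2_inner_def mult.commute)
    show "0 \<le> L2_inner \<Omega> v v"
      by (simp add: L2_inner_def integral_nonneg_AE)
  qed
  then show "psd_form.nrm (L2_inner \<Omega>) = L2_norm \<Omega>"
    by (simp add: fun_eq_iff psd_form.nrm_def L2_norm_def)
qed

lemma L2_inner_cong_AE:
  assumes "AE x in lebesgue_on \<Omega>. f x = f' x" "AE x in lebesgue_on \<Omega>. g x = g' x"
    and "f \<in> L2 \<Omega>" "f' \<in> L2 \<Omega>" "g \<in> L2 \<Omega>" "g' \<in> L2 \<Omega>"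
  shows "L2_inner \<Omega> f g = L2_inner \<Omega> f' g'"
  unfolding L2_inner_def using assms by (intro integral_cong_AE) (auto simp: L2_def)

lemma L2_norm_cong_AE:
  assumes "AE x in lebesgue_on \<Omega>. f x = g x" "f \<in> L2 \<Omega>" "g \<in> L2 \<Omega>"
  shows "L2_norm \<Omega> f = L2_norm \<Omega> g"
  unfolding L2_norm_def using L2_inner_cong_AE[OF assms(1,1)] assms by simp

lemma L2_cong_AE:
  assumes S: "\<Omega> \<in> sets lebesgue" and f: "f \<in> L2 \<Omega>" and eq: "AE x in lebesgue_on \<Omega>. f x = g x"
  shows "g \<in> L2 \<Omega>"
proof -
  have g: "g \<in> borel_measurable (lebesgue_on \<Omega>)"
    by (rule borel_measurable_lebesgue_on_AE[OF S L2_measurable[OF f] eq])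
  have i: "integrable (lebesgue_on \<Omega>) (\<lambda>x. (f x)\<^sup>2)"
    using f by (simp add: L2_def)
  have "integrable (lebesgue_on \<Omega>) (\<lambda>x. (g x)\<^sup>2)"
    by (rule integrable_cong_AE_imp[OF i borel_measurable_power[OF g]])
      (rule eventually_mono[OF eq], simp)
  with g show ?thesis by (simp add: L2_def)
qed

text \<open>Domination by a multiple of an \<open>L2\<close> function; the bounded factors to come
  are the coefficients of the equation and, for the Poincare inequality, a coordinate
  function.\<close>

lemma L2_norm_bounded:
  assumes f: "f \<in> L2 \<Omega>" and g: "g \<in> borel_measurable (lebesgue_on \<Omega>)"
    and le: "AE x in lebesgue_on \<Omega>. \<bar>g x\<bar> \<le> M * \<bar>f x\<bar>" and M: "0 \<le> M"
  shows "g \<in> L2 \<Omega>" and "L2_norm \<Omega> g \<le> M * L2_norm \<Omega> f"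
proof -
  have sq: "AE x in lebesgue_on \<Omega>. (g x)\<^sup>2 \<le> M\<^sup>2 * (f x)\<^sup>2"
    using le
  proof (rule eventually_mono)
    fix x assume "\<bar>g x\<bar> \<le> M * \<bar>f x\<bar>"
    then have "\<bar>g x\<bar>\<^sup>2 \<le> (M * \<bar>f x\<bar>)\<^sup>2" by (intro power_mono) auto
    then show "(g x)\<^sup>2 \<le> M\<^sup>2 * (f x)\<^sup>2" by (simp add: power_mult_distrib)
  qed
  have int: "integrable (lebesgue_on \<Omega>) (\<lambda>x. M\<^sup>2 * (f x)\<^sup>2)" using f by (simp add: L2_def)
  have "integrable (lebesgue_on \<Omega>) (\<lambda>x. (g x)\<^sup>2)"
    using sq g by (intro Bochner_Integration.integrable_bound[OF int]) auto
  then show gL: "g \<in> L2 \<Omega>" using g by (simp add: L2_def)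
  have "L2_inner \<Omega> g g \<le> M\<^sup>2 * L2_inner \<Omega> f f"
    using integral_mono_AE[OF _ int sq] gL by (simp add: L2_inner_def L2_def power2_eq_square)
  then have "sqrt (L2_inner \<Omega> g g) \<le> sqrt (M\<^sup>2 * L2_inner \<Omega> f f)" by (rule real_sqrt_le_mono)
  then show "L2_norm \<Omega> g \<le> M * L2_norm \<Omega> f" using M by (simp add: L2_norm_def real_sqrt_mult)
qed

lemma LinfE:
  assumes "k \<in> Linf \<Omega>"
  obtains M where "0 \<le> M" "AE x in lebesgue_on \<Omega>. \<bar>k x\<bar> \<le> M" "k \<in> borel_measurable (lebesgue_on \<Omega>)"
proof -
  from assms obtain M where "AE x in lebesgue_on \<Omega>. \<bar>k x\<bar> \<le> M" "k \<in> borel_measurable (lebesgue_on \<Omega>)"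
    by (auto simp: Linf_def)
  then show ?thesis by (intro that[of "\<bar>M\<bar>"]) (auto elim: eventually_mono)
qed

lemma Linf_mult_L2:
  assumes "k \<in> Linf \<Omega>"
  shows "f \<in> L2 \<Omega> \<Longrightarrow> (\<lambda>x. k x * f x) \<in> L2 \<Omega>"
    and "\<exists>M\<ge>0. \<forall>f\<in>L2 \<Omega>. L2_norm \<Omega> (\<lambda>x. k x * f x) \<le> M * L2_norm \<Omega> f"
proof -
  obtain M where M: "0 \<le> M" "AE x in lebesgue_on \<Omega>. \<bar>k x\<bar> \<le> M" "k \<in> borel_measurable (lebesgue_on \<Omega>)"
    using LinfE[OF assms] by blast
  have b: "AE x in lebesgue_on \<Omega>. \<bar>k x * f x\<bar> \<le> M * \<bar>f x\<bar>" for f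
    using M(2) by (rule eventually_mono) (auto simp: abs_mult intro: mult_right_mono)
  have m: "f \<in> L2 \<Omega> \<Longrightarrow> (\<lambda>x. k x * f x) \<in> borel_measurable (lebesgue_on \<Omega>)" for f
    using M(3) L2_measurable by (intro borel_measurable_times)
  show "f \<in> L2 \<Omega> \<Longrightarrow> (\<lambda>x. k x * f x) \<in> L2 \<Omega>"
    by (rule L2_norm_bounded(1)[OF _ m b M(1)])
  show "\<exists>M\<ge>0. \<forall>f\<in>L2 \<Omega>. L2_norm \<Omega> (\<lambda>x. k x * f x) \<le> M * L2_norm \<Omega> f"
    using L2_norm_bounded(2)[OF _ m b M(1)] M(1) by blast
qed

lemma bounded_in_L2:
  assumes "finite_measure (lebesgue_on \<Omega>)" "f \<in> borel_measurable (lebesgue_on \<Omega>)"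
    and "AE x in lebesgue_on \<Omega>. \<bar>f x\<bar> \<le> M"
  shows "f \<in> L2 \<Omega>"
proof -
  have "AE x in lebesgue_on \<Omega>. norm ((f x)\<^sup>2) \<le> M\<^sup>2"
    using assms(3) by (rule eventually_mono) (simp add: abs_le_square_iff[symmetric])
  then show ?thesis
    unfolding L2_def using assms(2)
    by (auto intro: finite_measure.integrable_const_bound[OF assms(1), of _ "M\<^sup>2"])
qed

text \<open>Riesz-Fischer. A subsequence with geometrically small increments converges almost
  everywhere, because the \<open>L1\<close> norms of the increments are summable; finiteness of the
  measure bounds these by the \<open>L2\<close> norms. Fatou's lemma then turns the Cauchy property
  into convergence in norm.\<close>

theorem L2_complete:
  assumes fin: "finite_measure (lebesgue_on \<Omega>)"
    and X: "\<And>n::nat. X n \<in> L2 \<Omega>"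
    and cauchy: "\<And>e. 0 < e \<Longrightarrow> \<exists>k. \<forall>m\<ge>k. \<forall>n\<ge>k. L2_norm \<Omega> (\<lambda>x. X m x - X n x) < e"
  shows "\<exists>f\<in>L2 \<Omega>. (\<lambda>n. L2_norm \<Omega> (\<lambda>x. X n x - f x)) \<longlonglongrightarrow> 0"
proof -
  let ?M = "lebesgue_on \<Omega>"
  interpret finite_measure ?M by fact
  have one: "(\<lambda>x. 1) \<in> L2 \<Omega>" by (simp add: L2_def)
  obtain K where K: "\<And>j m n. K j \<le> m \<Longrightarrow> K j \<le> n \<Longrightarrow> L2_norm \<Omega> (\<lambda>x. X m x - X n x) < (1/2) ^ j"
  proof -
    have "\<forall>j. \<exists>k. \<forall>m\<ge>k. \<forall>n\<ge>k. L2_norm \<Omega> (\<lambda>x. X m x - X n x) < (1/2) ^ j"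
      using cauchy by simp
    from choice[OF this] show ?thesis using that by blast
  qed
  \<comment> \<open>Summing the thresholds ensures \<open>K k \<le> r k\<close> and
    \<open>K k \<le> r (Suc k)\<close> at once, so the increment from \<open>r k\<close> to
    \<open>r (Suc k)\<close> is below \<open>(1/2) ^ k\<close> in norm; adding \<open>k\<close>
    makes the indices tend to infinity.\<close>
  define r where "r k = (\<Sum>i\<le>k. K i) + k" for k
  have rK: "K k \<le> r k" "K k \<le> r (Suc k)" "k \<le> r k" for k
    using member_le_sum[of k "{..k}" K] by (auto simp: r_def)
  note [measurable] = L2_measurable[OF X]
  define D where "D k x = \<bar>X (r (Suc k)) x - X (r k) x\<bar>" for k x
  have D_meas[measurable]: "D k \<in> borel_measurable ?M" for k unfolding D_def by measurable
  have DL: "(\<lambda>x. X (r (Suc k)) x - X (r k) x) \<in> L2 \<Omega>" for k by (intro L2.diff_mem X)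
  have DL2: "D k \<in> L2 \<Omega>" for k
    using DL[of k] L2_norm_bounded(1)[OF DL[of k] D_meas[of k], of 1] by (simp add: D_def)
  have int_D: "(\<integral>\<^sup>+ x. ennreal (D k x) \<partial>?M) \<le> ennreal (L2_norm \<Omega> (\<lambda>x. 1) * (1/2) ^ k)" for k
  proof -
    have "integrable ?M (D k)" using integrable_L2_mult[OF DL2[of k] one] by simp
    then have "(\<integral>\<^sup>+ x. ennreal (D k x) \<partial>?M) = ennreal (\<integral>x. D k x \<partial>?M)"
      by (intro nn_integral_eq_integral) (simp_all add: D_def[abs_def])
    also have "(\<integral>x. D k x \<partial>?M) = L2_inner \<Omega> (D k) (\<lambda>x. 1)" by (simp add: L2_inner_def)
    also have "\<dots> \<le> L2_norm \<Omega> (D k) * L2_norm \<Omega> (\<lambda>x. 1)"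
      using L2.cauchy_schwarz[OF DL2[of k] one] by simp
    also have "L2_norm \<Omega> (D k) = L2_norm \<Omega> (\<lambda>x. X (r (Suc k)) x - X (r k) x)"
      by (simp add: L2_norm_def L2_inner_def D_def)
    also have "\<dots> * L2_norm \<Omega> (\<lambda>x. 1) \<le> (1/2) ^ k * L2_norm \<Omega> (\<lambda>x. 1)"
      by (intro mult_right_mono L2.nrm_nonneg[OF one] less_imp_le[OF K] rK)
    finally show ?thesis by (simp add: mult.commute ennreal_leI)
  qed
  have "(\<integral>\<^sup>+ x. (\<Sum>k. ennreal (D k x)) \<partial>?M) = (\<Sum>k. \<integral>\<^sup>+ x. ennreal (D k x) \<partial>?M)"
    by (rule nn_integral_suminf) measurable
  also have "\<dots> \<le> (\<Sum>k. ennreal (L2_norm \<Omega> (\<lambda>x. 1) * (1/2) ^ k))"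
    by (intro suminf_le int_D) auto
  also have "\<dots> = ennreal (\<Sum>k. L2_norm \<Omega> (\<lambda>x. 1) * (1/2) ^ k)"
    using L2.nrm_nonneg[OF one] by (intro suminf_ennreal2) (auto intro: summable_mult)
  also have "\<dots> < \<infinity>" by simp
  finally have "AE x in ?M. (\<Sum>k. ennreal (D k x)) \<noteq> \<infinity>"
    by (intro nn_integral_PInf_AE) auto
  then have conv: "AE x in ?M. convergent (\<lambda>k. X (r k) x)"
  proof (rule eventually_mono)
    fix x assume "(\<Sum>k. ennreal (D k x)) \<noteq> \<infinity>"
    then have "summable (\<lambda>k. D k x)" by (intro summable_suminf_not_top) (auto simp: D_def)
    then have "summable (\<lambda>k. X (r (Suc k)) x - X (r k) x)"
      by (auto simp: D_def intro: summable_rabs_cancel)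
    then have "convergent (\<lambda>n. X (r n) x - X (r 0) x)"
      unfolding summable_iff_convergent using sum_lessThan_telescope[of "\<lambda>k. X (r k) x"] by simp
    then show "convergent (\<lambda>k. X (r k) x)"
      using convergent_diff_const_right_iff[of "\<lambda>k. X (r k) x" "X (r 0) x"] by simp
  qed
  \<comment> \<open>Where the subsequence diverges, \<open>f\<close> takes whatever value
    \<open>lim\<close> denotes; this is a null set, and \<open>f\<close> is measurable all the
    same.\<close>
  define f where "f x = lim (\<lambda>k. X (r k) x)" for x
  have f[measurable]: "f \<in> borel_measurable ?M"
    unfolding f_def by (intro borel_measurable_lim_metric) measurable
  have lim: "AE x in ?M. (\<lambda>k. X (r k) x) \<longlonglongrightarrow> f x"
    using conv by (rule eventually_mono) (simp add: f_def convergent_LIMSEQ_iff)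
  have close: "(\<lambda>x. X n x - f x) \<in> L2 \<Omega> \<and> L2_norm \<Omega> (\<lambda>x. X n x - f x) \<le> e"
    if e: "0 < e" and k: "\<forall>m\<ge>k. \<forall>n\<ge>k. L2_norm \<Omega> (\<lambda>x. X m x - X n x) < e" and n: "k \<le> n" for e k n
  proof -
    have bnd: "(\<integral>\<^sup>+ x. ennreal ((X n x - X (r j) x)\<^sup>2) \<partial>?M) \<le> ennreal (e\<^sup>2)" if "k \<le> j" for j
    proof -
      have dj: "(\<lambda>x. X n x - X (r j) x) \<in> L2 \<Omega>" by (intro L2.diff_mem X)
      have "(\<integral>\<^sup>+ x. ennreal ((X n x - X (r j) x)\<^sup>2) \<partial>?M) = ennreal (\<integral>x. (X n x - X (r j) x)\<^sup>2 \<partial>?M)"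
        using dj by (intro nn_integral_eq_integral) (auto simp: L2_def)
      also have "(\<integral>x. (X n x - X (r j) x)\<^sup>2 \<partial>?M) = (L2_norm \<Omega> (\<lambda>x. X n x - X (r j) x))\<^sup>2"
        unfolding L2.nrm_sq[OF dj] by (simp add: L2_inner_def power2_eq_square)
      also have "\<dots> \<le> e\<^sup>2"
        using k[rule_format, OF n order_trans[OF that rK(3)]] L2.nrm_nonneg[OF dj]
        by (intro power_mono) simp_all
      finally show ?thesis by (simp add: ennreal_leI)
    qed
    have "(\<integral>\<^sup>+ x. ennreal ((X n x - f x)\<^sup>2) \<partial>?M)
          = (\<integral>\<^sup>+ x. liminf (\<lambda>j. ennreal ((X n x - X (r j) x)\<^sup>2)) \<partial>?M)"
    proof (rule nn_integral_cong_AE, rule eventually_mono[OF lim])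
      fix x assume "(\<lambda>k. X (r k) x) \<longlonglongrightarrow> f x"
      then have "(\<lambda>j. ennreal ((X n x - X (r j) x)\<^sup>2)) \<longlonglongrightarrow> ennreal ((X n x - f x)\<^sup>2)"
        by (intro tendsto_ennrealI tendsto_power tendsto_diff tendsto_const)
      then show "ennreal ((X n x - f x)\<^sup>2) = liminf (\<lambda>j. ennreal ((X n x - X (r j) x)\<^sup>2))"
        by (rule lim_imp_Liminf[OF sequentially_bot, symmetric])
    qed
    \<comment> \<open>Fatou's lemma, with \<open>X n\<close> fixed and the index of the subsequence
      tending to infinity.\<close>
    also have "\<dots> \<le> liminf (\<lambda>j. \<integral>\<^sup>+ x. ennreal ((X n x - X (r j) x)\<^sup>2) \<partial>?M)"
      by (intro nn_integral_liminf) measurable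
    also have "\<dots> \<le> limsup (\<lambda>j. \<integral>\<^sup>+ x. ennreal ((X n x - X (r j) x)\<^sup>2) \<partial>?M)"
      by (rule Liminf_le_Limsup) simp
    also have "\<dots> \<le> ennreal (e\<^sup>2)"
      using bnd by (intro Limsup_bounded eventually_sequentiallyI[of k]) auto
    finally have le: "(\<integral>\<^sup>+ x. ennreal ((X n x - f x)\<^sup>2) \<partial>?M) \<le> ennreal (e\<^sup>2)" .
    have int: "integrable ?M (\<lambda>x. (X n x - f x)\<^sup>2)"
    proof (rule integrableI_nonneg)
      show "(\<integral>\<^sup>+ x. ennreal ((X n x - f x)\<^sup>2) \<partial>?M) < \<infinity>"
        using le_less_trans[OF le ennreal_less_top] by simp
    qed simp_all
    then have L: "(\<lambda>x. X n x - f x) \<in> L2 \<Omega>" by (simp add: L2_def)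
    have "(L2_norm \<Omega> (\<lambda>x. X n x - f x))\<^sup>2 = (\<integral>x. (X n x - f x)\<^sup>2 \<partial>?M)"
      unfolding L2.nrm_sq[OF L] by (simp add: L2_inner_def power2_eq_square)
    also have "ennreal \<dots> \<le> ennreal (e\<^sup>2)"
      using le nn_integral_eq_integral[OF int] by simp
    finally have "ennreal ((L2_norm \<Omega> (\<lambda>x. X n x - f x))\<^sup>2) \<le> ennreal (e\<^sup>2)" .
    then have "(L2_norm \<Omega> (\<lambda>x. X n x - f x))\<^sup>2 \<le> e\<^sup>2"
      by (rule ennreal_le_iff[OF zero_le_power2, THEN iffD1])
    then have "L2_norm \<Omega> (\<lambda>x. X n x - f x) \<le> e" by (rule power2_le_imp_le) (use e in simp)
    with L show ?thesis by blast
  qed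
  obtain k1 where k1: "\<forall>m\<ge>k1. \<forall>n\<ge>k1. L2_norm \<Omega> (\<lambda>x. X m x - X n x) < 1"
    using cauchy[OF zero_less_one] by blast
  have "(\<lambda>x. X k1 x - (X k1 x - f x)) \<in> L2 \<Omega>"
    by (rule L2.diff_mem[OF X conjunct1[OF close[OF zero_less_one k1 order_refl]]])
  then have fL: "f \<in> L2 \<Omega>" by simp
  moreover have "(\<lambda>n. L2_norm \<Omega> (\<lambda>x. X n x - f x)) \<longlonglongrightarrow> 0"
  proof (rule LIMSEQ_I)
    fix e :: real assume "0 < e"
    then obtain k where k: "\<forall>m\<ge>k. \<forall>n\<ge>k. L2_norm \<Omega> (\<lambda>x. X m x - X n x) < e/2"
      using cauchy[of "e/2"] half_gt_zero[of e] by blast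
    have "norm (L2_norm \<Omega> (\<lambda>x. X n x - f x) - 0) < e" if "k \<le> n" for n
    proof -
      have "L2_norm \<Omega> (\<lambda>x. X n x - f x) \<le> e/2" using close[OF _ k that] \<open>0 < e\<close> by simp
      then show ?thesis using L2.nrm_nonneg[OF L2.diff_mem[OF X fL], of n] \<open>0 < e\<close> by simp
    qed
    then show "\<exists>no. \<forall>n\<ge>no. norm (L2_norm \<Omega> (\<lambda>x. X n x - f x) - 0) < e" by blast
  qed
  ultimately show ?thesis by blast
qed

section \<open>Test functions\<close>

lemma partial_eqI: "(f has_derivative D) (at x) \<Longrightarrow> partial i f x = D (axis i 1)"
  unfolding partial_def by (simp flip: frechet_derivative_at)

lemma partial_add:
  assumes "f differentiable (at x)" "g differentiable (at x)"
  shows "partial i (\<lambda>x. f x + g x) x = partial i f x + partial i g x"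
  by (rule partial_eqI[OF has_derivative_add[OF assms[unfolded frechet_derivative_works]], of i,
        folded partial_def])

lemma partial_mult:
  assumes "f differentiable (at x)" "g differentiable (at x)"
  shows "partial i (\<lambda>x. f x * g x) x = f x * partial i g x + partial i f x * g x"
  by (rule partial_eqI[OF has_derivative_mult[OF assms[unfolded frechet_derivative_works]], of i,
        folded partial_def])

lemma partial_const: "partial i (\<lambda>x. k) x = 0"
  by (simp add: partial_eqI[OF has_derivative_const])

lemma partial_coordinate: "partial i (\<lambda>x. x $ j) x = (if i = j then 1 else 0)"
proof -
  have "((\<lambda>x. x $ j) has_derivative (\<lambda>h. h $ j)) (at x)"
    by (rule bounded_linear.has_derivative[OF bounded_linear_vec_nth has_derivative_ident])
  from partial_eqI[OF this] show ?thesis by (simp add: axis_def)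
qed

lemma Ck_imp_continuous: "Ck k f \<Longrightarrow> continuous_on UNIV f"
  by (cases k) (auto simp: continuous_at_imp_continuous_on differentiable_imp_continuous_within)

lemma Ck_Suc_imp: "Ck (Suc k) f \<Longrightarrow> Ck k f"
proof (induction k arbitrary: f)
  case 0
  then show ?case using Ck_imp_continuous[OF 0] by simp
next
  case (Suc k)
  then show ?case by simp
qed

lemma Ck_const: "Ck k (\<lambda>x. r)"
  by (induction k arbitrary: r) (simp_all add: partial_const[abs_def])

lemma Ck_add: "Ck k f \<Longrightarrow> Ck k g \<Longrightarrow> Ck k (\<lambda>x. f x + g x)"
proof (induction k arbitrary: f g)
  case 0
  then show ?case by (simp add: continuous_on_add)
next
  case (Suc k)
  then have "partial i (\<lambda>x. f x + g x) = (\<lambda>x. partial i f x + partial i g x)" for i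
    by (auto simp: partial_add)
  with Suc show ?case by simp
qed

text \<open>By the product rule the partial derivatives mix the factors with their derivatives, so
  the induction step also needs the factors themselves at the lower order \<open>k\<close>.\<close>

lemma Ck_mult: "Ck k f \<Longrightarrow> Ck k g \<Longrightarrow> Ck k (\<lambda>x. f x * g x)"
proof (induction k arbitrary: f g)
  case 0
  then show ?case by (simp add: continuous_on_mult)
next
  case (Suc k)
  then have "partial i (\<lambda>x. f x * g x) = (\<lambda>x. f x * partial i g x + partial i f x * g x)" for i
    by (auto simp: partial_mult)
  with Suc Ck_Suc_imp[OF Suc.prems(1)] Ck_Suc_imp[OF Suc.prems(2)] show ?case
    by (simp add: Ck_add)
qed

lemma Ck_prod: "finite I \<Longrightarrow> (\<And>i. i \<in> I \<Longrightarrow> Ck k (f i)) \<Longrightarrow> Ck k (\<lambda>x. \<Prod>i\<in>I. f i x)"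
  by (induction I rule: finite_induct) (simp_all add: Ck_const Ck_mult)

text \<open>The factors \<open>1 / t ^ m\<close> make this family closed under differentiation up to linear
  combinations.\<close>

definition flat_exp :: "nat \<Rightarrow> real \<Rightarrow> real" where
  "flat_exp m t = (if 0 < t then exp (- 1 / t) / t ^ m else 0)"

text \<open>From the right, the substitution \<open>inverse t\<close> reduces the limit to
  exponential growth beating every power; from the left the function is zero.\<close>

lemma flat_exp_tendsto_0: "(flat_exp m \<longlongrightarrow> 0) (at 0)"
proof (rule filterlim_split_at)
  show "(flat_exp m \<longlongrightarrow> 0) (at_left 0)"
    by (rule tendsto_eventually) (auto simp: flat_exp_def eventually_at_filter)
  have "((\<lambda>t. inverse t ^ m / exp (inverse t)) \<longlongrightarrow> (0::real)) (at_right 0)"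
    by (rule filterlim_compose[OF tendsto_power_div_exp_0 filterlim_inverse_at_top_right])
  moreover have "eventually (\<lambda>t. inverse t ^ m / exp (inverse t) = flat_exp m t) (at_right 0)"
    by (auto simp: flat_exp_def eventually_at_filter exp_minus divide_simps power_inverse)
  ultimately show "(flat_exp m \<longlongrightarrow> 0) (at_right 0)"
    by (rule Lim_transform_eventually)
qed

text \<open>At the origin the difference quotient of \<open>flat_exp m\<close> is
  \<open>flat_exp (Suc m)\<close>, whose limit is already known to be zero; elsewhere this is
  elementary calculus.\<close>

lemma flat_exp_deriv:
  "(flat_exp m has_real_derivative flat_exp (m + 2) t - real m * flat_exp (m + 1) t) (at t)"
proof (cases t "0 :: real" rule: linorder_cases)
  case less
  have "((\<lambda>t. 0) has_real_derivative 0) (at t)" by simp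
  then have "(flat_exp m has_real_derivative 0) (at t)"
    by (rule has_field_derivative_transform_within_open[of _ _ _ "{..<0}"])
      (use less in \<open>auto simp: flat_exp_def\<close>)
  with less show ?thesis by (simp add: flat_exp_def)
next
  case equal
  have "((\<lambda>h. (flat_exp m (0 + h) - flat_exp m 0) / h) \<longlongrightarrow> 0) (at 0)"
    using flat_exp_tendsto_0[of "Suc m"]
    by (rule Lim_transform_eventually) (auto simp: flat_exp_def eventually_at_filter)
  then have "(flat_exp m has_real_derivative 0) (at 0)" by (simp add: DERIV_def)
  with equal show ?thesis by (simp add: flat_exp_def)
next
  case greater
  have "((\<lambda>t. exp (- 1 / t) / t ^ m) has_real_derivative
      exp (- 1 / t) / t ^ (m + 2) - real m * (exp (- 1 / t) / t ^ (m + 1))) (at t)"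
  proof -
    have E: "((\<lambda>t. exp (- 1 / t)) has_real_derivative exp (- 1 / t) / t\<^sup>2) (at t)"
      using greater by (auto intro!: derivative_eq_intros simp: field_simps power2_eq_square)
    have P: "((\<lambda>t. t ^ m) has_real_derivative real m * t ^ m / t) (at t)"
      using DERIV_pow[of m t UNIV] greater by (cases m) simp_all
    show ?thesis
      by (rule DERIV_cong[OF DERIV_divide[OF E P]])
        (use greater in \<open>simp_all add: field_simps power2_eq_square\<close>)
  qed
  then have "(flat_exp m has_real_derivative
      exp (- 1 / t) / t ^ (m + 2) - real m * (exp (- 1 / t) / t ^ (m + 1))) (at t)"
    by (rule has_field_derivative_transform_within_open[of _ _ _ "{0<..}"])
      (use greater in \<open>auto simp: flat_exp_def\<close>)
  with greater show ?thesis by (simp add: flat_exp_def)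
qed

section \<open>Smooth bump functions on boxes\<close>

lemma Ck_flat_exp: "Ck k (\<lambda>x :: real ^ 'd::finite. flat_exp m (s * (x $ i) + t))"
proof (induction k arbitrary: m)
  case 0
  have "continuous_on UNIV (flat_exp m)"
    using flat_exp_deriv DERIV_isCont by (blast intro: continuous_at_imp_continuous_on)
  then have "continuous_on UNIV (\<lambda>x :: real ^ 'd. flat_exp m (s * (x $ i) + t))"
    by (rule continuous_on_compose2) (auto intro!: continuous_intros)
  then show ?case by simp
next
  case (Suc k)
  let ?F = "\<lambda>m (x :: real ^ 'd). flat_exp m (s * (x $ i) + t)"
  have D: "(?F m has_derivative
      (\<lambda>h. (?F (m + 2) x - real m * ?F (m + 1) x) * (s * (h $ i)))) (at x)" for x
  proof -
    have "((\<lambda>x. s * (x $ i) + t) has_derivative (\<lambda>h. s * (h $ i))) (at x)"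
      by (auto intro!: derivative_eq_intros bounded_linear.has_derivative[OF bounded_linear_vec_nth])
    from DERIV_compose_FDERIV[OF flat_exp_deriv this] show ?thesis
      by (simp add: mult.commute)
  qed
  have P: "partial j (?F m) =
      (\<lambda>x. (if j = i then s else 0) * (?F (m + 2) x + (- real m) * ?F (m + 1) x))" for j
    by (auto simp: fun_eq_iff partial_eqI[OF D] axis_def)
  have "Ck k (partial j (?F m))" for j
    unfolding P by (intro Ck_mult Ck_const Ck_add Suc.IH)
  moreover have "?F m differentiable (at x)" for x
    using D unfolding differentiable_def by blast
  ultimately show ?case by simp
qed

text \<open>A substitute for mollifiers: each coordinate contributes one factor vanishing to the
  left of \<open>a $ i\<close> and one vanishing to the right of \<open>b $ i\<close>. Growing
  \<open>n\<close> steepens the factors while the support stays in the box, so the bumps tend to the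
  indicator of the open box. \<open>Suc n\<close> keeps the scale positive; the signs are arranged
  to match \<open>Ck_flat_exp\<close>.\<close>

definition box_bump :: "real ^ 'd::finite \<Rightarrow> real ^ 'd \<Rightarrow> nat \<Rightarrow> real ^ 'd \<Rightarrow> real" where
  "box_bump a b n x =
     (\<Prod>i\<in>UNIV. flat_exp 0 (real (Suc n) * (x $ i) + - real (Suc n) * (a $ i)) *
                flat_exp 0 (- real (Suc n) * (x $ i) + real (Suc n) * (b $ i)))"

lemma box_bump_factor:
  "flat_exp 0 (real (Suc n) * s + - real (Suc n) * t) =
    (if t < s then exp (- 1 / (real (Suc n) * (s - t))) else 0)"
  "flat_exp 0 (- real (Suc n) * s + real (Suc n) * t) =
    (if s < t then exp (- 1 / (real (Suc n) * (t - s))) else 0)"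
proof -
  have e: "real (Suc n) * s + - real (Suc n) * t = real (Suc n) * (s - t)"
    "- real (Suc n) * s + real (Suc n) * t = real (Suc n) * (t - s)"
    by (simp_all add: algebra_simps)
  show "flat_exp 0 (real (Suc n) * s + - real (Suc n) * t) =
    (if t < s then exp (- 1 / (real (Suc n) * (s - t))) else 0)"
    unfolding e by (simp add: flat_exp_def zero_less_mult_iff)
  show "flat_exp 0 (- real (Suc n) * s + real (Suc n) * t) =
    (if s < t then exp (- 1 / (real (Suc n) * (t - s))) else 0)"
    unfolding e by (simp add: flat_exp_def zero_less_mult_iff)
qed

lemma box_bump_eq_0: "x \<notin> box a b \<Longrightarrow> box_bump a b n x = 0"
  unfolding box_bump_def mem_box_cart box_bump_factor by (auto intro!: prod_zero)

lemma flat_exp_0_bounds: "0 \<le> flat_exp 0 t" "flat_exp 0 t \<le> 1"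
  by (simp_all add: flat_exp_def)

lemma box_bump_bounds: "0 \<le> box_bump a b n x" "box_bump a b n x \<le> 1"
  unfolding box_bump_def
  by (intro prod_nonneg prod_le_1 ballI conjI mult_nonneg_nonneg mult_le_one flat_exp_0_bounds)+

lemma box_bump_tendsto:
  fixes a b x :: "real ^ 'd::finite"
  shows "(\<lambda>n. box_bump a b n x) \<longlonglongrightarrow> indicator (box a b) x"
proof (cases "x \<in> box a b")
  case True
  have e: "(\<lambda>n. exp (- 1 / (real (Suc n) * r))) \<longlonglongrightarrow> 1" if "0 < r" for r
  proof -
    have "(\<lambda>n. - (1 / r) * (1 / real (Suc n))) \<longlonglongrightarrow> - (1 / r) * 0"
      by (intro tendsto_mult tendsto_const LIMSEQ_Suc lim_1_over_n)
    then have "(\<lambda>n. exp (- (1 / r) * (1 / real (Suc n)))) \<longlonglongrightarrow> exp (- (1 / r) * 0)"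
      by (rule tendsto_exp)
    then show ?thesis by (simp add: field_simps)
  qed
  have "(\<lambda>n. box_bump a b n x) \<longlonglongrightarrow> (\<Prod>i\<in>(UNIV :: 'd set). 1 * 1)"
    unfolding box_bump_def box_bump_factor
  proof (intro tendsto_prod tendsto_mult)
    fix i :: 'd
    have i: "a $ i < x $ i" "x $ i < b $ i" using True by (simp_all add: mem_box_cart)
    show "(\<lambda>n. if a $ i < x $ i then exp (- 1 / (real (Suc n) * (x $ i - a $ i))) else 0) \<longlonglongrightarrow> 1"
      using e[of "x $ i - a $ i"] i by simp
    show "(\<lambda>n. if x $ i < b $ i then exp (- 1 / (real (Suc n) * (b $ i - x $ i))) else 0) \<longlonglongrightarrow> 1"
      using e[of "b $ i - x $ i"] i by simp
  qed
  with True show ?thesis by simp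
qed (simp add: box_bump_eq_0)

lemma box_bump_test_function:
  assumes "cbox a b \<subseteq> \<Omega>"
  shows "box_bump a b n \<in> test_functions \<Omega>"
proof -
  have "{x. box_bump a b n x \<noteq> 0} \<subseteq> cbox a b"
    using box_bump_eq_0 box_subset_cbox by blast
  then have cl: "closure {x. box_bump a b n x \<noteq> 0} \<subseteq> cbox a b"
    by (rule closure_minimal) (rule closed_cbox)
  have "compact (cbox a b \<inter> closure {x. box_bump a b n x \<noteq> 0})"
    by (intro compact_Int_closed) auto
  then have "compact (closure {x. box_bump a b n x \<noteq> 0})"
    using cl by (simp add: Int_absorb1)
  moreover have "Ck k (box_bump a b n)" for k
    unfolding box_bump_def[abs_def] by (intro Ck_prod finite Ck_mult Ck_flat_exp)
  ultimately show ?thesis using cl assms unfolding test_functions_def by blast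
qed

section \<open>Supports of test functions and pairings with them\<close>

lemma test_function_Ck: "\<phi> \<in> test_functions \<Omega> \<Longrightarrow> Ck k \<phi>"
  by (simp add: test_functions_def)

lemma test_function_differentiable: "\<phi> \<in> test_functions \<Omega> \<Longrightarrow> \<phi> differentiable (at x)"
  using test_function_Ck[of \<phi> \<Omega> "Suc 0"] by simp

lemma test_function_continuous:
  "\<phi> \<in> test_functions \<Omega> \<Longrightarrow> continuous_on UNIV \<phi>"
  "\<phi> \<in> test_functions \<Omega> \<Longrightarrow> continuous_on UNIV (partial i \<phi>)"
  using test_function_Ck[of \<phi> \<Omega> "Suc 0"] Ck_imp_continuous test_function_Ck[of \<phi> \<Omega> 0]
  by simp_all

lemma partial_eq_0_outside:
  assumes "closed K" "\<And>x. x \<notin> K \<Longrightarrow> f x = 0" "x \<notin> K"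
  shows "partial i f x = 0"
proof -
  have "((\<lambda>x. 0 :: real) has_derivative (\<lambda>h. 0)) (at x)" by simp
  then have "(f has_derivative (\<lambda>h. 0)) (at x)"
    by (rule has_derivative_transform_within_open[of _ _ _ _ "- K"])
      (simp_all add: assms open_Compl)
  from partial_eqI[OF this] show ?thesis .
qed

lemma test_function_support:
  assumes "\<phi> \<in> test_functions \<Omega>"
  shows "\<exists>K. compact K \<and> K \<subseteq> \<Omega> \<and> (\<forall>x. x \<notin> K \<longrightarrow> \<phi> x = 0 \<and> (\<forall>i. partial i \<phi> x = 0))"
proof (intro exI conjI allI impI)
  let ?K = "closure {x. \<phi> x \<noteq> 0}"
  show "compact ?K" "?K \<subseteq> \<Omega>" using assms by (simp_all add: test_functions_def)
  show z: "\<phi> x = 0" if "x \<notin> ?K" for x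
    using that by (metis (mono_tags) closure_subset mem_Collect_eq subsetD)
  show "partial i \<phi> x = 0" if "x \<notin> ?K" for x i
    by (rule partial_eq_0_outside[OF closed_closure z that])
qed

lemma set_integrable_mult_continuous:
  fixes g \<phi> :: "real ^ 'd \<Rightarrow> real"
  assumes g: "g absolutely_integrable_on K" and K: "compact K" and \<phi>: "continuous_on UNIV \<phi>"
  shows "(\<lambda>x. g x * \<phi> x) absolutely_integrable_on K"
proof -
  have Ks: "K \<in> sets lebesgue" using K by (simp add: fmeasurableD lmeasurable_compact)
  have "(\<lambda>x. \<phi> x * g x) absolutely_integrable_on K"
  proof (rule absolutely_integrable_bounded_measurable_product[OF bilinear_times _ Ks _ g])
    show "\<phi> \<in> borel_measurable (lebesgue_on K)"
      using \<phi> Ks by (auto intro: continuous_imp_measurable_on_sets_lebesgue continuous_on_subset)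
    show "bounded (\<phi> ` K)"
      using K \<phi> by (meson compact_continuous_image compact_imp_bounded continuous_on_subset top_greatest)
  qed
  then show ?thesis by (simp add: mult.commute)
qed

text \<open>\<open>g\<close> is merely locally integrable, so its product with \<open>\<phi>\<close>
  is controlled on the compact set \<open>K\<close> only; as \<open>\<phi>\<close> vanishes
  elsewhere, the integral over \<Omega> is the one over \<open>K\<close>.\<close>

lemma L2_inner_compact_support:
  fixes g \<phi> :: "real ^ 'd \<Rightarrow> real"
  assumes \<Omega>: "\<Omega> \<in> sets lebesgue" and g: "locally_integrable \<Omega> g"
    and K: "compact K" "K \<subseteq> \<Omega>" and \<phi>: "continuous_on UNIV \<phi>" "\<And>x. x \<notin> K \<Longrightarrow> \<phi> x = 0"
  shows "integrable (lebesgue_on \<Omega>) (\<lambda>x. g x * \<phi> x)"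
    and "L2_inner \<Omega> g \<phi> = (LINT x:K|lebesgue. g x * \<phi> x)"
proof -
  have e: "indicator \<Omega> x * (g x * \<phi> x) = indicator K x * (g x * \<phi> x)" for x
    using K \<phi>(2) by (auto simp: indicator_def)
  show "integrable (lebesgue_on \<Omega>) (\<lambda>x. g x * \<phi> x)"
    using set_integrable_mult_continuous[where g = g and K = K and \<phi> = \<phi>] g K \<phi>(1) \<Omega>
    by (simp add: integrable_restrict_space e locally_integrable_def set_integrable_def)
  show "L2_inner \<Omega> g \<phi> = (LINT x:K|lebesgue. g x * \<phi> x)"
    using \<Omega> by (simp add: L2_inner_def integral_restrict_space e set_lebesgue_integral_def)
qed

lemma L2_inner_test_diff:
  fixes g \<phi> :: "real ^ 'd::finite \<Rightarrow> real"
  assumes \<Omega>: "\<Omega> \<in> sets lebesgue" and g: "locally_integrable \<Omega> g" "locally_integrable \<Omega> h"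
    and \<phi>: "\<phi> \<in> test_functions \<Omega>"
  shows "L2_inner \<Omega> (\<lambda>x. g x - h x) \<phi> = L2_inner \<Omega> g \<phi> - L2_inner \<Omega> h \<phi>"
proof -
  obtain K where K: "compact K" "K \<subseteq> \<Omega>"
    and z: "\<forall>x. x \<notin> K \<longrightarrow> \<phi> x = 0 \<and> (\<forall>i. partial i \<phi> x = 0)"
    using test_function_support[OF \<phi>] by blast
  note i = L2_inner_compact_support(1)[OF \<Omega> _ K test_function_continuous(1)[OF \<phi>]]
  show ?thesis
    using i[OF g(1)] i[OF g(2)] z by (simp add: L2_inner_def left_diff_distrib)
qed

text \<open>The bumps are bounded by 1 and tend to the indicator of the open box, so dominated
  convergence applies, the bound being the absolute value of \<open>g\<close> cut off to the closed
  box. The faces of the box are null.\<close>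

lemma box_integral_eq_0:
  fixes g :: "real ^ 'd::finite \<Rightarrow> real"
  assumes \<Omega>: "\<Omega> \<in> sets lebesgue" and g: "locally_integrable \<Omega> g"
    and zero: "\<And>\<phi>. \<phi> \<in> test_functions \<Omega> \<Longrightarrow> L2_inner \<Omega> g \<phi> = 0"
    and ab: "cbox a b \<subseteq> \<Omega>"
  shows "integral (cbox a b) g = 0"
proof -
  let ?h = "\<lambda>x. indicator (cbox a b) x *\<^sub>R g x"
  have gK: "set_integrable lebesgue (cbox a b) g"
    using g ab by (simp add: locally_integrable_def)
  then have h: "integrable lebesgue ?h" by (simp add: set_integrable_def)
  have "(\<lambda>n. \<integral>x. box_bump a b n x * ?h x \<partial>lebesgue) \<longlonglongrightarrow> (\<integral>x. indicator (box a b) x * ?h x \<partial>lebesgue)"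
  proof (rule integral_dominated_convergence[where w = "\<lambda>x. norm (?h x)"])
    have m: "box_bump a b n \<in> borel_measurable lebesgue" for n
      using continuous_imp_measurable_on_sets_lebesgue[of UNIV "box_bump a b n"]
        test_function_continuous(1)[OF box_bump_test_function[OF ab]]
      by (simp add: lebesgue_on_UNIV_eq)
    show "(\<lambda>x. box_bump a b n x * ?h x) \<in> borel_measurable lebesgue" for n
      by (rule borel_measurable_times[OF m borel_measurable_integrable[OF h]])
    show "(\<lambda>x. indicator (box a b) x * ?h x) \<in> borel_measurable lebesgue"
      by (rule borel_measurable_times[OF borel_measurable_indicator borel_measurable_integrable[OF h]])
        simp
    show "AE x in lebesgue. (\<lambda>n. box_bump a b n x * ?h x) \<longlonglongrightarrow> indicator (box a b) x * ?h x"
      by (intro AE_I2 tendsto_mult box_bump_tendsto tendsto_const)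
    show "AE x in lebesgue. norm (box_bump a b n x * ?h x) \<le> norm (?h x)" for n
    proof (rule AE_I2)
      fix x
      show "norm (box_bump a b n x * ?h x) \<le> norm (?h x)"
        unfolding norm_mult using box_bump_bounds[of a b n x]
        by (intro mult_left_le_one_le) simp_all
    qed
  qed (rule integrable_norm[OF h])
  moreover have "(\<integral>x. box_bump a b n x * ?h x \<partial>lebesgue) = 0" for n
  proof -
    have z: "x \<notin> cbox a b \<Longrightarrow> box_bump a b n x = 0" for x
      using box_bump_eq_0 box_subset_cbox by blast
    show ?thesis
      using zero[OF box_bump_test_function[OF ab, of n]]
        L2_inner_compact_support(2)[OF \<Omega> g compact_cbox ab
          test_function_continuous(1)[OF box_bump_test_function[OF ab]] z]
      by (simp add: set_lebesgue_integral_def mult_ac)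
  qed
  ultimately have "(\<integral>x. indicator (box a b) x * ?h x \<partial>lebesgue) = 0"
    by (simp add: LIMSEQ_const_iff)
  moreover have "(LINT x:box a b|lebesgue. g x) = (\<integral>x. indicator (box a b) x * ?h x \<partial>lebesgue)"
    unfolding set_lebesgue_integral_def using box_subset_cbox[of a b]
    by (intro Bochner_Integration.integral_cong) (auto simp: indicator_def)
  ultimately have "(LINT x:box a b|lebesgue. g x) = 0" by simp
  moreover have "set_integrable lebesgue (box a b) g"
    by (rule set_integrable_subset[OF gK]) (auto simp: box_subset_cbox)
  ultimately show ?thesis
    by (simp add: set_lebesgue_integral_eq_integral(2) integral_open_interval)
qed

section \<open>Weak derivatives\<close>

text \<open>All integrals over boxes in \<Omega> vanish, and by Lebesgue differentiation almost
  every value of \<open>g\<close> is a limit of averages over shrinking cubes with corner at the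
  point. Cutting \<open>g\<close> off to a box makes the differentiation theorem applicable; the
  exceptional null sets of the boxes are then joined by the local criterion for
  negligibility.\<close>

theorem fundamental_lemma_calculus_of_variations:
  fixes g :: "real ^ 'd::finite \<Rightarrow> real"
  assumes \<Omega>: "open \<Omega>" and g: "locally_integrable \<Omega> g"
    and zero: "\<And>\<phi>. \<phi> \<in> test_functions \<Omega> \<Longrightarrow> L2_inner \<Omega> g \<phi> = 0"
  shows "AE x in lebesgue_on \<Omega>. g x = 0"
proof -
  have \<Omega>s: "\<Omega> \<in> sets lebesgue" using \<Omega> by (simp add: borel_open)
  note int0 = box_integral_eq_0[OF \<Omega>s g zero]
  have loc: "negligible {x \<in> box a b. g x \<noteq> 0}" if ab: "cbox a b \<subseteq> \<Omega>" for a b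
  proof -
    define f where "f x = (if x \<in> cbox a b then g x else 0)" for x
    have "g absolutely_integrable_on cbox a b"
      using g ab by (simp add: locally_integrable_def)
    then have "f absolutely_integrable_on UNIV"
      unfolding f_def by (simp add: absolutely_integrable_restrict_UNIV)
    then have "f integrable_on cbox s t" for s t
      using absolutely_integrable_on_subcbox set_lebesgue_integral_eq_integral(1) by blast
    then obtain N where N: "negligible N" "\<And>x e. \<lbrakk>x \<notin> N; 0 < e\<rbrakk> \<Longrightarrow>
        \<exists>d>0. \<forall>h. 0 < h \<and> h < d \<longrightarrow>
          norm (integral (cbox x (x + h *\<^sub>R One)) f /\<^sub>R h ^ DIM(real ^ 'd) - f x) < e"
      using integrable_ccontinuous_explicit by blast
    have "g x = 0" if x: "x \<in> box a b" "x \<notin> N" for x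
    proof (rule ccontr)
      assume "g x \<noteq> 0"
      have xc: "x \<in> cbox a b" using x box_subset_cbox by blast
      obtain d where d: "0 < d" "\<And>h. 0 < h \<Longrightarrow> h < d \<Longrightarrow>
          norm (integral (cbox x (x + h *\<^sub>R One)) f /\<^sub>R h ^ DIM(real ^ 'd) - f x) < \<bar>g x\<bar>"
        using N(2)[OF x(2), of "\<bar>g x\<bar>"] \<open>g x \<noteq> 0\<close> by auto
      obtain r where r: "0 < r" "ball x r \<subseteq> box a b"
        using x(1) open_contains_ball open_box by blast
      \<comment> \<open>\<open>C\<close> exceeds the diagonal of the unit cube, so a cube of side at
        most \<open>r / (2 * C)\<close> with corner \<open>x\<close> stays inside the ball of radius
        \<open>r\<close>.\<close>
      define C where "C = norm (One :: real ^ 'd) + 1"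
      have C: "0 < C" by (simp add: C_def add_nonneg_pos)
      define h where "h = min (d / 2) (r / (2 * C))"
      have h: "0 < h" "h < d" using d r C by (auto simp: h_def)
      have sub: "cbox x (x + h *\<^sub>R One) \<subseteq> cbox a b"
      proof
        fix y assume y: "y \<in> cbox x (x + h *\<^sub>R One)"
        have "norm (y - x) \<le> norm (h *\<^sub>R (One :: real ^ 'd))"
          using y h by (intro norm_le_componentwise) (auto simp: mem_box inner_diff_left inner_add_left)
        also have "\<dots> \<le> h * C" using h by (simp add: C_def)
        also have "\<dots> \<le> r / (2 * C) * C" using C by (intro mult_right_mono) (auto simp: h_def)
        also have "\<dots> < r" using C r by simp
        finally have "y \<in> ball x r" by (simp add: dist_norm norm_minus_commute)
        then show "y \<in> cbox a b" using r box_subset_cbox by blast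
      qed
      have "integral (cbox x (x + h *\<^sub>R One)) f = integral (cbox x (x + h *\<^sub>R One)) g"
        using sub by (intro integral_cong) (auto simp: f_def)
      also have "\<dots> = 0" using sub ab by (intro int0) auto
      finally show False using d(2)[OF h] xc by (simp add: f_def)
    qed
    then show ?thesis by (intro negligible_subset[OF N(1)]) auto
  qed
  have "negligible {x \<in> \<Omega>. g x \<noteq> 0}"
    unfolding locally_negligible_alt[of "{x \<in> \<Omega>. g x \<noteq> 0}"]
  proof
    fix x assume x: "x \<in> {x \<in> \<Omega>. g x \<noteq> 0}"
    then have "x \<in> \<Omega>" by simp
    then obtain a b where ab: "cbox a b \<subseteq> \<Omega>" "x \<in> box a b" "\<forall>i\<in>Basis. a \<bullet> i < b \<bullet> i"
      by (rule open_contains_cbox[OF \<Omega>])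
    have e: "{x \<in> \<Omega>. g x \<noteq> 0} \<inter> box a b = {x \<in> box a b. g x \<noteq> 0}"
      using ab box_subset_cbox by blast
    show "\<exists>U. openin (top_of_set {x \<in> \<Omega>. g x \<noteq> 0}) U \<and> x \<in> U \<and> negligible U"
    proof (intro exI conjI)
      show "openin (top_of_set {x \<in> \<Omega>. g x \<noteq> 0}) ({x \<in> \<Omega>. g x \<noteq> 0} \<inter> box a b)"
        by (rule openin_open_Int[OF open_box])
      show "negligible ({x \<in> \<Omega>. g x \<noteq> 0} \<inter> box a b)"
        unfolding e by (rule loc[OF ab(1)])
    qed (use x ab in simp)
  qed
  then have "{x \<in> \<Omega>. g x \<noteq> 0} \<in> null_sets lebesgue"
    by (simp add: negligible_iff_null_sets)
  from AE_not_in[OF this] have "AE x in lebesgue. x \<in> \<Omega> \<longrightarrow> g x = 0"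
    by (rule eventually_mono) auto
  then show ?thesis using \<Omega>s by (simp add: AE_restrict_space_iff)
qed

lemma locally_integrable_diff:
  "locally_integrable \<Omega> f \<Longrightarrow> locally_integrable \<Omega> g \<Longrightarrow> locally_integrable \<Omega> (\<lambda>x. f x - g x)"
  by (simp add: locally_integrable_def set_integral_diff)

lemma weak_partial_unique:
  fixes v :: "real ^ 'd::finite \<Rightarrow> real"
  assumes \<Omega>: "open \<Omega>" and g: "is_weak_partial \<Omega> i v g" and h: "is_weak_partial \<Omega> i v h"
  shows "AE x in lebesgue_on \<Omega>. g x = h x"
proof -
  have \<Omega>s: "\<Omega> \<in> sets lebesgue" using \<Omega> by (simp add: borel_open)
  have "AE x in lebesgue_on \<Omega>. g x - h x = 0"
  proof (rule fundamental_lemma_calculus_of_variations[OF \<Omega>])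
    have l: "locally_integrable \<Omega> g" "locally_integrable \<Omega> h"
      using g h unfolding is_weak_partial_def by blast+
    then show "locally_integrable \<Omega> (\<lambda>x. g x - h x)" by (rule locally_integrable_diff)
    fix \<phi> assume \<phi>: "\<phi> \<in> test_functions \<Omega>"
    then have "L2_inner \<Omega> g \<phi> = L2_inner \<Omega> h \<phi>"
      using g h unfolding is_weak_partial_def by fastforce
    then show "L2_inner \<Omega> (\<lambda>x. g x - h x) \<phi> = 0"
      by (simp add: L2_inner_test_diff[OF \<Omega>s l \<phi>])
  qed
  then show ?thesis by simp
qed

section \<open>Integration by parts for continuously differentiable functions\<close>

lemma has_real_derivative_along_axis:
  fixes f :: "real ^ 'd::finite \<Rightarrow> real"
  assumes "\<And>x. f differentiable (at x)"
  shows "((\<lambda>s. f (x + s *\<^sub>R axis i 1)) has_real_derivative partial i f (x + s *\<^sub>R axis i 1)) (at s)"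
proof -
  let ?D = "frechet_derivative f (at (x + s *\<^sub>R axis i 1))"
  have f: "(f has_derivative ?D) (at (x + s *\<^sub>R axis i 1))"
    using assms frechet_derivative_works by blast
  have g: "((\<lambda>s. x + s *\<^sub>R axis i 1) has_derivative (\<lambda>h. h *\<^sub>R axis i 1)) (at s)"
    by (auto intro!: derivative_eq_intros)
  have "?D (h *\<^sub>R axis i 1) = partial i f (x + s *\<^sub>R axis i 1) * h" for h
    using linear_scale[OF has_derivative_linear[OF f]] by (simp add: partial_def)
  with diff_chain_at[OF g f] show ?thesis
    by (simp add: has_field_derivative_def o_def)
qed

lemma lborel_integral_translate:
  fixes f :: "'a::euclidean_space \<Rightarrow> real"
  assumes f: "integrable lborel f"
  shows "integrable lborel (\<lambda>x. f (c + x))" and "(\<integral>x. f (c + x) \<partial>lborel) = (\<integral>x. f x \<partial>lborel)"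
proof -
  have m: "f \<in> borel_measurable borel" using borel_measurable_integrable[OF f] by simp
  show "integrable lborel (\<lambda>x. f (c + x))"
    using f integrable_distr_eq[of "(+) c" lborel borel f] m by (simp add: lborel_distr_plus)
  show "(\<integral>x. f (c + x) \<partial>lborel) = (\<integral>x. f x \<partial>lborel)"
    using integral_distr[of "(+) c" lborel borel f] m by (simp add: lborel_distr_plus)
qed

lemma compact_support_bounded:
  fixes g :: "'a::topological_space \<Rightarrow> real"
  assumes "compact K" "continuous_on UNIV g" "\<And>x. x \<notin> K \<Longrightarrow> g x = 0"
  obtains B where "0 \<le> B" "\<And>x. \<bar>g x\<bar> \<le> B"
proof -
  have "bounded (g ` K)"
    using assms(1,2) by (meson compact_continuous_image compact_imp_bounded continuous_on_subset top_greatest)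
  then obtain B where "\<And>y. y \<in> g ` K \<Longrightarrow> norm y \<le> B" unfolding bounded_iff by blast
  then have "\<bar>g x\<bar> \<le> max B 0" for x by (cases "x \<in> K") (auto simp: assms(3) le_max_iff_disj)
  then show ?thesis by (intro that[of "max B 0"]) simp_all
qed

text \<open>The integral of a difference quotient vanishes by translation invariance.\<close>

theorem integral_partial_eq_0:
  fixes f :: "real ^ 'd::finite \<Rightarrow> real"
  assumes diff: "\<And>x. f differentiable (at x)" and cont: "continuous_on UNIV (partial i f)"
    and K: "compact K" and z: "\<And>x. x \<notin> K \<Longrightarrow> f x = 0"
  shows "(\<integral>x. partial i f x \<partial>lebesgue) = 0"
proof -
  let ?e = "axis i 1 :: real ^ 'd"
  have pz: "x \<notin> K \<Longrightarrow> partial i f x = 0" for x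
    by (rule partial_eq_0_outside[OF compact_imp_closed[OF K] z])
  obtain B where B: "0 \<le> B" "\<And>x. \<bar>partial i f x\<bar> \<le> B"
    using compact_support_bounded[OF K cont pz] by metis
  obtain R where R: "\<And>x. x \<in> K \<Longrightarrow> norm x \<le> R"
    using compact_imp_bounded[OF K] unfolding bounded_iff by blast
  have cf: "continuous_on UNIV f"
    using diff by (simp add: continuous_at_imp_continuous_on differentiable_imp_continuous_within)
  have mf: "f \<in> borel_measurable borel" using cf by (rule borel_measurable_continuous_onI)
  have mp: "partial i f \<in> borel_measurable borel" using cont by (rule borel_measurable_continuous_onI)
  have "(\<lambda>x. indicator K x *\<^sub>R f x) = f"
  proof
    show "indicator K x *\<^sub>R f x = f x" for x using z by (cases "x \<in> K") simp_all
  qed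
  with borel_integrable_compact[OF K continuous_on_subset[OF cf subset_UNIV]]
  have f: "integrable lborel f" by metis
  have lip: "\<bar>f (x + t *\<^sub>R ?e) - f x\<bar> \<le> B * \<bar>t\<bar>" for x t
  proof -
    have "norm (f (x + t *\<^sub>R ?e) - f (x + 0 *\<^sub>R ?e)) \<le> B * norm (t - 0)"
      by (rule field_differentiable_bound[OF convex_UNIV has_real_derivative_along_axis[OF diff]])
        (simp_all add: B)
    then show ?thesis by simp
  qed
  define t where "t n = 1 / real (Suc n)" for n
  have t: "0 < t n" "t n \<le> 1" for n by (simp_all add: t_def)
  define q where "q n x = (f (t n *\<^sub>R ?e + x) - f x) / t n" for n x
  have q_int: "(\<integral>x. q n x \<partial>lborel) = 0" for n
    unfolding q_def using lborel_integral_translate[OF f, of "t n *\<^sub>R ?e"] f by simp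
  have "(\<lambda>n. \<integral>x. q n x \<partial>lborel) \<longlonglongrightarrow> (\<integral>x. partial i f x \<partial>lborel)"
  \<comment> \<open>Shifts have length at most 1, so all quotients vanish outside the ball of radius
    \<open>R + 1\<close>; inside, the mean value bound along the axis gives
    \<open>B\<close>.\<close>
  proof (rule integral_dominated_convergence[where w = "\<lambda>x. B * indicator (cball 0 (R + 1)) x"])
    show "partial i f \<in> borel_measurable lborel" using mp by simp
    show "q n \<in> borel_measurable lborel" for n
      unfolding q_def[abs_def] using mf
        borel_measurable_integrable[OF lborel_integral_translate(1)[OF f, of "t n *\<^sub>R ?e"]]
      by simp
    show "integrable lborel (\<lambda>x. B * indicator (cball 0 (R + 1)) (x :: real ^ 'd))"
      by (intro integrable_mult_right integrable_real_indicator emeasure_bounded_finite) simp_all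
    show "AE x in lborel. (\<lambda>n. q n x) \<longlonglongrightarrow> partial i f x"
    proof (rule AE_I2)
      fix x
      have "((\<lambda>h. (f (x + h *\<^sub>R ?e) - f x) / h) \<longlongrightarrow> partial i f x) (at 0)"
        using has_real_derivative_along_axis[OF diff, of x i 0] by (simp add: DERIV_def)
      moreover have "filterlim t (at 0) sequentially"
        unfolding filterlim_at t_def using LIMSEQ_Suc[OF lim_1_over_n[where 'a = real]] by simp
      ultimately show "(\<lambda>n. q n x) \<longlonglongrightarrow> partial i f x"
        unfolding q_def add.commute[of "t _ *\<^sub>R ?e"] by (rule filterlim_compose)
    qed
    show "AE x in lborel. norm (q n x) \<le> B * indicator (cball 0 (R + 1)) x" for n
    proof (rule AE_I2)
      fix x :: "real ^ 'd"
      show "norm (q n x) \<le> B * indicator (cball 0 (R + 1)) x"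
      proof (cases "x \<in> cball 0 (R + 1)")
        case True
        have "norm (q n x) = \<bar>f (x + t n *\<^sub>R ?e) - f x\<bar> / t n"
          using t[of n] by (simp add: q_def add.commute)
        also have "\<dots> \<le> B * \<bar>t n\<bar> / t n" using t[of n] by (intro divide_right_mono lip) simp
        also have "\<dots> = B" using t[of n] by simp
        finally show ?thesis using True by simp
      next
        case False
        then have x: "R + 1 < norm x" by (simp add: dist_norm)
        have "norm x \<le> norm (t n *\<^sub>R ?e + x) + norm (t n *\<^sub>R ?e)"
          using norm_triangle_ineq4[of "t n *\<^sub>R ?e + x" "t n *\<^sub>R ?e"] by simp
        also have "norm (t n *\<^sub>R ?e) \<le> 1" using t[of n] by simp
        finally have "R < norm (t n *\<^sub>R ?e + x)" using x by simp
        then have "f (t n *\<^sub>R ?e + x) = 0" "f x = 0"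
          using R[of "t n *\<^sub>R ?e + x"] R[of x] x z by force+
        then show ?thesis using B by (simp add: q_def)
      qed
    qed
  qed
  then have "(\<integral>x. partial i f x \<partial>lborel) = 0"
    using q_int by (simp add: LIMSEQ_const_iff)
  then show ?thesis using mp by (simp add: integral_completion)
qed

lemma continuous_locally_integrable:
  fixes f :: "real ^ 'd \<Rightarrow> real"
  assumes "continuous_on UNIV f"
  shows "locally_integrable \<Omega> f"
  unfolding locally_integrable_def
proof (intro allI impI)
  fix K assume K: "compact K \<and> K \<subseteq> \<Omega>"
  have "(\<lambda>x. 1 :: real) absolutely_integrable_on K"
    using K by (intro absolutely_integrable_on_const lmeasurable_compact) simp
  from set_integrable_mult_continuous[OF this _ assms] K
  show "f absolutely_integrable_on K" by simp
qed

text \<open>The vanishing integral of a derivative is applied to the product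
  \<open>f \<phi>\<close>, whose compact support comes from \<open>\<phi>\<close>; the product rule
  splits it into the two pairings.\<close>

lemma C1_weak_partial:
  fixes f :: "real ^ 'd::finite \<Rightarrow> real"
  assumes \<Omega>: "\<Omega> \<in> sets lebesgue"
    and diff: "\<And>x. f differentiable (at x)" and cont: "continuous_on UNIV (partial i f)"
  shows "is_weak_partial \<Omega> i f (partial i f)"
  unfolding is_weak_partial_def
proof (intro conjI ballI)
  have cf: "continuous_on UNIV f"
    using diff by (simp add: continuous_at_imp_continuous_on differentiable_imp_continuous_within)
  show l: "locally_integrable \<Omega> f" "locally_integrable \<Omega> (partial i f)"
    by (rule continuous_locally_integrable[OF cf], rule continuous_locally_integrable[OF cont])
  fix \<phi> assume \<phi>: "\<phi> \<in> test_functions \<Omega>"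
  obtain K where K: "compact K" "K \<subseteq> \<Omega>"
    and z: "\<forall>x. x \<notin> K \<longrightarrow> \<phi> x = 0 \<and> (\<forall>i. partial i \<phi> x = 0)"
    using test_function_support[OF \<phi>] by blast
  note c = test_function_continuous[OF \<phi>]
  have pf: "partial i (\<lambda>x. f x * \<phi> x) = (\<lambda>x. f x * partial i \<phi> x + partial i f x * \<phi> x)"
    by (rule ext) (rule partial_mult[OF diff test_function_differentiable[OF \<phi>]])
  have li: "f absolutely_integrable_on K" "partial i f absolutely_integrable_on K"
    using l K by (simp_all add: locally_integrable_def)
  have "L2_inner \<Omega> f (partial i \<phi>) + L2_inner \<Omega> (partial i f) \<phi> =
      (LINT x:K|lebesgue. f x * partial i \<phi> x) + (LINT x:K|lebesgue. partial i f x * \<phi> x)"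
    using z by (simp add: L2_inner_compact_support(2)[OF \<Omega> _ K] l c)
  also have "\<dots> = (LINT x:K|lebesgue. f x * partial i \<phi> x + partial i f x * \<phi> x)"
    by (rule set_integral_add(2)[symmetric]) (intro set_integrable_mult_continuous li K c)+
  also have "\<dots> = (\<integral>x. partial i (\<lambda>x. f x * \<phi> x) x \<partial>lebesgue)"
    unfolding set_lebesgue_integral_def pf using z
    by (intro Bochner_Integration.integral_cong) (auto simp: indicator_def)
  also have "\<dots> = 0"
  proof (rule integral_partial_eq_0[OF _ _ K(1)])
    show "(\<lambda>x. f x * \<phi> x) differentiable (at x)" for x
      using diff test_function_differentiable[OF \<phi>] by (rule differentiable_mult)
    show "continuous_on UNIV (partial i (\<lambda>x. f x * \<phi> x))"
      unfolding pf by (intro continuous_on_add continuous_on_mult cf cont c)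
  qed (use z in simp)
  finally show "L2_inner \<Omega> f (partial i \<phi>) = - L2_inner \<Omega> (partial i f) \<phi>" by simp
qed

text \<open>On a compact \<open>K\<close> the function is the product of \<open>v\<close> with the
  indicator of \<open>K\<close>, which lies in \<open>L2\<close> because \<open>K\<close> has finite
  measure.\<close>

lemma L2_locally_integrable:
  assumes \<Omega>: "\<Omega> \<in> sets lebesgue" and v: "v \<in> L2 \<Omega>"
  shows "locally_integrable \<Omega> v"
  unfolding locally_integrable_def
proof (intro allI impI)
  fix K assume K: "compact K \<and> K \<subseteq> \<Omega>"
  then have Km: "K \<in> lmeasurable" by (simp add: lmeasurable_compact)
  have e: "indicator \<Omega> x * (indicator K x * r) = indicator K x * (r :: real)" for x r
    using K by (auto simp: indicator_def)
  have m: "(indicator K :: _ \<Rightarrow> real) \<in> borel_measurable (lebesgue_on \<Omega>)"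
    using Km by (intro measurable_restrict_space1 borel_measurable_indicator) (simp add: fmeasurableD)
  have "integrable lebesgue (indicator K :: _ \<Rightarrow> real)"
    using Km by (simp add: lmeasurable_iff_integrable)
  moreover have "(\<lambda>x. indicator \<Omega> x *\<^sub>R indicator K x) = (indicator K :: _ \<Rightarrow> real)"
    using K by (auto simp: indicator_def fun_eq_iff)
  ultimately have "integrable (lebesgue_on \<Omega>) (indicator K :: _ \<Rightarrow> real)"
    using \<Omega> by (simp add: integrable_restrict_space del: real_scaleR_def)
  moreover have "(indicator K x :: real)\<^sup>2 = indicator K x" for x by (simp add: indicator_def)
  ultimately have "(indicator K :: _ \<Rightarrow> real) \<in> L2 \<Omega>" using m by (simp add: L2_def)
  from integrable_L2_mult[OF this v] show "v absolutely_integrable_on K"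
    using \<Omega> by (simp add: integrable_restrict_space e set_integrable_def)
qed

section \<open>Sobolev spaces and the energy form\<close>

locale bounded_domain =
  fixes \<Omega> :: "(real ^ 'd::finite) set"
  assumes open_domain: "open \<Omega>" and bounded_domain: "bounded \<Omega>"
begin

abbreviation (input) D :: "'d \<Rightarrow> (real ^ 'd \<Rightarrow> real) \<Rightarrow> real ^ 'd \<Rightarrow> real" where
  "D \<equiv> weak_partial \<Omega>"

lemma sets_domain: "\<Omega> \<in> sets lebesgue"
  using open_domain by (simp add: borel_open)

lemma lmeasurable_domain: "\<Omega> \<in> lmeasurable"
  using open_domain bounded_domain by (simp add: lmeasurable_open)

lemma finite_measure_domain: "finite_measure (lebesgue_on \<Omega>)"
  by (rule finite_measure_lebesgue_on[OF lmeasurable_domain])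

lemma continuous_compact_support_L2:
  assumes "compact K" "continuous_on UNIV g" "\<And>x. x \<notin> K \<Longrightarrow> g x = 0"
  shows "g \<in> L2 \<Omega>"
proof -
  obtain B where "0 \<le> B" "\<And>x. \<bar>g x\<bar> \<le> B"
    using compact_support_bounded[OF assms] by metis
  moreover have "g \<in> borel_measurable (lebesgue_on \<Omega>)"
    using assms(2) sets_domain
    by (intro continuous_imp_measurable_on_sets_lebesgue) (auto intro: continuous_on_subset)
  ultimately show ?thesis
    by (intro bounded_in_L2[OF finite_measure_domain, of g B]) simp_all
qed

lemma test_function_L2:
  assumes "\<phi> \<in> test_functions \<Omega>"
  shows "\<phi> \<in> L2 \<Omega>" "partial i \<phi> \<in> L2 \<Omega>"
proof -
  obtain K where K: "compact K"
    and z: "\<forall>x. x \<notin> K \<longrightarrow> \<phi> x = 0 \<and> (\<forall>i. partial i \<phi> x = 0)"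
    using test_function_support[OF assms] by blast
  note c = continuous_compact_support_L2[OF K] test_function_continuous[OF assms]
  show "\<phi> \<in> L2 \<Omega>" "partial i \<phi> \<in> L2 \<Omega>"
    by (rule c; simp add: c z)+
qed

lemma test_function_weak_partial:
  assumes "\<phi> \<in> test_functions \<Omega>"
  shows "is_weak_partial \<Omega> i \<phi> (partial i \<phi>)"
  using sets_domain test_function_differentiable[OF assms] test_function_continuous(2)[OF assms]
  by (rule C1_weak_partial)

lemma is_weak_partial_lincomb:
  assumes L: "v \<in> L2 \<Omega>" "g \<in> L2 \<Omega>" "w \<in> L2 \<Omega>" "h \<in> L2 \<Omega>"
    and v: "is_weak_partial \<Omega> i v g" and w: "is_weak_partial \<Omega> i w h"
  shows "is_weak_partial \<Omega> i (\<lambda>x. v x + r * w x) (\<lambda>x. g x + r * h x)"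
  unfolding is_weak_partial_def
proof (intro conjI ballI)
  show "locally_integrable \<Omega> (\<lambda>x. v x + r * w x)" "locally_integrable \<Omega> (\<lambda>x. g x + r * h x)"
    using L by (simp_all add: L2_locally_integrable sets_domain L2.form_simps)
  fix \<phi> assume \<phi>: "\<phi> \<in> test_functions \<Omega>"
  then have "L2_inner \<Omega> v (partial i \<phi>) = - L2_inner \<Omega> g \<phi>"
    "L2_inner \<Omega> w (partial i \<phi>) = - L2_inner \<Omega> h \<phi>"
    using v w by (simp_all add: is_weak_partial_def)
  then show "L2_inner \<Omega> (\<lambda>x. v x + r * w x) (partial i \<phi>) = - L2_inner \<Omega> (\<lambda>x. g x + r * h x) \<phi>"
    using L test_function_L2[OF \<phi>] by (simp add: L2.form_simps)
qed

text \<open>Existence of one weak derivative makes the \<open>SOME\<close> choice a genuine weak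
  derivative, and uniqueness ties it to any derivative found otherwise.\<close>

lemma weak_partial_AE_eq:
  assumes "is_weak_partial \<Omega> i v g"
  shows "AE x in lebesgue_on \<Omega>. D i v x = g x"
  unfolding weak_partial_def
  by (rule weak_partial_unique[OF open_domain someI[of "is_weak_partial \<Omega> i v", OF assms] assms])

lemma weak_partial_in_L2:
  assumes "is_weak_partial \<Omega> i v g" "g \<in> L2 \<Omega>"
  shows "D i v \<in> L2 \<Omega>"
  by (rule L2_cong_AE[OF sets_domain assms(2)])
    (rule eventually_mono[OF weak_partial_AE_eq[OF assms(1)]], simp)

lemma H1_D:
  assumes "v \<in> H1 \<Omega>"
  shows "v \<in> L2 \<Omega>" "D i v \<in> L2 \<Omega>" "is_weak_partial \<Omega> i v (D i v)"
proof -
  obtain g where g: "g \<in> L2 \<Omega>" "is_weak_partial \<Omega> i v g"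
    using assms unfolding H1_def by blast
  show "v \<in> L2 \<Omega>" using assms by (simp add: H1_def)
  show "D i v \<in> L2 \<Omega>" by (rule weak_partial_in_L2[OF g(2,1)])
  show "is_weak_partial \<Omega> i v (D i v)"
    unfolding weak_partial_def by (rule someI[of "is_weak_partial \<Omega> i v", OF g(2)])
qed

lemma H1_I:
  assumes "v \<in> L2 \<Omega>" "\<And>i. g i \<in> L2 \<Omega>" "\<And>i. is_weak_partial \<Omega> i v (g i)"
  shows "v \<in> H1 \<Omega>"
  using assms unfolding H1_def by blast

text \<open>The three derivatives are chosen independently of each other, hence their linearity
  holds only almost everywhere.\<close>

lemma H1_lincomb:
  assumes v: "v \<in> H1 \<Omega>" and w: "w \<in> H1 \<Omega>"
  shows "(\<lambda>x. v x + r * w x) \<in> H1 \<Omega>"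
    and "AE x in lebesgue_on \<Omega>. D i (\<lambda>x. v x + r * w x) x = D i v x + r * D i w x"
proof -
  have wp: "is_weak_partial \<Omega> i (\<lambda>x. v x + r * w x) (\<lambda>x. D i v x + r * D i w x)" for i
    by (rule is_weak_partial_lincomb[OF H1_D(1,2)[OF v] H1_D(1,2)[OF w] H1_D(3)[OF v] H1_D(3)[OF w]])
  show "(\<lambda>x. v x + r * w x) \<in> H1 \<Omega>"
    by (rule H1_I[OF _ _ wp]) (simp_all add: L2.form_simps H1_D[OF v] H1_D[OF w])
  show "AE x in lebesgue_on \<Omega>. D i (\<lambda>x. v x + r * w x) x = D i v x + r * D i w x"
    by (rule weak_partial_AE_eq[OF wp])
qed

lemma test_function_H1:
  assumes "\<phi> \<in> test_functions \<Omega>"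
  shows "\<phi> \<in> H1 \<Omega>" "AE x in lebesgue_on \<Omega>. D i \<phi> x = partial i \<phi> x"
  using H1_I[OF test_function_L2[OF assms] test_function_weak_partial[OF assms]]
    weak_partial_AE_eq[OF test_function_weak_partial[OF assms]] by blast+

lemma zero_test_function: "(\<lambda>x. 0) \<in> test_functions \<Omega>"
  by (simp add: test_functions_def Ck_const)

lemma test_function_lincomb:
  assumes "\<phi> \<in> test_functions \<Omega>" "\<psi> \<in> test_functions \<Omega>"
  shows "(\<lambda>x. \<phi> x + r * \<psi> x) \<in> test_functions \<Omega>"
proof -
  let ?K = "closure {x. \<phi> x \<noteq> 0} \<union> closure {x. \<psi> x \<noteq> 0}"
  have K: "compact ?K" "?K \<subseteq> \<Omega>"
    using assms by (simp_all add: test_functions_def compact_Un)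
  have "{x. \<phi> x + r * \<psi> x \<noteq> 0} \<subseteq> {x. \<phi> x \<noteq> 0} \<union> {x. \<psi> x \<noteq> 0}" by auto
  then have c: "closure {x. \<phi> x + r * \<psi> x \<noteq> 0} \<subseteq> ?K"
    unfolding closure_Un[symmetric] by (rule closure_mono)
  have "compact (?K \<inter> closure {x. \<phi> x + r * \<psi> x \<noteq> 0})"
    using K(1) closed_closure by (rule compact_Int_closed)
  then have "compact (closure {x. \<phi> x + r * \<psi> x \<noteq> 0})"
    using c by (simp add: Int_absorb1)
  moreover have "Ck k (\<lambda>x. \<phi> x + r * \<psi> x)" for k
    using assms by (intro Ck_add Ck_mult Ck_const test_function_Ck)
  ultimately show ?thesis using c K unfolding test_functions_def by blast
qed

end

text \<open>Two instances are intended: the coefficients of the equation, and the unit matrix with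
  \<open>c = 1\<close>, whose form is the \<open>H1\<close> inner product. Boundedness makes the
  form finite, symmetry and semidefiniteness make it a \<open>psd_form\<close>.\<close>

locale semidefinite_coefficients = bounded_domain \<Omega> for \<Omega> :: "(real ^ 'd::finite) set" +
  fixes A :: "real ^ 'd \<Rightarrow> real ^ 'd ^ 'd" and c :: "real ^ 'd \<Rightarrow> real"
  assumes A_Linf: "(\<lambda>x. A x $ i $ j) \<in> Linf \<Omega>" and c_Linf: "c \<in> Linf \<Omega>"
    and A_sym: "AE x in lebesgue_on \<Omega>. transpose (A x) = A x"
    and A_psd: "AE x in lebesgue_on \<Omega>. \<forall>\<xi>. 0 \<le> \<xi> \<bullet> (A x *v \<xi>)"
    and c_nonneg: "AE x in lebesgue_on \<Omega>. 0 \<le> c x"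
begin

definition integrand :: "(real ^ 'd \<Rightarrow> real) \<Rightarrow> (real ^ 'd \<Rightarrow> real) \<Rightarrow> real ^ 'd \<Rightarrow> real" where
  "integrand y v x = (\<Sum>i\<in>UNIV. \<Sum>j\<in>UNIV. A x $ i $ j * D i y x * D j v x) + c x * y x * v x"

lemma summand_integrable:
  assumes "k \<in> Linf \<Omega>" "f \<in> L2 \<Omega>" "g \<in> L2 \<Omega>"
  shows "integrable (lebesgue_on \<Omega>) (\<lambda>x. k x * f x * g x)"
  by (rule integrable_L2_mult[OF Linf_mult_L2(1)[OF assms(1,2)] assms(3)])

lemma integrand_integrable:
  assumes "y \<in> H1 \<Omega>" "v \<in> H1 \<Omega>"
  shows "integrable (lebesgue_on \<Omega>) (integrand y v)"
  unfolding integrand_def[abs_def]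
  by (intro Bochner_Integration.integrable_add Bochner_Integration.integrable_sum
      summand_integrable A_Linf c_Linf H1_D[OF assms(1)] H1_D[OF assms(2)])

lemma bform_eq_integral: "bform \<Omega> A c y v = (\<integral>x. integrand y v x \<partial>lebesgue_on \<Omega>)"
  by (simp add: bform_def integrand_def)

lemma bform_eq_sum:
  assumes "y \<in> H1 \<Omega>" "v \<in> H1 \<Omega>"
  shows "bform \<Omega> A c y v =
    (\<Sum>i\<in>UNIV. \<Sum>j\<in>UNIV. L2_inner \<Omega> (\<lambda>x. A x $ i $ j * D i y x) (D j v)) + L2_inner \<Omega> (\<lambda>x. c x * y x) v"
proof -
  note i = summand_integrable[OF A_Linf H1_D(2)[OF assms(1)] H1_D(2)[OF assms(2)]]
    summand_integrable[OF c_Linf H1_D(1)[OF assms(1)] H1_D(1)[OF assms(2)]]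
  show ?thesis unfolding bform_def L2_inner_def
    by (simp add: i)
qed

lemma bform_sym:
  assumes "y \<in> H1 \<Omega>" "v \<in> H1 \<Omega>"
  shows "bform \<Omega> A c y v = bform \<Omega> A c v y"
  unfolding bform_eq_integral
proof (rule integral_cong_AE)
  show "integrand y v \<in> borel_measurable (lebesgue_on \<Omega>)" "integrand v y \<in> borel_measurable (lebesgue_on \<Omega>)"
    using integrand_integrable assms by blast+
  show "AE x in lebesgue_on \<Omega>. integrand y v x = integrand v y x"
    using A_sym
  proof (rule eventually_mono)
    fix x assume "transpose (A x) = A x"
    then have s: "A x $ i $ j = A x $ j $ i" for i j
      by (metis transpose_def vec_lambda_beta)
    have "(\<Sum>i\<in>UNIV. \<Sum>j\<in>UNIV. A x $ i $ j * D i y x * D j v x) =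
        (\<Sum>j\<in>UNIV. \<Sum>i\<in>UNIV. A x $ i $ j * D i y x * D j v x)" by (rule sum.swap)
    also have "\<dots> = (\<Sum>j\<in>UNIV. \<Sum>i\<in>UNIV. A x $ j $ i * D j v x * D i y x)"
      by (intro sum.cong refl) (simp add: s)
    finally show "integrand y v x = integrand v y x"
      by (simp add: integrand_def)
  qed
qed

text \<open>The integrands agree only outside the exceptional sets of the weak derivatives; with
  finitely many coordinates the union of these sets is null.\<close>

lemma bform_lincomb:
  assumes v: "v \<in> H1 \<Omega>" and w: "w \<in> H1 \<Omega>" and y: "y \<in> H1 \<Omega>"
  shows "bform \<Omega> A c (\<lambda>x. v x + r * w x) y = bform \<Omega> A c v y + r * bform \<Omega> A c w y"
proof -
  note vw = H1_lincomb(1)[OF v w, of r]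
  have "bform \<Omega> A c (\<lambda>x. v x + r * w x) y =
      (\<integral>x. integrand v y x + r * integrand w y x \<partial>lebesgue_on \<Omega>)"
    unfolding bform_eq_integral
  proof (rule integral_cong_AE)
    show "integrand (\<lambda>x. v x + r * w x) y \<in> borel_measurable (lebesgue_on \<Omega>)"
      using integrand_integrable[OF vw y] by (rule borel_measurable_integrable)
    show "(\<lambda>x. integrand v y x + r * integrand w y x) \<in> borel_measurable (lebesgue_on \<Omega>)"
      by (intro borel_measurable_integrable Bochner_Integration.integrable_add integrable_mult_right
          integrand_integrable v w y)
    have "AE x in lebesgue_on \<Omega>. \<forall>i\<in>UNIV. D i (\<lambda>x. v x + r * w x) x = D i v x + r * D i w x"
      using H1_lincomb(2)[OF v w] by (intro AE_finite_allI) simp_all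
    then show "AE x in lebesgue_on \<Omega>. integrand (\<lambda>x. v x + r * w x) y x = integrand v y x + r * integrand w y x"
    proof (rule eventually_mono)
      fix x assume "\<forall>i\<in>UNIV. D i (\<lambda>x. v x + r * w x) x = D i v x + r * D i w x"
      then show "integrand (\<lambda>x. v x + r * w x) y x = integrand v y x + r * integrand w y x"
        by (simp add: integrand_def algebra_simps sum.distrib sum_distrib_left)
    qed
  qed
  also have "\<dots> = bform \<Omega> A c v y + r * bform \<Omega> A c w y"
    unfolding bform_eq_integral
    using integrand_integrable[OF v y] integrand_integrable[OF w y] by simp
  finally show ?thesis .
qed

lemma integrand_ge:
  assumes "\<And>\<xi>. t * (norm \<xi>)\<^sup>2 \<le> \<xi> \<bullet> (A x *v \<xi>)" "0 \<le> c x"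
  shows "t * (\<Sum>i\<in>UNIV. (D i v x)\<^sup>2) \<le> integrand v v x"
proof -
  let ?\<xi> = "\<chi> i. D i v x"
  have "(norm ?\<xi>)\<^sup>2 = (\<Sum>i\<in>UNIV. (D i v x)\<^sup>2)"
    unfolding power2_norm_eq_inner inner_vec_def by (simp add: power2_eq_square)
  moreover have "?\<xi> \<bullet> (A x *v ?\<xi>) = (\<Sum>i\<in>UNIV. \<Sum>j\<in>UNIV. A x $ i $ j * D i v x * D j v x)"
    by (simp add: inner_vec_def matrix_vector_mult_def sum_distrib_left mult_ac)
  moreover have "0 \<le> c x * v x * v x" using assms(2) by (simp add: mult.assoc)
  ultimately show ?thesis using assms(1)[of ?\<xi>] by (simp add: integrand_def)
qed

text \<open>Both the sign and the coercivity of the form come from here: \<open>t = 0\<close> gives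
  nonnegativity, the ellipticity constant gives control of the gradient.\<close>

lemma bform_ge:
  assumes v: "v \<in> H1 \<Omega>" and A: "AE x in lebesgue_on \<Omega>. \<forall>\<xi>. t * (norm \<xi>)\<^sup>2 \<le> \<xi> \<bullet> (A x *v \<xi>)"
  shows "t * (\<Sum>i\<in>UNIV. (L2_norm \<Omega> (D i v))\<^sup>2) \<le> bform \<Omega> A c v v"
proof -
  note Dv = H1_D(2)[OF v]
  have sq: "integrable (lebesgue_on \<Omega>) (\<lambda>x. (D i v x)\<^sup>2)" for i
    using Dv[of i] by (simp add: L2_def)
  have "t * (\<Sum>i\<in>UNIV. (L2_norm \<Omega> (D i v))\<^sup>2) = (\<integral>x. t * (\<Sum>i\<in>UNIV. (D i v x)\<^sup>2) \<partial>lebesgue_on \<Omega>)"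
    by (simp add: sq L2.nrm_sq[OF Dv] L2_inner_def flip: power2_eq_square)
  also have "\<dots> \<le> bform \<Omega> A c v v"
    unfolding bform_eq_integral
  proof (rule integral_mono_AE)
    show "integrable (lebesgue_on \<Omega>) (\<lambda>x. t * (\<Sum>i\<in>UNIV. (D i v x)\<^sup>2))"
      by (intro integrable_mult_right Bochner_Integration.integrable_sum sq)
    show "integrable (lebesgue_on \<Omega>) (integrand v v)" by (rule integrand_integrable[OF v v])
    show "AE x in lebesgue_on \<Omega>. t * (\<Sum>i\<in>UNIV. (D i v x)\<^sup>2) \<le> integrand v v x"
      using A c_nonneg
      by eventually_elim (rule integrand_ge, simp_all)
  qed
  finally show ?thesis .
qed

lemma zero_H1: "(\<lambda>x. 0) \<in> H1 \<Omega>"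
  by (rule test_function_H1(1)[OF zero_test_function])

lemma psd_form_bform: "psd_form (H1 \<Omega>) (bform \<Omega> A c)"
proof
  fix u v w :: "real ^ 'd \<Rightarrow> real" and r :: real
  show "(\<lambda>x. 0) \<in> H1 \<Omega>" by (rule zero_H1)
  show "v \<in> H1 \<Omega> \<Longrightarrow> w \<in> H1 \<Omega> \<Longrightarrow> (\<lambda>x. v x + w x) \<in> H1 \<Omega>"
    using H1_lincomb(1)[of v w 1] by simp
  show "v \<in> H1 \<Omega> \<Longrightarrow> (\<lambda>x. r * v x) \<in> H1 \<Omega>"
    using H1_lincomb(1)[OF zero_H1, of v r] by simp
  show "u \<in> H1 \<Omega> \<Longrightarrow> v \<in> H1 \<Omega> \<Longrightarrow> w \<in> H1 \<Omega> \<Longrightarrow>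
      bform \<Omega> A c (\<lambda>x. u x + v x) w = bform \<Omega> A c u w + bform \<Omega> A c v w"
    using bform_lincomb[of u v w 1] by simp
  \<comment> \<open>Scaling is a linear combination with the zero function. The second fact yields
    \<open>B = B + B\<close> for the value of the form at zero, which is not immediate because the
    chosen derivative of zero is an arbitrary representative.\<close>
  show "bform \<Omega> A c (\<lambda>x. r * v x) w = r * bform \<Omega> A c v w" if v: "v \<in> H1 \<Omega>" and w: "w \<in> H1 \<Omega>"
    using bform_lincomb[OF zero_H1 v w, of r] bform_lincomb[OF zero_H1 zero_H1 w, of 1] by simp
  show "v \<in> H1 \<Omega> \<Longrightarrow> w \<in> H1 \<Omega> \<Longrightarrow> bform \<Omega> A c v w = bform \<Omega> A c w v"
    by (rule bform_sym)
  show "v \<in> H1 \<Omega> \<Longrightarrow> 0 \<le> bform \<Omega> A c v v"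
    using bform_ge[of v 0] A_psd by simp
qed

sublocale energy: psd_form "H1 \<Omega>" "bform \<Omega> A c"
  rewrites "psd_form.nrm (bform \<Omega> A c) = energy_norm \<Omega> A c"
  by (rule psd_form_bform)
    (simp add: fun_eq_iff psd_form.nrm_def[OF psd_form_bform] energy_norm_def)

end

context bounded_domain
begin

text \<open>As the energy form of unit coefficients, the \<open>H1\<close> inner product inherits
  bilinearity and nonnegativity from the general locale.\<close>

definition H1_inner :: "(real ^ 'd \<Rightarrow> real) \<Rightarrow> (real ^ 'd \<Rightarrow> real) \<Rightarrow> real" where
  "H1_inner = bform \<Omega> (\<lambda>x. mat 1) (\<lambda>x. 1)"

lemma unit_coefficients: "semidefinite_coefficients \<Omega> (\<lambda>x. mat 1) (\<lambda>x. 1)"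
proof
  have "(\<lambda>x. r) \<in> Linf \<Omega>" for r by (auto simp: Linf_def)
  then show "(\<lambda>x. mat 1 $ i $ j) \<in> Linf \<Omega>" "(\<lambda>x. 1) \<in> Linf \<Omega>" for i j by blast+
qed simp_all

lemma H1_norm_eq:
  assumes "v \<in> H1 \<Omega>"
  shows "H1_norm \<Omega> v = psd_form.nrm H1_inner v"
proof -
  interpret I: semidefinite_coefficients \<Omega> "\<lambda>x. mat 1" "\<lambda>x. 1" by (rule unit_coefficients)
  have "H1_inner v v = (\<Sum>i\<in>UNIV. \<Sum>j\<in>UNIV. (if i = j then L2_inner \<Omega> (D i v) (D j v) else 0)) + L2_inner \<Omega> v v"
    unfolding H1_inner_def I.bform_eq_sum[OF assms assms]
    by (intro arg_cong2[where f = "(+)"] sum.cong refl) (simp_all add: mat_def L2_inner_def)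
  also have "\<dots> = (L2_norm \<Omega> v)\<^sup>2 + (\<Sum>i\<in>UNIV. (L2_norm \<Omega> (D i v))\<^sup>2)"
    by (simp add: L2.nrm_sq H1_D[OF assms])
  finally show ?thesis
    by (simp add: H1_norm_def psd_form.nrm_def[OF I.psd_form_bform, folded H1_inner_def])
qed

sublocale H1: psd_form "H1 \<Omega>" H1_inner
  unfolding H1_inner_def by (rule semidefinite_coefficients.psd_form_bform[OF unit_coefficients])

lemma L2_norm_le_H1_norm:
  assumes "v \<in> H1 \<Omega>"
  shows "L2_norm \<Omega> v \<le> H1_norm \<Omega> v" "L2_norm \<Omega> (D i v) \<le> H1_norm \<Omega> v"
proof -
  have "(L2_norm \<Omega> (D i v))\<^sup>2 \<le> (\<Sum>i\<in>UNIV. (L2_norm \<Omega> (D i v))\<^sup>2)"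
    by (rule member_le_sum) simp_all
  moreover have "0 \<le> (\<Sum>i\<in>UNIV. (L2_norm \<Omega> (D i v))\<^sup>2)" by (simp add: sum_nonneg)
  ultimately show "L2_norm \<Omega> v \<le> H1_norm \<Omega> v" "L2_norm \<Omega> (D i v) \<le> H1_norm \<Omega> v"
    unfolding H1_norm_def using zero_le_power2[of "L2_norm \<Omega> v"]
    by (intro real_le_rsqrt; linarith)+
qed

lemma H1_norm_le:
  assumes "v \<in> H1 \<Omega>"
  shows "H1_norm \<Omega> v \<le> L2_norm \<Omega> v + (\<Sum>i\<in>UNIV. L2_norm \<Omega> (D i v))"
proof -
  have "H1_norm \<Omega> v \<le> sqrt ((L2_norm \<Omega> v)\<^sup>2) + sqrt (\<Sum>i\<in>UNIV. (L2_norm \<Omega> (D i v))\<^sup>2)"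
    unfolding H1_norm_def by (intro sqrt_add_le_add_sqrt sum_nonneg) simp_all
  also have "sqrt ((L2_norm \<Omega> v)\<^sup>2) = L2_norm \<Omega> v"
    by (simp add: L2.nrm_nonneg H1_D[OF assms])
  also have "sqrt (\<Sum>i\<in>UNIV. (L2_norm \<Omega> (D i v))\<^sup>2) \<le> (\<Sum>i\<in>UNIV. L2_norm \<Omega> (D i v))"
    using L2_set_le_sum[of UNIV "\<lambda>i. L2_norm \<Omega> (D i v)"]
    by (simp add: L2_set_def L2.nrm_nonneg H1_D[OF assms])
  finally show ?thesis by simp
qed

end

section \<open>Existence of states\<close>

context bounded_domain
begin

lemma H1_diff_D:
  assumes "v \<in> H1 \<Omega>" "w \<in> H1 \<Omega>"
  shows "AE x in lebesgue_on \<Omega>. D i (\<lambda>x. v x - w x) x = D i v x - D i w x"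
  using H1_lincomb(2)[OF assms, of i "-1"] by simp

lemma L2_norm_diff_D_le:
  assumes v: "v \<in> H1 \<Omega>" and w: "w \<in> H1 \<Omega>"
  shows "L2_norm \<Omega> (\<lambda>x. D i v x - D i w x) \<le> H1_norm \<Omega> (\<lambda>x. v x - w x)"
proof -
  note vw = H1.diff_mem[OF v w]
  have "L2_norm \<Omega> (\<lambda>x. D i v x - D i w x) = L2_norm \<Omega> (D i (\<lambda>x. v x - w x))"
    using L2_norm_cong_AE[OF H1_diff_D[OF v w] H1_D(2)[OF vw] L2.diff_mem[OF H1_D(2)[OF v] H1_D(2)[OF w]]]
    by simp
  then show ?thesis using L2_norm_le_H1_norm(2)[OF vw] by simp
qed

lemma H1_norm_triangle:
  assumes "v \<in> H1 \<Omega>" "w \<in> H1 \<Omega>"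
  shows "H1_norm \<Omega> (\<lambda>x. v x + w x) \<le> H1_norm \<Omega> v + H1_norm \<Omega> w"
  using H1.nrm_triangle[OF assms] by (simp add: H1_norm_eq assms H1.add_mem)

lemma H1_norm_scale: "v \<in> H1 \<Omega> \<Longrightarrow> H1_norm \<Omega> (\<lambda>x. r * v x) = \<bar>r\<bar> * H1_norm \<Omega> v"
  by (simp add: H1_norm_eq H1.scale_mem H1.nrm_scale)

section \<open>The subspace \<open>H10\<close>\<close>

lemma H10_H1: "v \<in> H10 \<Omega> \<Longrightarrow> v \<in> H1 \<Omega>"
  by (simp add: H10_def)

lemma H10_approx:
  assumes "v \<in> H10 \<Omega>" "0 < e"
  obtains \<phi> where "\<phi> \<in> test_functions \<Omega>" "H1_norm \<Omega> (\<lambda>x. v x - \<phi> x) < e"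
  using assms unfolding H10_def by blast

lemma zero_H10: "(\<lambda>x. 0) \<in> H10 \<Omega>"
proof -
  have "H1_norm \<Omega> (\<lambda>x. 0) = 0" by (simp add: H1_norm_eq H1.zero_mem H1.nrm_zero)
  then show ?thesis
    unfolding H10_def using H1.zero_mem
    by (intro CollectI conjI allI impI bexI[OF _ zero_test_function]) simp_all
qed

lemma H10_lincomb:
  assumes v: "v \<in> H10 \<Omega>" and w: "w \<in> H10 \<Omega>"
  shows "(\<lambda>x. v x + r * w x) \<in> H10 \<Omega>"
  unfolding H10_def
proof (intro CollectI conjI allI impI)
  note vw = v[THEN H10_H1] w[THEN H10_H1]
  show "(\<lambda>x. v x + r * w x) \<in> H1 \<Omega>" by (rule H1_lincomb(1)[OF vw])
  fix e :: real assume e: "0 < e"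
  \<comment> \<open>The tolerance is chosen so that the two approximation errors, the second one
    weighted by \<open>\<bar>r\<bar>\<close>, add up to \<open>e\<close>.\<close>
  define d where "d = e / (1 + \<bar>r\<bar>)"
  have "d * (1 + \<bar>r\<bar>) = e" using abs_ge_zero[of r] unfolding d_def by simp
  then have d: "d + \<bar>r\<bar> * d = e" by (simp add: algebra_simps)
  have d0: "0 < d" using e by (simp add: d_def add_pos_nonneg)
  obtain \<phi> where \<phi>: "\<phi> \<in> test_functions \<Omega>" "H1_norm \<Omega> (\<lambda>x. v x - \<phi> x) < d"
    by (rule H10_approx[OF v d0])
  obtain \<psi> where \<psi>: "\<psi> \<in> test_functions \<Omega>" "H1_norm \<Omega> (\<lambda>x. w x - \<psi> x) < d"
    by (rule H10_approx[OF w d0])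
  note m = H1.diff_mem[OF vw(1) test_function_H1(1)[OF \<phi>(1)]]
    H1.diff_mem[OF vw(2) test_function_H1(1)[OF \<psi>(1)]]
  have "H1_norm \<Omega> (\<lambda>x. (v x - \<phi> x) + r * (w x - \<psi> x)) \<le>
      H1_norm \<Omega> (\<lambda>x. v x - \<phi> x) + H1_norm \<Omega> (\<lambda>x. r * (w x - \<psi> x))"
    by (rule H1_norm_triangle[OF m(1) H1.scale_mem[OF m(2)]])
  also have "H1_norm \<Omega> (\<lambda>x. r * (w x - \<psi> x)) = \<bar>r\<bar> * H1_norm \<Omega> (\<lambda>x. w x - \<psi> x)"
    by (rule H1_norm_scale[OF m(2)])
  also have "\<dots> \<le> \<bar>r\<bar> * d" using \<psi> by (intro mult_left_mono) auto
  finally have "H1_norm \<Omega> (\<lambda>x. (v x - \<phi> x) + r * (w x - \<psi> x)) < e" using \<phi>(2) d by simp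
  moreover have "(\<lambda>x. (v x - \<phi> x) + r * (w x - \<psi> x)) = (\<lambda>x. v x + r * w x - (\<phi> x + r * \<psi> x))"
    by (simp add: fun_eq_iff algebra_simps)
  ultimately have "H1_norm \<Omega> (\<lambda>x. v x + r * w x - (\<phi> x + r * \<psi> x)) < e" by simp
  then show "\<exists>\<eta>\<in>test_functions \<Omega>. H1_norm \<Omega> (\<lambda>x. v x + r * w x - \<eta> x) < e"
    using test_function_lincomb[OF \<phi>(1) \<psi>(1), of r] by (rule bexI)
qed

lemma H10_diff: "v \<in> H10 \<Omega> \<Longrightarrow> w \<in> H10 \<Omega> \<Longrightarrow> (\<lambda>x. v x - w x) \<in> H10 \<Omega>"
  using H10_lincomb[of v w "-1"] by simp

text \<open>Integrating \<open>\<partial>\<^sub>i (x\<^sub>i \<phi>\<^sup>2) = \<phi>\<^sup>2 + 2 x\<^sub>i \<phi> \<partial>\<^sub>i \<phi>\<close> gives the inequality without Fubini.\<close>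

lemma poincare_test_function:
  assumes R: "\<And>x. x \<in> \<Omega> \<Longrightarrow> norm x \<le> R" "0 \<le> R" and \<phi>: "\<phi> \<in> test_functions \<Omega>"
  shows "L2_norm \<Omega> \<phi> \<le> 2 * R * L2_norm \<Omega> (partial i \<phi>)"
proof -
  obtain K where K: "compact K" "K \<subseteq> \<Omega>"
    and z: "\<forall>x. x \<notin> K \<longrightarrow> \<phi> x = 0 \<and> (\<forall>i. partial i \<phi> x = 0)"
    using test_function_support[OF \<phi>] by blast
  note d = test_function_differentiable[OF \<phi>] and c = test_function_continuous[OF \<phi>]
  note L = test_function_L2[OF \<phi>]
  let ?f = "\<lambda>x :: real ^ 'd. x $ i * (\<phi> x * \<phi> x)"
  have dx: "(\<lambda>x :: real ^ 'd. x $ i) differentiable (at x)" for x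
    by (intro bounded_linear_imp_differentiable bounded_linear_vec_nth)
  have pf: "partial i ?f = (\<lambda>x. x $ i * (\<phi> x * partial i \<phi> x + partial i \<phi> x * \<phi> x) + 1 * (\<phi> x * \<phi> x))"
    by (rule ext) (subst partial_mult[OF dx differentiable_mult[OF d d]],
        simp add: partial_mult[OF d d] partial_coordinate)
  have cx: "continuous_on UNIV (\<lambda>x :: real ^ 'd. x $ i)" by (intro continuous_intros)
  have "(\<integral>x. partial i ?f x \<partial>lebesgue) = 0"
  proof (rule integral_partial_eq_0[OF _ _ K(1)])
    show "?f differentiable (at x)" for x by (intro differentiable_mult dx d)
    show "continuous_on UNIV (partial i ?f)"
      unfolding pf by (intro continuous_on_add continuous_on_mult cx c continuous_on_const)
  qed (use z in simp)
  moreover have "(\<integral>x. partial i ?f x \<partial>lebesgue) = (\<integral>x. partial i ?f x \<partial>lebesgue_on \<Omega>)"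
  proof -
    have "\<phi> x = 0" if "x \<notin> \<Omega>" for x using that z K(2) by blast
    then show ?thesis
      unfolding pf using sets_domain
      by (subst integral_restrict_space)
        (auto intro!: Bochner_Integration.integral_cong simp: indicator_def)
  qed
  moreover have xL: "(\<lambda>x. x $ i * \<phi> x) \<in> L2 \<Omega>"
    using z by (intro continuous_compact_support_L2[OF K(1)] continuous_on_mult cx c) simp
  have "(\<integral>x. partial i ?f x \<partial>lebesgue_on \<Omega>) =
      2 * L2_inner \<Omega> (\<lambda>x. x $ i * \<phi> x) (partial i \<phi>) + L2_inner \<Omega> \<phi> \<phi>"
  proof -
    have "partial i ?f = (\<lambda>x. 2 * ((x $ i * \<phi> x) * partial i \<phi> x) + \<phi> x * \<phi> x)"
      unfolding pf by (simp add: fun_eq_iff algebra_simps)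
    then show ?thesis
      using integrable_L2_mult[OF xL L(2)[of i]] integrable_L2_mult[OF L(1) L(1)]
      by (simp add: L2_inner_def)
  qed
  ultimately have "(L2_norm \<Omega> \<phi>)\<^sup>2 = - 2 * L2_inner \<Omega> (\<lambda>x. x $ i * \<phi> x) (partial i \<phi>)"
    by (simp add: L2.nrm_sq L(1))
  also have "\<dots> \<le> 2 * (L2_norm \<Omega> (\<lambda>x. x $ i * \<phi> x) * L2_norm \<Omega> (partial i \<phi>))"
    using L2.cauchy_schwarz[OF xL L(2), of i] by linarith
  \<comment> \<open>Boundedness of \<Omega> enters here: coordinates are at most \<open>R\<close> in
    absolute value. The norm of \<open>\<phi>\<close> now stands on both sides and is
    cancelled.\<close>
  also have "L2_norm \<Omega> (\<lambda>x. x $ i * \<phi> x) \<le> R * L2_norm \<Omega> \<phi>"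
  proof (rule L2_norm_bounded(2)[OF L(1) L2_measurable[OF xL] _ R(2)])
    have "\<bar>x $ i * \<phi> x\<bar> \<le> R * \<bar>\<phi> x\<bar>" if "x \<in> \<Omega>" for x
      unfolding abs_mult using component_le_norm_cart[of x i] R(1)[OF that]
      by (intro mult_right_mono) simp_all
    then show "AE x in lebesgue_on \<Omega>. \<bar>x $ i * \<phi> x\<bar> \<le> R * \<bar>\<phi> x\<bar>" by (intro AE_I2) simp
  qed
  finally have "L2_norm \<Omega> \<phi> * L2_norm \<Omega> \<phi> \<le> (2 * R * L2_norm \<Omega> (partial i \<phi>)) * L2_norm \<Omega> \<phi>"
    using L2.nrm_nonneg[OF L(2), of i]
    by (simp add: power2_eq_square mult_right_mono mult_ac)
  then show ?thesis
    using L2.nrm_nonneg[OF L(1)] L2.nrm_nonneg[OF L(2), of i] R(2)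
    by (cases "L2_norm \<Omega> \<phi> = 0") (simp_all add: mult_le_cancel_right)
qed

text \<open>Density carries the inequality from test functions to \<open>H10\<close> with the same
  constant \<open>2 * R\<close>. Replacing \<open>v\<close> by a test function costs
  \<open>d\<close> in the function and \<open>2 * R * d\<close> in the derivative, which explains
  the choice of \<open>d\<close>.\<close>

theorem poincare:
  "\<exists>C\<ge>0. \<forall>v\<in>H10 \<Omega>. \<forall>i. L2_norm \<Omega> v \<le> C * L2_norm \<Omega> (D i v)"
proof -
  obtain R where R: "0 < R" "\<And>x. x \<in> \<Omega> \<Longrightarrow> norm x \<le> R"
    using bounded_domain unfolding bounded_pos by blast
  have "L2_norm \<Omega> v \<le> 2 * R * L2_norm \<Omega> (D i v)" if v: "v \<in> H10 \<Omega>" for v i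
  proof (rule field_le_epsilon)
    fix e :: real assume e: "0 < e"
    define d where "d = e / (1 + 2 * R)"
    have "d * (1 + 2 * R) = e" using R(1) unfolding d_def by simp
    then have d: "d + 2 * R * d = e" by (simp add: algebra_simps)
    have d0: "0 < d" using e R(1) by (simp add: d_def add_pos_pos)
    obtain \<phi> where \<phi>: "\<phi> \<in> test_functions \<Omega>" "H1_norm \<Omega> (\<lambda>x. v x - \<phi> x) < d"
      by (rule H10_approx[OF v d0])
    note v1 = H10_H1[OF v] and \<phi>1 = test_function_H1(1)[OF \<phi>(1)] and \<phi>L = test_function_L2[OF \<phi>(1)]
    note m = H1.diff_mem[OF v1 \<phi>1]
    have "L2_norm \<Omega> v \<le> L2_norm \<Omega> (\<lambda>x. v x - \<phi> x) + L2_norm \<Omega> \<phi>"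
      using L2.nrm_triangle[OF H1_D(1)[OF m] \<phi>L(1)] by simp
    also have "L2_norm \<Omega> (\<lambda>x. v x - \<phi> x) \<le> d"
      using L2_norm_le_H1_norm(1)[OF m] \<phi>(2) by simp
    also have "L2_norm \<Omega> \<phi> \<le> 2 * R * L2_norm \<Omega> (partial i \<phi>)"
      using R \<phi>(1) by (intro poincare_test_function) simp_all
    also have "L2_norm \<Omega> (partial i \<phi>) = L2_norm \<Omega> (D i \<phi>)"
      using L2_norm_cong_AE[OF test_function_H1(2)[OF \<phi>(1)] H1_D(2)[OF \<phi>1] \<phi>L(2)] by simp
    also have "\<dots> \<le> L2_norm \<Omega> (D i v) + d"
      using L2.nrm_reverse_triangle[OF H1_D(2)[OF v1] H1_D(2)[OF \<phi>1], of i i]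
        L2_norm_diff_D_le[OF v1 \<phi>1, of i] \<phi>(2) by simp
    finally have "L2_norm \<Omega> v \<le> d + 2 * R * (L2_norm \<Omega> (D i v) + d)"
      using R(1) by simp
    also have "\<dots> = 2 * R * L2_norm \<Omega> (D i v) + e"
      using d by (simp add: algebra_simps)
    finally show "L2_norm \<Omega> v \<le> 2 * R * L2_norm \<Omega> (D i v) + e" .
  qed
  then show ?thesis using R(1) by (intro exI[of _ "2 * R"]) simp
qed

text \<open>The functions and each of their derivatives converge separately in \<open>L2\<close>.
  The defining identity of the weak derivative passes to the limit for a fixed test function, so the
  limits of the derivatives are the derivatives of the limit.\<close>

theorem H1_complete:
  assumes X: "\<And>n::nat. X n \<in> H1 \<Omega>"
    and cauchy: "\<And>e. 0 < e \<Longrightarrow> \<exists>k. \<forall>m\<ge>k. \<forall>n\<ge>k. H1_norm \<Omega> (\<lambda>x. X m x - X n x) < e"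
  shows "\<exists>v\<in>H1 \<Omega>. (\<lambda>n. H1_norm \<Omega> (\<lambda>x. X n x - v x)) \<longlonglongrightarrow> 0"
proof -
  note XL = H1_D[OF X]
  have "\<exists>v\<in>L2 \<Omega>. (\<lambda>n. L2_norm \<Omega> (\<lambda>x. X n x - v x)) \<longlonglongrightarrow> 0"
  proof (rule L2_complete[OF finite_measure_domain XL(1)])
    fix e :: real assume "0 < e"
    then obtain k where "\<forall>m\<ge>k. \<forall>n\<ge>k. H1_norm \<Omega> (\<lambda>x. X m x - X n x) < e" using cauchy by blast
    then show "\<exists>k. \<forall>m\<ge>k. \<forall>n\<ge>k. L2_norm \<Omega> (\<lambda>x. X m x - X n x) < e"
      by (intro exI[of _ k] allI impI le_less_trans[OF L2_norm_le_H1_norm(1)[OF H1.diff_mem[OF X X]]])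
        simp
  qed
  then obtain v where v: "v \<in> L2 \<Omega>" and lim: "(\<lambda>n. L2_norm \<Omega> (\<lambda>x. X n x - v x)) \<longlonglongrightarrow> 0" by blast
  have "\<exists>g\<in>L2 \<Omega>. (\<lambda>n. L2_norm \<Omega> (\<lambda>x. D i (X n) x - g x)) \<longlonglongrightarrow> 0" for i
  proof (rule L2_complete[OF finite_measure_domain XL(2)])
    fix e :: real assume "0 < e"
    then obtain k where "\<forall>m\<ge>k. \<forall>n\<ge>k. H1_norm \<Omega> (\<lambda>x. X m x - X n x) < e" using cauchy by blast
    then show "\<exists>k. \<forall>m\<ge>k. \<forall>n\<ge>k. L2_norm \<Omega> (\<lambda>x. D i (X m) x - D i (X n) x) < e"
      by (intro exI[of _ k] allI impI le_less_trans[OF L2_norm_diff_D_le[OF X X]]) simp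
  qed
  then have "\<exists>g. \<forall>i. g i \<in> L2 \<Omega> \<and> (\<lambda>n. L2_norm \<Omega> (\<lambda>x. D i (X n) x - g i x)) \<longlonglongrightarrow> 0"
    by (intro choice allI) blast
  then obtain g where g: "\<And>i. g i \<in> L2 \<Omega>"
    and limg: "\<And>i. (\<lambda>n. L2_norm \<Omega> (\<lambda>x. D i (X n) x - g i x)) \<longlonglongrightarrow> 0" by blast
  have wp: "is_weak_partial \<Omega> i v (g i)" for i
    unfolding is_weak_partial_def
  proof (intro conjI ballI)
    show "locally_integrable \<Omega> v" "locally_integrable \<Omega> (g i)"
      using v g sets_domain by (simp_all add: L2_locally_integrable)
    fix \<phi> assume \<phi>: "\<phi> \<in> test_functions \<Omega>"
    note L = test_function_L2[OF \<phi>]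
    have l1: "(\<lambda>n. L2_inner \<Omega> (X n) (partial i \<phi>)) \<longlonglongrightarrow> L2_inner \<Omega> v (partial i \<phi>)"
      by (rule L2.form_tendsto[OF XL(1) v L(2) lim])
    have eq: "L2_inner \<Omega> (X n) (partial i \<phi>) = - L2_inner \<Omega> (D i (X n)) \<phi>" for n
      using H1_D(3)[OF X[of n], of i] \<phi> by (simp add: is_weak_partial_def)
    have l2: "(\<lambda>n. - L2_inner \<Omega> (D i (X n)) \<phi>) \<longlonglongrightarrow> - L2_inner \<Omega> (g i) \<phi>"
      by (intro tendsto_minus L2.form_tendsto[OF XL(2) g L(1) limg])
    show "L2_inner \<Omega> v (partial i \<phi>) = - L2_inner \<Omega> (g i) \<phi>"
      by (rule LIMSEQ_unique[OF l1[unfolded eq] l2])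
  qed
  have vH: "v \<in> H1 \<Omega>" by (rule H1_I[OF v g wp])
  have up: "H1_norm \<Omega> (\<lambda>x. X n x - v x) \<le>
      L2_norm \<Omega> (\<lambda>x. X n x - v x) + (\<Sum>i\<in>UNIV. L2_norm \<Omega> (\<lambda>x. D i (X n) x - g i x))" for n
  proof -
    note m = H1.diff_mem[OF X[of n] vH]
    have "AE x in lebesgue_on \<Omega>. D i (\<lambda>x. X n x - v x) x = D i (X n) x - g i x" for i
      using H1_diff_D[OF X[of n] vH, of i] weak_partial_AE_eq[OF wp[of i]] by eventually_elim simp
    then have eq: "L2_norm \<Omega> (D i (\<lambda>x. X n x - v x)) = L2_norm \<Omega> (\<lambda>x. D i (X n) x - g i x)" for i
      by (rule L2_norm_cong_AE[OF _ H1_D(2)[OF m] L2.diff_mem[OF XL(2) g]])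
    show ?thesis using H1_norm_le[OF m] unfolding eq .
  qed
  have "(\<lambda>n. L2_norm \<Omega> (\<lambda>x. X n x - v x) + (\<Sum>i\<in>UNIV. L2_norm \<Omega> (\<lambda>x. D i (X n) x - g i x)))
      \<longlonglongrightarrow> 0 + (\<Sum>i\<in>(UNIV :: 'd set). 0)"
    by (intro tendsto_add tendsto_sum lim limg)
  then have "(\<lambda>n. L2_norm \<Omega> (\<lambda>x. X n x - v x) + (\<Sum>i\<in>UNIV. L2_norm \<Omega> (\<lambda>x. D i (X n) x - g i x)))
      \<longlonglongrightarrow> 0" by (simp only: sum.neutral_const add_0)
  moreover have "norm (H1_norm \<Omega> (\<lambda>x. X n x - v x)) \<le>
      L2_norm \<Omega> (\<lambda>x. X n x - v x) + (\<Sum>i\<in>UNIV. L2_norm \<Omega> (\<lambda>x. D i (X n) x - g i x))" for n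
  proof -
    have "0 \<le> H1_norm \<Omega> (\<lambda>x. X n x - v x)"
      unfolding H1_norm_def by (intro real_sqrt_ge_zero add_nonneg_nonneg sum_nonneg zero_le_power2)
    then show ?thesis using up[of n] by simp
  qed
  ultimately have "(\<lambda>n. H1_norm \<Omega> (\<lambda>x. X n x - v x)) \<longlonglongrightarrow> 0"
    by (rule Lim_null_comparison[OF always_eventually[OF allI], rotated])
  with vH show ?thesis by blast
qed

text \<open>A test function close to a late \<open>X n\<close> is close to \<open>v\<close>.\<close>

lemma H10_closed:
  assumes X: "\<And>n::nat. X n \<in> H10 \<Omega>" and v: "v \<in> H1 \<Omega>"
    and lim: "(\<lambda>n. H1_norm \<Omega> (\<lambda>x. X n x - v x)) \<longlonglongrightarrow> 0"
  shows "v \<in> H10 \<Omega>"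
  unfolding H10_def
proof (intro CollectI conjI allI impI v)
  fix e :: real assume e: "0 < e"
  have "eventually (\<lambda>n. H1_norm \<Omega> (\<lambda>x. X n x - v x) < e / 2) sequentially"
    using order_tendstoD(2)[OF lim, of "e / 2"] e by simp
  then obtain n where n: "H1_norm \<Omega> (\<lambda>x. X n x - v x) < e / 2"
    using eventually_happens'[OF sequentially_bot] by blast
  have e2: "0 < e / 2" using e by simp
  obtain \<phi> where \<phi>: "\<phi> \<in> test_functions \<Omega>" "H1_norm \<Omega> (\<lambda>x. X n x - \<phi> x) < e / 2"
    by (rule H10_approx[OF X[of n] e2])
  note Xn = H10_H1[OF X[of n]] and \<phi>1 = test_function_H1(1)[OF \<phi>(1)]
  have "H1_norm \<Omega> (\<lambda>x. v x - \<phi> x) \<le> H1_norm \<Omega> (\<lambda>x. v x - X n x) + H1_norm \<Omega> (\<lambda>x. X n x - \<phi> x)"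
    using H1_norm_triangle[OF H1.diff_mem[OF v Xn] H1.diff_mem[OF Xn \<phi>1]] by simp
  also have "H1_norm \<Omega> (\<lambda>x. v x - X n x) = H1_norm \<Omega> (\<lambda>x. X n x - v x)"
    using H1_norm_scale[OF H1.diff_mem[OF Xn v], of "-1"] by simp
  finally show "\<exists>\<phi>\<in>test_functions \<Omega>. H1_norm \<Omega> (\<lambda>x. v x - \<phi> x) < e"
    using n \<phi> by (intro bexI[OF _ \<phi>(1)]) simp
qed

end

text \<open>Each term of the form is bounded by Cauchy-Schwarz and the essential bound of its
  coefficient. This half of the norm equivalence turns \<open>H1\<close> limits into energy
  limits.\<close>

lemma (in semidefinite_coefficients) energy_norm_le_H1_norm:
  "\<exists>M\<ge>0. \<forall>v\<in>H1 \<Omega>. energy_norm \<Omega> A c v \<le> M * H1_norm \<Omega> v"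
proof -
  have bound: "\<exists>M\<ge>0. \<forall>f\<in>L2 \<Omega>. \<forall>g\<in>L2 \<Omega>. L2_inner \<Omega> (\<lambda>x. k x * f x) g \<le> M * (L2_norm \<Omega> f * L2_norm \<Omega> g)"
    if k: "k \<in> Linf \<Omega>" for k
  proof -
    obtain M where M: "0 \<le> M" "\<And>f. f \<in> L2 \<Omega> \<Longrightarrow> L2_norm \<Omega> (\<lambda>x. k x * f x) \<le> M * L2_norm \<Omega> f"
      using Linf_mult_L2(2)[OF k] by blast
    have "L2_inner \<Omega> (\<lambda>x. k x * f x) g \<le> M * (L2_norm \<Omega> f * L2_norm \<Omega> g)"
      if fg: "f \<in> L2 \<Omega>" "g \<in> L2 \<Omega>" for f g
    proof -
      have "L2_inner \<Omega> (\<lambda>x. k x * f x) g \<le> L2_norm \<Omega> (\<lambda>x. k x * f x) * L2_norm \<Omega> g"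
        using L2.cauchy_schwarz[OF Linf_mult_L2(1)[OF k fg(1)] fg(2)] by simp
      also have "\<dots> \<le> M * L2_norm \<Omega> f * L2_norm \<Omega> g"
        by (rule mult_right_mono[OF M(2)[OF fg(1)] L2.nrm_nonneg[OF fg(2)]])
      finally show ?thesis by (simp add: mult.assoc)
    qed
    with M(1) show ?thesis by blast
  qed
  have "\<exists>M. \<forall>i j. 0 \<le> M i j \<and> (\<forall>f\<in>L2 \<Omega>. \<forall>g\<in>L2 \<Omega>.
      L2_inner \<Omega> (\<lambda>x. A x $ i $ j * f x) g \<le> M i j * (L2_norm \<Omega> f * L2_norm \<Omega> g))"
    using bound[OF A_Linf] by (intro choice allI) blast
  then obtain M where M: "\<And>i j. 0 \<le> M i j" "\<And>i j f g. f \<in> L2 \<Omega> \<Longrightarrow> g \<in> L2 \<Omega> \<Longrightarrow>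
      L2_inner \<Omega> (\<lambda>x. A x $ i $ j * f x) g \<le> M i j * (L2_norm \<Omega> f * L2_norm \<Omega> g)"
    by blast
  obtain N where N: "0 \<le> N" "\<And>f g. f \<in> L2 \<Omega> \<Longrightarrow> g \<in> L2 \<Omega> \<Longrightarrow>
      L2_inner \<Omega> (\<lambda>x. c x * f x) g \<le> N * (L2_norm \<Omega> f * L2_norm \<Omega> g)"
    using bound[OF c_Linf] by blast
  define Q where "Q = (\<Sum>i\<in>UNIV. \<Sum>j\<in>UNIV. M i j) + N"
  have Q: "0 \<le> Q" using M N by (simp add: Q_def sum_nonneg)
  have "energy_norm \<Omega> A c v \<le> sqrt Q * H1_norm \<Omega> v" if v: "v \<in> H1 \<Omega>" for v
  proof -
    let ?h = "H1_norm \<Omega> v"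
    note L = H1_D[OF v] and le = L2_norm_le_H1_norm[OF v]
    have h: "0 \<le> ?h" using le(1) L2.nrm_nonneg[OF L(1)] by linarith
    have "bform \<Omega> A c v v \<le> (\<Sum>i\<in>UNIV. \<Sum>j\<in>UNIV. M i j * (?h * ?h)) + N * (?h * ?h)"
      unfolding bform_eq_sum[OF v v]
    proof (intro add_mono sum_mono)
      show "L2_inner \<Omega> (\<lambda>x. A x $ i $ j * D i v x) (D j v) \<le> M i j * (?h * ?h)" for i j
        using M(2)[OF L(2) L(2), of i j i j] M(1)[of i j] le(2)[of i] le(2)[of j] h
          L2.nrm_nonneg[OF L(2), of i] L2.nrm_nonneg[OF L(2), of j]
        by (meson mult_left_mono mult_mono order_trans)
      show "L2_inner \<Omega> (\<lambda>x. c x * v x) v \<le> N * (?h * ?h)"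
        using N(2)[OF L(1) L(1)] N(1) le(1) h L2.nrm_nonneg[OF L(1)]
        by (meson mult_left_mono mult_mono order_trans)
    qed
    also have "\<dots> = Q * ?h\<^sup>2"
      by (simp add: Q_def power2_eq_square distrib_right sum_distrib_right)
    finally show ?thesis
      unfolding energy_norm_def using h Q
      by (intro real_le_lsqrt) (simp_all add: power_mult_distrib)
  qed
  then show ?thesis using Q by (intro exI[of _ "sqrt Q"]) simp
qed

locale elliptic_coefficients = semidefinite_coefficients \<Omega> A c
  for \<Omega> :: "(real ^ 'd::finite) set" and A c +
  assumes A_elliptic: "\<exists>\<theta>>0. AE x in lebesgue_on \<Omega>. \<forall>\<xi>. \<theta> * (norm \<xi>)\<^sup>2 \<le> \<xi> \<bullet> (A x *v \<xi>)"
begin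

text \<open>Poincare bounds the \<open>L2\<close> part by the gradient and ellipticity bounds the
  gradient by the form, whence \<open>Q = (C\<^sup>2 + 1) / \<theta>\<close>.\<close>

theorem energy_coercive:
  "\<exists>K>0. \<forall>v\<in>H10 \<Omega>. H1_norm \<Omega> v \<le> K * energy_norm \<Omega> A c v"
proof -
  obtain C where C: "0 \<le> C" "\<And>v i. v \<in> H10 \<Omega> \<Longrightarrow> L2_norm \<Omega> v \<le> C * L2_norm \<Omega> (D i v)"
    using poincare by blast
  obtain \<theta> where \<theta>: "0 < \<theta>" "AE x in lebesgue_on \<Omega>. \<forall>\<xi>. \<theta> * (norm \<xi>)\<^sup>2 \<le> \<xi> \<bullet> (A x *v \<xi>)"
    using A_elliptic by blast
  define Q where "Q = (C\<^sup>2 + 1) / \<theta>"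
  have Q: "0 < Q" using \<theta>(1) by (simp add: Q_def add_nonneg_pos)
  have "H1_norm \<Omega> v \<le> sqrt Q * energy_norm \<Omega> A c v" if v: "v \<in> H10 \<Omega>" for v
  proof -
    note v1 = H10_H1[OF v]
    let ?s = "\<Sum>i\<in>UNIV. (L2_norm \<Omega> (D i v))\<^sup>2"
    have "(L2_norm \<Omega> v)\<^sup>2 \<le> C\<^sup>2 * ?s"
    proof -
      \<comment> \<open>Any one coordinate direction will do, its derivative being part of the
        gradient sum.\<close>
      fix i :: 'd
      have "(L2_norm \<Omega> v)\<^sup>2 \<le> (C * L2_norm \<Omega> (D i v))\<^sup>2"
        by (rule power_mono[OF C(2)[OF v] L2.nrm_nonneg[OF H1_D(1)[OF v1]]])
      also have "\<dots> = C\<^sup>2 * (L2_norm \<Omega> (D i v))\<^sup>2" by (rule power_mult_distrib)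
      also have "\<dots> \<le> C\<^sup>2 * ?s" by (intro mult_left_mono member_le_sum) simp_all
      finally show ?thesis .
    qed
    then have "(L2_norm \<Omega> v)\<^sup>2 + ?s \<le> (C\<^sup>2 + 1) * ?s" by (simp add: algebra_simps)
    also have "\<dots> \<le> (C\<^sup>2 + 1) * (bform \<Omega> A c v v / \<theta>)"
      using bform_ge[OF v1 \<theta>(2)] \<theta>(1) by (intro mult_left_mono) (simp_all add: field_simps)
    also have "\<dots> = Q * bform \<Omega> A c v v" by (simp add: Q_def)
    finally have "H1_norm \<Omega> v \<le> sqrt (Q * bform \<Omega> A c v v)"
      unfolding H1_norm_def by (rule real_sqrt_le_mono)
    then show ?thesis by (simp add: energy_norm_def real_sqrt_mult)
  qed
  then show ?thesis using Q by (intro exI[of _ "sqrt Q"]) simp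
qed

text \<open>Riesz representation in \<open>H10\<close> with the energy form. Completeness is
  transported: coercivity turns an energy Cauchy sequence into an \<open>H1\<close> Cauchy sequence,
  its limit stays in the closed subspace \<open>H10\<close>, and the upper bound of the energy norm
  brings convergence back.\<close>

theorem state_exists:
  assumes f: "f \<in> L2 \<Omega>"
  shows "\<exists>w. is_state \<Omega> A c f w"
proof -
  interpret E: psd_form "H10 \<Omega>" "bform \<Omega> A c"
    rewrites "psd_form.nrm (bform \<Omega> A c) = energy_norm \<Omega> A c"
  proof -
    show "psd_form (H10 \<Omega>) (bform \<Omega> A c)"
    proof
      fix u v w :: "real ^ 'd \<Rightarrow> real" and r :: real
      show "(\<lambda>x. 0) \<in> H10 \<Omega>" by (rule zero_H10)
      show "v \<in> H10 \<Omega> \<Longrightarrow> w \<in> H10 \<Omega> \<Longrightarrow> (\<lambda>x. v x + w x) \<in> H10 \<Omega>"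
        using H10_lincomb[of v w 1] by simp
      show "v \<in> H10 \<Omega> \<Longrightarrow> (\<lambda>x. r * v x) \<in> H10 \<Omega>"
        using H10_lincomb[OF zero_H10, of v r] by simp
    qed (simp_all add: H10_H1 energy.form_simps energy.form_nonneg energy.form_sym)
    show "psd_form.nrm (bform \<Omega> A c) = energy_norm \<Omega> A c"
      by (simp add: fun_eq_iff psd_form.nrm_def[OF psd_form_bform] energy_norm_def)
  qed
  obtain K where K: "0 < K" "\<And>v. v \<in> H10 \<Omega> \<Longrightarrow> H1_norm \<Omega> v \<le> K * energy_norm \<Omega> A c v"
    using energy_coercive by blast
  obtain M where M: "0 \<le> M" "\<And>v. v \<in> H1 \<Omega> \<Longrightarrow> energy_norm \<Omega> A c v \<le> M * H1_norm \<Omega> v"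
    using energy_norm_le_H1_norm by blast
  have "\<exists>w\<in>H10 \<Omega>. \<forall>v\<in>H10 \<Omega>. bform \<Omega> A c w v = L2_inner \<Omega> f v"
  proof (rule E.riesz_representation)
    show "L2_inner \<Omega> f (\<lambda>x. v x + w x) = L2_inner \<Omega> f v + L2_inner \<Omega> f w"
      if "v \<in> H10 \<Omega>" "w \<in> H10 \<Omega>" for v w
      using that f by (simp add: L2.form_simps H1_D(1)[OF H10_H1])
    show "L2_inner \<Omega> f (\<lambda>x. r * v x) = r * L2_inner \<Omega> f v" if "v \<in> H10 \<Omega>" for v r
      using that f by (simp add: L2.form_simps H1_D(1)[OF H10_H1])
    show "\<bar>L2_inner \<Omega> f v\<bar> \<le> (L2_norm \<Omega> f * K) * energy_norm \<Omega> A c v" if v: "v \<in> H10 \<Omega>" for v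
    proof -
      have "\<bar>L2_inner \<Omega> f v\<bar> \<le> L2_norm \<Omega> f * L2_norm \<Omega> v"
        by (rule L2.cauchy_schwarz[OF f H1_D(1)[OF H10_H1[OF v]]])
      also have "\<dots> \<le> L2_norm \<Omega> f * (K * energy_norm \<Omega> A c v)"
        using L2_norm_le_H1_norm(1)[OF H10_H1[OF v]] K(2)[OF v]
        by (intro mult_left_mono L2.nrm_nonneg f) simp
      finally show ?thesis by (simp add: mult.assoc)
    qed
    fix X assume X: "\<And>n::nat. X n \<in> H10 \<Omega>"
      and cauchy: "\<And>e. 0 < e \<Longrightarrow> \<exists>k. \<forall>m\<ge>k. \<forall>n\<ge>k. energy_norm \<Omega> A c (\<lambda>x. X m x - X n x) < e"
    have "\<exists>v\<in>H1 \<Omega>. (\<lambda>n. H1_norm \<Omega> (\<lambda>x. X n x - v x)) \<longlonglongrightarrow> 0"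
    proof (rule H1_complete[OF H10_H1[OF X]])
      fix e :: real assume "0 < e"
      then have "0 < e / K" using K(1) by simp
      then obtain k where k: "\<forall>m\<ge>k. \<forall>n\<ge>k. energy_norm \<Omega> A c (\<lambda>x. X m x - X n x) < e / K"
        using cauchy by blast
      have "H1_norm \<Omega> (\<lambda>x. X m x - X n x) < e" if "k \<le> m" "k \<le> n" for m n
      proof -
        have "H1_norm \<Omega> (\<lambda>x. X m x - X n x) \<le> K * energy_norm \<Omega> A c (\<lambda>x. X m x - X n x)"
          by (rule K(2)[OF H10_diff[OF X X]])
        also have "\<dots> < K * (e / K)" using k that K(1) by (intro mult_strict_left_mono) simp_all
        finally show ?thesis using K(1) by simp
      qed
      then show "\<exists>k. \<forall>m\<ge>k. \<forall>n\<ge>k. H1_norm \<Omega> (\<lambda>x. X m x - X n x) < e" by blast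
    qed
    then obtain v where v: "v \<in> H1 \<Omega>" and lim: "(\<lambda>n. H1_norm \<Omega> (\<lambda>x. X n x - v x)) \<longlonglongrightarrow> 0" by blast
    have v0: "v \<in> H10 \<Omega>" by (rule H10_closed[OF X v lim])
    have limM: "(\<lambda>n. M * H1_norm \<Omega> (\<lambda>x. X n x - v x)) \<longlonglongrightarrow> 0"
      using tendsto_mult_right_zero[OF lim] .
    have "norm (energy_norm \<Omega> A c (\<lambda>x. X n x - v x)) \<le> M * H1_norm \<Omega> (\<lambda>x. X n x - v x)" for n
      using M(2)[OF H10_H1[OF H10_diff[OF X[of n] v0]]] E.nrm_nonneg[OF H10_diff[OF X[of n] v0]] by simp
    then have "(\<lambda>n. energy_norm \<Omega> A c (\<lambda>x. X n x - v x)) \<longlonglongrightarrow> 0"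
      by (intro Lim_null_comparison[OF always_eventually limM] allI)
    with v0 show "\<exists>v\<in>H10 \<Omega>. (\<lambda>n. energy_norm \<Omega> A c (\<lambda>x. X n x - v x)) \<longlonglongrightarrow> 0" by blast
  qed
  then show ?thesis unfolding is_state_def by blast
qed

end

section \<open>Error estimates\<close>

context elliptic_coefficients
begin

abbreviation (input) form :: "(real ^ 'd \<Rightarrow> real) \<Rightarrow> (real ^ 'd \<Rightarrow> real) \<Rightarrow> real" where
  "form \<equiv> bform \<Omega> A c"

abbreviation (input) en :: "(real ^ 'd \<Rightarrow> real) \<Rightarrow> real" where
  "en \<equiv> energy_norm \<Omega> A c"

abbreviation (input) nrm2 :: "(real ^ 'd \<Rightarrow> real) \<Rightarrow> real" where
  "nrm2 \<equiv> L2_norm \<Omega>"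

abbreviation (input) state :: "(real ^ 'd \<Rightarrow> real) \<Rightarrow> (real ^ 'd \<Rightarrow> real) \<Rightarrow> bool" where
  "state \<equiv> is_state \<Omega> A c"

section \<open>Stability of the solution operator\<close>

lemma H10_L2: "v \<in> H10 \<Omega> \<Longrightarrow> v \<in> L2 \<Omega>"
  by (rule H1_D(1)[OF H10_H1])

text \<open>A named constant, fixed by the domain and the coefficients, lets the later estimates
  display their constants explicitly; independence of the mesh is then visible.\<close>

definition embedding_const :: real where
  "embedding_const = (SOME K. 0 < K \<and> (\<forall>v\<in>H10 \<Omega>. nrm2 v \<le> K * en v))"

lemma embedding_const: "0 < embedding_const" "v \<in> H10 \<Omega> \<Longrightarrow> nrm2 v \<le> embedding_const * en v"
proof -
  obtain K where K: "0 < K" "\<And>v. v \<in> H10 \<Omega> \<Longrightarrow> H1_norm \<Omega> v \<le> K * en v"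
    using energy_coercive by blast
  have "\<exists>K. 0 < K \<and> (\<forall>v\<in>H10 \<Omega>. nrm2 v \<le> K * en v)"
  proof (intro exI conjI ballI)
    show "0 < K" by (rule K(1))
    show "nrm2 v \<le> K * en v" if "v \<in> H10 \<Omega>" for v
      by (rule order_trans[OF L2_norm_le_H1_norm(1)[OF H10_H1[OF that]] K(2)[OF that]])
  qed
  from someI_ex[OF this, folded embedding_const_def]
  show "0 < embedding_const" "v \<in> H10 \<Omega> \<Longrightarrow> nrm2 v \<le> embedding_const * en v" by simp_all
qed

lemma en_nonneg: "v \<in> H10 \<Omega> \<Longrightarrow> 0 \<le> en v"
  by (rule energy.nrm_nonneg[OF H10_H1])

lemma state_H10: "state f w \<Longrightarrow> w \<in> H10 \<Omega>"
  by (simp add: is_state_def)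

lemma stateD: "state f w \<Longrightarrow> v \<in> H10 \<Omega> \<Longrightarrow> form w v = L2_inner \<Omega> f v"
  by (simp add: is_state_def)

lemma adjoint_state_iff: "is_adjoint_state \<Omega> A c g q \<longleftrightarrow> state g q"
  unfolding is_state_def is_adjoint_state_def
  by (intro conj_cong ball_cong refl) (simp add: bform_sym[OF H10_H1 H10_H1])

lemma sol_op_state: "f \<in> L2 \<Omega> \<Longrightarrow> state f (sol_op \<Omega> A c f)"
  unfolding sol_op_def by (rule someI_ex[OF state_exists])

lemma adj_sol_op_eq: "adj_sol_op \<Omega> A c = sol_op \<Omega> A c"
  by (simp add: fun_eq_iff adj_sol_op_def sol_op_def adjoint_state_iff)

text \<open>\<open>sol_op\<close> selects representatives and so is not known to be linear as a map
  into functions; linearity of the equation is therefore expressed through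
  \<open>is_state\<close>.\<close>

lemma state_lincomb:
  assumes "f \<in> L2 \<Omega>" "g \<in> L2 \<Omega>" and w: "state f w" and z: "state g z"
  shows "state (\<lambda>x. f x + r * g x) (\<lambda>x. w x + r * z x)"
  unfolding is_state_def
proof (intro conjI ballI)
  note wz = state_H10[OF w] state_H10[OF z]
  show "(\<lambda>x. w x + r * z x) \<in> H10 \<Omega>" by (rule H10_lincomb[OF wz])
  fix v assume v: "v \<in> H10 \<Omega>"
  show "form (\<lambda>x. w x + r * z x) v = L2_inner \<Omega> (\<lambda>x. f x + r * g x) v"
    using assms(1,2) wz v
    by (simp add: energy.form_simps L2.form_simps H10_H1 H10_L2 stateD[OF w v] stateD[OF z v])
qed

lemma state_diff:
  assumes "f \<in> L2 \<Omega>" "g \<in> L2 \<Omega>" "state f w" "state g z"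
  shows "state (\<lambda>x. f x - g x) (\<lambda>x. w x - z x)"
  using state_lincomb[OF assms, of "-1"] by simp

text \<open>The state equation is tested with \<open>w\<close> itself and one factor
  \<open>en w\<close> is cancelled.\<close>

lemma state_energy_le:
  assumes f: "f \<in> L2 \<Omega>" and w: "state f w"
  shows "en w \<le> embedding_const * nrm2 f"
proof (cases "en w = 0")
  case True
  then show ?thesis using embedding_const(1) L2.nrm_nonneg[OF f] by simp
next
  case False
  note w0 = state_H10[OF w]
  have "en w * en w = form w w"
    using energy.nrm_sq[OF H10_H1[OF w0]] by (simp add: power2_eq_square)
  also have "\<dots> = L2_inner \<Omega> f w" by (rule stateD[OF w w0])
  also have "\<dots> \<le> nrm2 f * nrm2 w" using L2.cauchy_schwarz[OF f H10_L2[OF w0]] by simp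
  also have "\<dots> \<le> nrm2 f * (embedding_const * en w)"
    by (rule mult_left_mono[OF embedding_const(2)[OF w0] L2.nrm_nonneg[OF f]])
  finally have "en w * en w \<le> (embedding_const * nrm2 f) * en w" by (simp add: mult_ac)
  then show ?thesis using False en_nonneg[OF w0] by (simp add: mult_le_cancel_right)
qed

lemma state_L2_le:
  assumes "f \<in> L2 \<Omega>" "state f w"
  shows "nrm2 w \<le> embedding_const\<^sup>2 * nrm2 f"
proof -
  have "nrm2 w \<le> embedding_const * en w" by (rule embedding_const(2)[OF state_H10[OF assms(2)]])
  also have "\<dots> \<le> embedding_const * (embedding_const * nrm2 f)"
    using state_energy_le[OF assms] embedding_const(1) by (intro mult_left_mono) simp_all
  finally show ?thesis by (simp add: power2_eq_square mult.assoc)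
qed

section \<open>Best approximation, \<open>kappa\<close> and duality\<close>

lemma FE_space_H10: "v \<in> FE_space \<Omega> \<T> \<Longrightarrow> v \<in> H10 \<Omega>"
  by (simp add: FE_space_def)

lemma zero_FE_space: "(\<lambda>x. 0) \<in> FE_space \<Omega> \<T>"
proof -
  have "\<exists>g k. \<forall>x\<in>T. 0 = g \<bullet> x + k" for T :: "(real ^ 'd) set"
    by (rule exI[of _ 0], rule exI[of _ 0]) simp
  then show ?thesis unfolding FE_space_def using zero_H10 by simp
qed

text \<open>The infimum and the supremum in \<open>kappa\<close> are real-valued, so they are
  meaningful only with bounds. Comparing with the zero element of the discrete space bounds the
  infimum uniformly over loads of norm 1.\<close>

lemma best_approx:
  fixes \<T> :: "(real ^ 'd) set set"
  assumes f: "f \<in> L2 \<Omega>"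
  defines "e \<equiv> (INF v\<in>FE_space \<Omega> \<T>. en (\<lambda>x. sol_op \<Omega> A c f x - v x))"
  shows "0 \<le> e" and "e \<le> embedding_const * nrm2 f"
proof -
  note w = sol_op_state[OF f]
  have nonneg: "0 \<le> en (\<lambda>x. sol_op \<Omega> A c f x - v x)" if "v \<in> FE_space \<Omega> \<T>" for v
    by (rule en_nonneg[OF H10_diff[OF state_H10[OF w] FE_space_H10[OF that]]])
  show "0 \<le> e"
    unfolding e_def using zero_FE_space nonneg by (intro cINF_greatest) blast+
  have "e \<le> en (\<lambda>x. sol_op \<Omega> A c f x - 0)"
    unfolding e_def using nonneg by (intro cINF_lower[OF _ zero_FE_space] bdd_belowI2[where m = 0])
  also have "\<dots> \<le> embedding_const * nrm2 f" using state_energy_le[OF f w] by simp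
  finally show "e \<le> embedding_const * nrm2 f" .
qed

lemma best_approx_le_kappa:
  assumes "f \<in> L2 \<Omega>" "nrm2 f = 1"
  shows "(INF v\<in>FE_space \<Omega> \<T>. en (\<lambda>x. sol_op \<Omega> A c f x - v x)) \<le> kappa \<Omega> A c \<T>"
  unfolding kappa_def
proof (rule cSUP_upper)
  show "f \<in> {f \<in> L2 \<Omega>. nrm2 f = 1}" using assms by simp
  show "bdd_above ((\<lambda>f. INF v\<in>FE_space \<Omega> \<T>. en (\<lambda>x. sol_op \<Omega> A c f x - v x)) ` {f \<in> L2 \<Omega>. nrm2 f = 1})"
  proof (rule bdd_aboveI2[where M = embedding_const])
    fix f assume "f \<in> {f \<in> L2 \<Omega>. nrm2 f = 1}"
    then show "(INF v\<in>FE_space \<Omega> \<T>. en (\<lambda>x. sol_op \<Omega> A c f x - v x)) \<le> embedding_const"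
      using best_approx(2)[of f \<T>] by simp
  qed
qed

text \<open>A supremum inherits nonnegativity only from a member, so a load of norm 1 has to be
  exhibited: the normalised constant function, available because a nonempty open set has positive
  measure.\<close>

lemma kappa_nonneg:
  assumes "\<Omega> \<noteq> {}"
  shows "0 \<le> kappa \<Omega> A c \<T>"
proof -
  have one: "(\<lambda>x. 1) \<in> L2 \<Omega>"
    using finite_measure_domain by (intro bounded_in_L2[of _ _ 1]) simp_all
  have "\<not> negligible \<Omega>" using open_not_negligible[OF open_domain assms] .
  then have "measure lebesgue \<Omega> \<noteq> 0"
    using lmeasurable_domain by (simp add: negligible_iff_measure)
  moreover have "L2_inner \<Omega> (\<lambda>x. 1) (\<lambda>x. 1) = measure lebesgue \<Omega>"
    using sets_domain by (simp add: L2_inner_def measure_restrict_space)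
  ultimately have n: "nrm2 (\<lambda>x. 1) \<noteq> 0" by (simp add: L2_norm_def)
  define f where "f = (\<lambda>x :: real ^ 'd. (1 / nrm2 (\<lambda>x. 1)) * 1)"
  have f: "f \<in> L2 \<Omega>" unfolding f_def by (rule L2.scale_mem[OF one])
  have "nrm2 f = 1"
    unfolding f_def L2.nrm_scale[OF one] using n L2.nrm_nonneg[OF one] by simp
  then show ?thesis
    using best_approx(1)[OF f, of \<T>] best_approx_le_kappa[OF f, of \<T>] by linarith
qed

text \<open>The normalised error is taken as load of a dual problem with solution \<open>w\<close>.
  Then \<open>nrm2 e = form w e = form (w - v) e\<close> for every discrete \<open>v\<close> by
  Galerkin orthogonality, and the infimum over \<open>v\<close> of the energy norm of
  \<open>w - v\<close> is at most \<open>kappa\<close>.\<close>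

theorem aubin_nitsche:
  assumes ne: "\<Omega> \<noteq> {}" and e: "e \<in> H10 \<Omega>"
    and orth: "\<And>v. v \<in> FE_space \<Omega> \<T> \<Longrightarrow> form e v = 0"
  shows "nrm2 e \<le> kappa \<Omega> A c \<T> * en e"
proof (cases "nrm2 e = 0 \<or> en e = 0")
  \<comment> \<open>Here the normalisation or the later division would fail; the embedding makes
    \<open>nrm2 e\<close> zero in both cases.\<close>
  case True
  then have "nrm2 e \<le> 0" using embedding_const(2)[OF e] by auto
  also have "0 \<le> kappa \<Omega> A c \<T> * en e"
    using kappa_nonneg[OF ne] en_nonneg[OF e] by simp
  finally show ?thesis .
next
  case False
  note eL = H10_L2[OF e]
  have pos: "0 < nrm2 e" "0 < en e"
    using False L2.nrm_nonneg[OF eL] en_nonneg[OF e] by linarith+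
  define f where "f = (\<lambda>x. (1 / nrm2 e) * e x)"
  have f: "f \<in> L2 \<Omega>" "nrm2 f = 1"
    unfolding f_def L2.nrm_scale[OF eL] by (rule L2.scale_mem[OF eL], use pos in simp)
  let ?w = "sol_op \<Omega> A c f"
  note w = sol_op_state[OF f(1)]
  have le: "nrm2 e / en e \<le> en (\<lambda>x. ?w x - v x)" if v: "v \<in> FE_space \<Omega> \<T>" for v
  proof -
    note m = H10_H1[OF state_H10[OF w]] H10_H1[OF FE_space_H10[OF v]] H10_H1[OF e]
    have "nrm2 e = (1 / nrm2 e) * L2_inner \<Omega> e e"
      using pos L2.nrm_sq[OF eL] by (simp add: power2_eq_square field_simps)
    also have "\<dots> = L2_inner \<Omega> f e" unfolding f_def by (rule L2.form_scale[OF eL eL, symmetric])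
    also have "\<dots> = form ?w e" by (rule stateD[OF w e, symmetric])
    also have "\<dots> = form (\<lambda>x. ?w x - v x) e"
      using orth[OF v] m by (simp add: energy.form_simps energy.form_sym[of v e])
    also have "\<dots> \<le> en (\<lambda>x. ?w x - v x) * en e"
      using energy.cauchy_schwarz[OF energy.diff_mem[OF m(1,2)] m(3)] by simp
    finally show ?thesis using pos by (simp add: field_simps)
  qed
  have "nrm2 e / en e \<le> (INF v\<in>FE_space \<Omega> \<T>. en (\<lambda>x. ?w x - v x))"
    using zero_FE_space le by (intro cINF_greatest) blast+
  also have "\<dots> \<le> kappa \<Omega> A c \<T>" by (rule best_approx_le_kappa[OF f])
  finally show ?thesis using pos by (simp add: field_simps)
qed

section \<open>Admissible controls and first-order optimality\<close>

lemma U_ad_L2: "u \<in> U_ad \<Omega> a b \<Longrightarrow> u \<in> L2 \<Omega>"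
  by (simp add: U_ad_def)

lemma U_ad_convex:
  assumes "u \<in> U_ad \<Omega> a b" "v \<in> U_ad \<Omega> a b" "0 \<le> t" "t \<le> 1"
  shows "(\<lambda>x. u x + t * (v x - u x)) \<in> U_ad \<Omega> a b"
proof -
  have "AE x in lebesgue_on \<Omega>. a \<le> u x \<and> u x \<le> b" "AE x in lebesgue_on \<Omega>. a \<le> v x \<and> v x \<le> b"
    using assms(1,2) by (simp_all add: U_ad_def)
  then have "AE x in lebesgue_on \<Omega>. a \<le> u x + t * (v x - u x) \<and> u x + t * (v x - u x) \<le> b"
  proof eventually_elim
    case (elim x)
    have e: "u x + t * (v x - u x) = (1 - t) * u x + t * v x" by (simp add: algebra_simps)
    have "(1 - t) * a + t * a \<le> (1 - t) * u x + t * v x"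
      "(1 - t) * u x + t * v x \<le> (1 - t) * b + t * b"
      using elim assms(3,4) by (intro add_mono mult_left_mono; simp)+
    then show ?case unfolding e by (simp add: algebra_simps)
  qed
  then show ?thesis
    using assms(1,2) unfolding U_ad_def by (simp add: L2.form_simps)
qed

text \<open>\<open>ocp_solution\<close> asserts minimality of the cost, so the variational
  inequality is derived by moving from \<open>u\<close> towards \<open>v\<close>. The state moves
  affinely, hence the cost is a quadratic polynomial in \<open>t\<close>: \<open>d\<close> is its
  derivative at \<open>t = 0\<close> and \<open>s\<close> its leading coefficient.\<close>

theorem optimality_condition:
  assumes sol: "ocp_solution \<Omega> A c \<alpha> yd a b u y p" and yd: "yd \<in> L2 \<Omega>" and v: "v \<in> U_ad \<Omega> a b"
  shows "0 \<le> L2_inner \<Omega> (\<lambda>x. \<alpha> * u x + p x) (\<lambda>x. v x - u x)"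
proof -
  have u: "u \<in> U_ad \<Omega> a b" and y: "state u y" and p: "is_adjoint_state \<Omega> A c (\<lambda>x. y x - yd x) p"
    and opt: "\<And>v z. v \<in> U_ad \<Omega> a b \<Longrightarrow> state v z \<Longrightarrow> cost \<Omega> \<alpha> yd y u \<le> cost \<Omega> \<alpha> yd z v"
    using sol unfolding ocp_solution_def by blast+
  let ?z = "sol_op \<Omega> A c v"
  note z = sol_op_state[OF U_ad_L2[OF v]]
  note uL = U_ad_L2[OF u] and vL = U_ad_L2[OF v] and yL = H10_L2[OF state_H10[OF y]]
    and zL = H10_L2[OF state_H10[OF z]]
  have pL: "p \<in> H10 \<Omega>" using p by (simp add: is_adjoint_state_def)
  define d where "d = L2_inner \<Omega> (\<lambda>x. y x - yd x) (\<lambda>x. ?z x - y x) + \<alpha> * L2_inner \<Omega> u (\<lambda>x. v x - u x)"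
  define s where "s = 1/2 * L2_inner \<Omega> (\<lambda>x. ?z x - y x) (\<lambda>x. ?z x - y x)
      + \<alpha>/2 * L2_inner \<Omega> (\<lambda>x. v x - u x) (\<lambda>x. v x - u x)"
  have zy: "(\<lambda>x. ?z x - y x) \<in> L2 \<Omega>" "(\<lambda>x. y x - yd x) \<in> L2 \<Omega>" "(\<lambda>x. v x - u x) \<in> L2 \<Omega>"
    using uL vL yL zL yd by (simp_all add: L2.form_simps)
  have "0 \<le> t * d + t\<^sup>2 * s" if t: "0 < t" "t \<le> 1" for t
  proof -
    have "cost \<Omega> \<alpha> yd y u \<le> cost \<Omega> \<alpha> yd (\<lambda>x. y x + t * (?z x - y x)) (\<lambda>x. u x + t * (v x - u x))"
      using t by (intro opt U_ad_convex[OF u v] state_lincomb uL L2.diff_mem vL y state_diff z) simp_all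
    also have "(\<lambda>x. y x + t * (?z x - y x) - yd x) = (\<lambda>x. (y x - yd x) + t * (?z x - y x))"
      by (simp add: fun_eq_iff)
    then have "cost \<Omega> \<alpha> yd (\<lambda>x. y x + t * (?z x - y x)) (\<lambda>x. u x + t * (v x - u x))
        = 1/2 * (nrm2 (\<lambda>x. (y x - yd x) + t * (?z x - y x)))\<^sup>2
          + \<alpha>/2 * (nrm2 (\<lambda>x. u x + t * (v x - u x)))\<^sup>2"
      unfolding cost_def by (simp only:)
    also have "\<dots> = cost \<Omega> \<alpha> yd y u + (t * d + t\<^sup>2 * s)"
      unfolding cost_def d_def s_def L2.nrm_sq[OF zy(2)] L2.nrm_sq[OF uL]
        L2.nrm_sq[OF L2.add_mem[OF zy(2) L2.scale_mem[OF zy(1)]]] L2.form_expand[OF zy(2,1)]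
        L2.nrm_sq[OF L2.add_mem[OF uL L2.scale_mem[OF zy(3)]]] L2.form_expand[OF uL zy(3)]
      by (simp only: algebra_simps) simp
    finally show ?thesis by simp
  qed
  then have "0 \<le> d" by (rule linear_term_nonneg)
  \<comment> \<open>The adjoint equation, followed by the state equation for \<open>v - u\<close>,
    turns the derivative of the tracking term into a pairing of \<open>p\<close> with
    \<open>v - u\<close>.\<close>
  also have "L2_inner \<Omega> (\<lambda>x. y x - yd x) (\<lambda>x. ?z x - y x) = form (\<lambda>x. ?z x - y x) p"
    using p H10_diff[OF state_H10[OF z] state_H10[OF y]] unfolding is_adjoint_state_def by simp
  then have "d = L2_inner \<Omega> (\<lambda>x. v x - u x) p + \<alpha> * L2_inner \<Omega> u (\<lambda>x. v x - u x)"
    using stateD[OF state_diff[OF vL uL z y] pL] by (simp add: d_def)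
  also have "\<dots> = L2_inner \<Omega> (\<lambda>x. \<alpha> * u x + p x) (\<lambda>x. v x - u x)"
    using zy(3) uL H10_L2[OF pL]
    by (simp add: L2.form_add L2.scale_mem L2.form_scale L2.form_sym[of p])
  finally show ?thesis .
qed

text \<open>Testing each variational inequality with the other control gives
  \<open>\<alpha> \<parallel>u - u\<^sub>h\<parallel>\<^sup>2 \<le> (p\<^sub>h - p, u - u\<^sub>h)\<close>. This is used twice: crudely, to bound \<open>\<parallel>u - u\<^sub>h\<parallel>\<close> by the energy errors,
  and with \<open>q = S\<^sup>*(S u\<^sub>h - y\<^sub>d)\<close> inserted, where \<open>(q - p, u - u\<^sub>h) = - \<parallel>S (u - u\<^sub>h)\<parallel>\<^sup>2 \<le> 0\<close>, to gain the
  factor \<open>\<kappa>\<close> by duality.\<close>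

theorem energy_error_estimates:
  assumes ne: "\<Omega> \<noteq> {}" and \<alpha>: "0 < \<alpha>" and yd: "yd \<in> L2 \<Omega>"
    and sol: "ocp_solution \<Omega> A c \<alpha> yd a b u y p"
    and disc: "discrete_solution \<Omega> A c \<alpha> yd a b \<T> uh yh ph"
  defines "Y \<equiv> sol_op \<Omega> A c uh" and "P \<equiv> sol_op \<Omega> A c (\<lambda>x. yh x - yd x)"
    and "err \<equiv> en (\<lambda>x. y x - yh x) + en (\<lambda>x. p x - ph x)"
    and "C1 \<equiv> 1 + embedding_const\<^sup>2 / \<alpha> + embedding_const\<^sup>2"
  defines "C2 \<equiv> (1 + embedding_const\<^sup>2) * C1 / \<alpha>"
  defines "C3 \<equiv> embedding_const\<^sup>2 * C2 + C1"
  shows "\<bar>en (\<lambda>x. y x - yh x) - en (\<lambda>x. Y x - yh x)\<bar> \<le> embedding_const * C2 * kappa \<Omega> A c \<T> * err"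
    and "\<bar>en (\<lambda>x. p x - ph x) - en (\<lambda>x. P x - ph x)\<bar> \<le> embedding_const * C3 * kappa \<Omega> A c \<T> * err"
proof -
  let ?\<kappa> = "kappa \<Omega> A c \<T>"
  have u: "u \<in> U_ad \<Omega> a b" and y: "state u y" and p: "state (\<lambda>x. y x - yd x) p"
    using sol unfolding ocp_solution_def adjoint_state_iff by blast+
  have uh: "uh \<in> U_ad \<Omega> a b" and yhF: "yh \<in> FE_space \<Omega> \<T>" and phF: "ph \<in> FE_space \<Omega> \<T>"
    and yh_eq: "\<And>v. v \<in> FE_space \<Omega> \<T> \<Longrightarrow> form yh v = L2_inner \<Omega> uh v"
    and ph_eq: "\<And>w. w \<in> FE_space \<Omega> \<T> \<Longrightarrow> form w ph = L2_inner \<Omega> (\<lambda>x. yh x - yd x) w"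
    and uh_vi: "\<And>v. v \<in> U_ad \<Omega> a b \<Longrightarrow> 0 \<le> L2_inner \<Omega> (\<lambda>x. \<alpha> * uh x + ph x) (\<lambda>x. v x - uh x)"
    using disc unfolding discrete_solution_def by blast+
  note yh = FE_space_H10[OF yhF] and ph = FE_space_H10[OF phF]
  note uL = U_ad_L2[OF u] and uhL = U_ad_L2[OF uh]
  note y0 = state_H10[OF y] and p0 = state_H10[OF p]
  have Y: "state uh Y" unfolding Y_def by (rule sol_op_state[OF uhL])
  note Y0 = state_H10[OF Y]
  note rL = L2.diff_mem[OF H10_L2[OF yh] yd] L2.diff_mem[OF H10_L2[OF Y0] yd] L2.diff_mem[OF H10_L2[OF y0] yd]
  have P: "state (\<lambda>x. yh x - yd x) P" unfolding P_def by (rule sol_op_state[OF rL(1)])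
  define q where "q = sol_op \<Omega> A c (\<lambda>x. Y x - yd x)"
  have q: "state (\<lambda>x. Y x - yd x) q" unfolding q_def by (rule sol_op_state[OF rL(2)])
  note P0 = state_H10[OF P] and q0 = state_H10[OF q]
  note duL = L2.diff_mem[OF uL uhL]
  have SyY: "state (\<lambda>x. u x - uh x) (\<lambda>x. y x - Y x)" by (rule state_diff[OF uL uhL y Y])
  have SpP: "state (\<lambda>x. y x - yh x) (\<lambda>x. p x - P x)"
    using state_diff[OF rL(3) rL(1) p P] by simp
  have SPq: "state (\<lambda>x. yh x - Y x) (\<lambda>x. P x - q x)"
    using state_diff[OF rL(1) rL(2) P q] by simp
  have Sqp: "state (\<lambda>x. Y x - y x) (\<lambda>x. q x - p x)"
    using state_diff[OF rL(2) rL(3) q p] by simp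
  note diffL = L2.diff_mem[OF H10_L2 H10_L2]

  have key: "\<alpha> * (nrm2 (\<lambda>x. u x - uh x))\<^sup>2 \<le> L2_inner \<Omega> (\<lambda>x. ph x - p x) (\<lambda>x. u x - uh x)"
  proof -
    have "0 \<le> L2_inner \<Omega> (\<lambda>x. \<alpha> * u x + p x) (\<lambda>x. uh x - u x)
        + L2_inner \<Omega> (\<lambda>x. \<alpha> * uh x + ph x) (\<lambda>x. u x - uh x)"
      using optimality_condition[OF sol yd uh] uh_vi[OF u] by simp
    also have "\<dots> = L2_inner \<Omega> (\<lambda>x. ph x - p x) (\<lambda>x. u x - uh x)
        - \<alpha> * L2_inner \<Omega> (\<lambda>x. u x - uh x) (\<lambda>x. u x - uh x)"
      using uL uhL H10_L2[OF p0] H10_L2[OF ph] by (simp add: L2.form_simps algebra_simps)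
    finally show ?thesis by (simp add: L2.nrm_sq[OF duL])
  qed
  \<comment> \<open>Cauchy-Schwarz bounds for the right side of \<open>key\<close> contain the
    factor \<open>\<parallel>u - uh\<parallel>\<close>, which is cancelled here for both uses. If
    the control error vanishes, \<open>0 \<le> r\<close> is enough.\<close>
  have du_le: "\<alpha> * nrm2 (\<lambda>x. u x - uh x) \<le> r"
    if "L2_inner \<Omega> (\<lambda>x. ph x - p x) (\<lambda>x. u x - uh x) \<le> r * nrm2 (\<lambda>x. u x - uh x)" "0 \<le> r" for r
  proof (cases "nrm2 (\<lambda>x. u x - uh x) = 0")
    case False
    have "(\<alpha> * nrm2 (\<lambda>x. u x - uh x)) * nrm2 (\<lambda>x. u x - uh x) \<le> r * nrm2 (\<lambda>x. u x - uh x)"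
      using key that(1) by (simp add: power2_eq_square mult.assoc)
    then show ?thesis using False L2.nrm_nonneg[OF duL] by (simp add: mult_le_cancel_right)
  qed (use that(2) in simp)

  have du1: "\<alpha> * nrm2 (\<lambda>x. u x - uh x) \<le> nrm2 (\<lambda>x. ph x - p x)"
    using L2.cauchy_schwarz[OF diffL[OF ph p0] duL] L2.nrm_nonneg[OF diffL[OF ph p0]]
    by (intro du_le) simp_all
  have du2: "\<alpha> * nrm2 (\<lambda>x. u x - uh x) \<le> nrm2 (\<lambda>x. ph x - q x)"
  proof (rule du_le[OF _ L2.nrm_nonneg[OF diffL[OF ph q0]]])
    have "L2_inner \<Omega> (\<lambda>x. u x - uh x) (\<lambda>x. q x - p x) = form (\<lambda>x. q x - p x) (\<lambda>x. y x - Y x)"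
      using stateD[OF SyY H10_diff[OF q0 p0]] bform_sym H10_H1[OF H10_diff[OF q0 p0]]
        H10_H1[OF H10_diff[OF y0 Y0]] by simp
    also have "\<dots> = L2_inner \<Omega> (\<lambda>x. Y x - y x) (\<lambda>x. y x - Y x)"
      by (rule stateD[OF Sqp H10_diff[OF y0 Y0]])
    also have "\<dots> = - L2_inner \<Omega> (\<lambda>x. y x - Y x) (\<lambda>x. y x - Y x)"
      using H10_L2[OF y0] H10_L2[OF Y0] by (simp add: L2.form_simps algebra_simps)
    also have "\<dots> \<le> 0" using L2.form_nonneg[OF diffL[OF y0 Y0]] by simp
    finally have "L2_inner \<Omega> (\<lambda>x. q x - p x) (\<lambda>x. u x - uh x) \<le> 0"
      using L2.form_sym[OF duL diffL[OF q0 p0]] by simp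
    moreover have "L2_inner \<Omega> (\<lambda>x. ph x - p x) (\<lambda>x. u x - uh x) =
        L2_inner \<Omega> (\<lambda>x. ph x - q x) (\<lambda>x. u x - uh x) + L2_inner \<Omega> (\<lambda>x. q x - p x) (\<lambda>x. u x - uh x)"
      using H10_L2[OF p0] H10_L2[OF q0] H10_L2[OF ph] duL by (simp add: L2.form_diff)
    ultimately show "L2_inner \<Omega> (\<lambda>x. ph x - p x) (\<lambda>x. u x - uh x) \<le>
        nrm2 (\<lambda>x. ph x - q x) * nrm2 (\<lambda>x. u x - uh x)"
      using L2.cauchy_schwarz[OF diffL[OF ph q0] duL] by simp
  qed

  have AN1: "nrm2 (\<lambda>x. Y x - yh x) \<le> ?\<kappa> * en (\<lambda>x. Y x - yh x)"
  proof (rule aubin_nitsche[OF ne H10_diff[OF Y0 yh]])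
    fix v assume v: "v \<in> FE_space \<Omega> \<T>"
    then show "form (\<lambda>x. Y x - yh x) v = 0"
      using stateD[OF Y FE_space_H10[OF v]] yh_eq[OF v]
      by (simp add: energy.form_diff H10_H1 Y0 yh FE_space_H10)
  qed
  have AN2: "nrm2 (\<lambda>x. P x - ph x) \<le> ?\<kappa> * en (\<lambda>x. P x - ph x)"
  proof (rule aubin_nitsche[OF ne H10_diff[OF P0 ph]])
    fix v assume v: "v \<in> FE_space \<Omega> \<T>"
    note v1 = H10_H1[OF FE_space_H10[OF v]]
    show "form (\<lambda>x. P x - ph x) v = 0"
      using stateD[OF P FE_space_H10[OF v]] ph_eq[OF v] bform_sym[OF v1 H10_H1[OF ph]]
      by (simp add: energy.form_diff H10_H1 P0 ph v1)
  qed

  have \<kappa>: "0 \<le> ?\<kappa>" by (rule kappa_nonneg[OF ne])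
  note e0 = embedding_const(1)
  define ey where "ey = en (\<lambda>x. y x - yh x)"
  define ep where "ep = en (\<lambda>x. p x - ph x)"
  define du where "du = nrm2 (\<lambda>x. u x - uh x)"
  have err: "err = ey + ep" by (simp add: err_def ey_def ep_def)
  have pos: "0 \<le> ey" "0 \<le> ep" "0 \<le> du"
    unfolding ey_def ep_def du_def
    by (rule en_nonneg[OF H10_diff[OF y0 yh]] en_nonneg[OF H10_diff[OF p0 ph]] L2.nrm_nonneg[OF duL])+
  have C1: "0 \<le> C1" using \<alpha> by (simp add: C1_def)

  have yY: "en (\<lambda>x. y x - Y x) \<le> embedding_const * du" "nrm2 (\<lambda>x. y x - Y x) \<le> embedding_const\<^sup>2 * du"
    unfolding du_def by (rule state_energy_le[OF duL SyY], rule state_L2_le[OF duL SyY])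
  have pP: "en (\<lambda>x. p x - P x) \<le> embedding_const * nrm2 (\<lambda>x. y x - yh x)"
    by (rule state_energy_le[OF diffL[OF y0 yh] SpP])
  have swap: "en (\<lambda>x. v x - w x) = en (\<lambda>x. w x - v x)" "nrm2 (\<lambda>x. v x - w x) = nrm2 (\<lambda>x. w x - v x)"
    if "v \<in> H10 \<Omega>" "w \<in> H10 \<Omega>" for v w
    using energy.nrm_diff_commute[OF H10_H1 H10_H1] L2.nrm_diff_commute[OF H10_L2 H10_L2] that
    by blast+

  \<comment> \<open>The crude bound, free of \<open>kappa\<close>: it compares \<open>ph\<close>
    with \<open>p\<close> directly and uses only the embedding.\<close>
  have du_ep: "du \<le> embedding_const / \<alpha> * ep"
  proof -
    have "\<alpha> * du \<le> embedding_const * ep"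
      using du1 embedding_const(2)[OF H10_diff[OF p0 ph]] swap(2)[OF p0 ph] by (simp add: du_def ep_def)
    then show ?thesis using \<alpha> by (simp add: field_simps)
  qed
  \<comment> \<open>Detour through \<open>y\<close>: the difference \<open>y - Y\<close> solves the
    equation with load \<open>u - uh\<close>, so the crude bound contributes
    \<open>embedding_const\<^sup>2 / \<alpha>\<close>; the summand 1 of \<open>C1\<close> is for
    \<open>y - yh\<close> itself.\<close>
  have Yh: "en (\<lambda>x. Y x - yh x) \<le> C1 * err"
  proof -
    have "en (\<lambda>x. Y x - yh x) \<le> en (\<lambda>x. Y x - y x) + ey"
      unfolding ey_def by (rule energy.nrm_triangle_diff[OF Y0[THEN H10_H1] y0[THEN H10_H1] yh[THEN H10_H1]])
    also have "en (\<lambda>x. Y x - y x) \<le> embedding_const * (embedding_const / \<alpha> * ep)"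
      using yY(1) swap(1)[OF Y0 y0] mult_left_mono[OF du_ep less_imp_le[OF e0]] by simp
    also have "embedding_const * (embedding_const / \<alpha> * ep) + ey = embedding_const\<^sup>2 / \<alpha> * ep + ey" by (simp add: power2_eq_square)
    also have "\<dots> \<le> embedding_const\<^sup>2 / \<alpha> * err + err"
      using pos \<alpha> by (intro add_mono mult_left_mono) (simp_all add: err)
    also have "\<dots> \<le> C1 * err"
      using pos by (simp add: C1_def err distrib_right)
    finally show ?thesis by simp
  qed
  \<comment> \<open>Likewise through \<open>p\<close>, where \<open>p - P\<close> has load
    \<open>y - yh\<close>; this is the source of the last summand of \<open>C1\<close>.\<close>
  have Ph: "en (\<lambda>x. P x - ph x) \<le> C1 * err"
  proof -
    have "en (\<lambda>x. P x - ph x) \<le> en (\<lambda>x. P x - p x) + ep"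
      unfolding ep_def by (rule energy.nrm_triangle_diff[OF P0[THEN H10_H1] p0[THEN H10_H1] ph[THEN H10_H1]])
    also have "en (\<lambda>x. P x - p x) \<le> embedding_const * (embedding_const * ey)"
      using pP swap(1)[OF P0 p0] mult_left_mono[OF embedding_const(2)[OF H10_diff[OF y0 yh]] less_imp_le[OF e0]]
      by (simp add: ey_def)
    also have "embedding_const * (embedding_const * ey) + ep = embedding_const\<^sup>2 * ey + ep" by (simp add: power2_eq_square)
    also have "\<dots> \<le> embedding_const\<^sup>2 * err + err"
      using pos by (intro add_mono mult_left_mono) (simp_all add: err)
    also have "\<dots> \<le> C1 * err"
      using pos \<alpha> by (simp add: C1_def err distrib_right)
    finally show ?thesis by simp
  qed
  have Yh2: "nrm2 (\<lambda>x. Y x - yh x) \<le> ?\<kappa> * (C1 * err)"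
    using AN1 mult_left_mono[OF Yh \<kappa>] by simp
  have Ph2: "nrm2 (\<lambda>x. P x - ph x) \<le> ?\<kappa> * (C1 * err)"
    using AN2 mult_left_mono[OF Ph \<kappa>] by simp

  \<comment> \<open>Now \<open>ph - q\<close> is split at \<open>P\<close> into the Galerkin error
    \<open>ph - P\<close> and the state \<open>P - q\<close> with load \<open>yh - Y\<close>, the
    other Galerkin error. Both carry \<open>kappa\<close>, which explains the factor
    \<open>1 + embedding_const\<^sup>2\<close> in \<open>C2\<close>.\<close>
  have du: "du \<le> C2 * ?\<kappa> * err"
  proof -
    have "nrm2 (\<lambda>x. ph x - q x) \<le> nrm2 (\<lambda>x. ph x - P x) + nrm2 (\<lambda>x. P x - q x)"
      by (rule L2.nrm_triangle_diff[OF H10_L2[OF ph] H10_L2[OF P0] H10_L2[OF q0]])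
    also have "nrm2 (\<lambda>x. P x - q x) \<le> embedding_const\<^sup>2 * nrm2 (\<lambda>x. yh x - Y x)"
      by (rule state_L2_le[OF diffL[OF yh Y0] SPq])
    also have "\<dots> \<le> embedding_const\<^sup>2 * (?\<kappa> * (C1 * err))"
      using Yh2 swap(2)[OF Y0 yh] by (intro mult_left_mono) simp_all
    also have "nrm2 (\<lambda>x. ph x - P x) \<le> ?\<kappa> * (C1 * err)"
      using Ph2 swap(2)[OF P0 ph] by simp
    finally have "\<alpha> * du \<le> ?\<kappa> * (C1 * err) + embedding_const\<^sup>2 * (?\<kappa> * (C1 * err))"
      using du2 by (simp add: du_def)
    also have "\<dots> = \<alpha> * (C2 * ?\<kappa> * err)" using \<alpha> by (simp add: C2_def field_simps)
    finally show ?thesis using \<alpha> by simp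
  qed
  \<comment> \<open>Splitting at \<open>Y\<close>: the control error passes through \<open>S\<close>
    with factor \<open>embedding_const\<^sup>2\<close>, and duality handles \<open>Y - yh\<close>;
    the two contributions form \<open>C3\<close>.\<close>
  have yyh: "nrm2 (\<lambda>x. y x - yh x) \<le> C3 * ?\<kappa> * err"
  proof -
    have "nrm2 (\<lambda>x. y x - yh x) \<le> nrm2 (\<lambda>x. y x - Y x) + nrm2 (\<lambda>x. Y x - yh x)"
      by (rule L2.nrm_triangle_diff[OF H10_L2[OF y0] H10_L2[OF Y0] H10_L2[OF yh]])
    also have "\<dots> \<le> embedding_const\<^sup>2 * (C2 * ?\<kappa> * err) + ?\<kappa> * (C1 * err)"
      using yY(2) mult_left_mono[OF du, of "embedding_const\<^sup>2"] Yh2 by simp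
    also have "\<dots> = C3 * ?\<kappa> * err" by (simp add: C3_def algebra_simps)
    finally show ?thesis .
  qed

  have rev: "\<bar>en (\<lambda>x. v x - z x) - en (\<lambda>x. w x - z x)\<bar> \<le> en (\<lambda>x. v x - w x)"
    if "v \<in> H10 \<Omega>" "w \<in> H10 \<Omega>" "z \<in> H10 \<Omega>" for v w z
    using energy.nrm_reverse_triangle[OF H10_H1[OF H10_diff[OF that(1,3)]] H10_H1[OF H10_diff[OF that(2,3)]]]
    by simp
  have "\<bar>en (\<lambda>x. y x - yh x) - en (\<lambda>x. Y x - yh x)\<bar> \<le> en (\<lambda>x. y x - Y x)"
    by (rule rev[OF y0 Y0 yh])
  also have "\<dots> \<le> embedding_const * (C2 * ?\<kappa> * err)"
    using yY(1) mult_left_mono[OF du less_imp_le[OF e0]] by simp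
  finally show "\<bar>en (\<lambda>x. y x - yh x) - en (\<lambda>x. Y x - yh x)\<bar> \<le> embedding_const * C2 * ?\<kappa> * err"
    by (simp add: mult.assoc)
  have "\<bar>en (\<lambda>x. p x - ph x) - en (\<lambda>x. P x - ph x)\<bar> \<le> en (\<lambda>x. p x - P x)"
    by (rule rev[OF p0 P0 ph])
  also have "\<dots> \<le> embedding_const * (C3 * ?\<kappa> * err)"
    using pP mult_left_mono[OF yyh less_imp_le[OF e0]] by simp
  finally show "\<bar>en (\<lambda>x. p x - ph x) - en (\<lambda>x. P x - ph x)\<bar> \<le> embedding_const * C3 * ?\<kappa> * err"
    by (simp add: mult.assoc)
qed

end

text \<open>Converts an absolute bound into the factor hidden in the O-notation, by division by
  \<open>E\<close>; for \<open>E = 0\<close> the bound forces \<open>s = t\<close> and the factor 0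
  serves.\<close>

lemma ex_relative_remainder:
  fixes s t E k :: real
  assumes "\<bar>s - t\<bar> \<le> k * E" "0 \<le> k" "0 \<le> E"
  shows "\<exists>r. \<bar>r\<bar> \<le> k \<and> s = t + r * E"
proof (cases "E = 0")
  case True
  with assms show ?thesis by (intro exI[of _ 0]) simp
next
  case False
  with assms show ?thesis
    by (intro exI[of _ "(s - t) / E"]) (simp add: abs_divide pos_divide_le_eq)
qed

text \<open>A finite union of polytopes is bounded and its interior is open; uniform ellipticity
  gives semidefiniteness.\<close>

lemma elliptic_coefficientsI:
  fixes \<Omega> :: "(real ^ 'd::finite) set"
  assumes \<Omega>: "polyhedral_domain \<Omega>" and A: "elliptic_matrix \<Omega> A"
    and c: "c \<in> Linf \<Omega>" "AE x in lebesgue_on \<Omega>. 0 \<le> c x"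
  shows "elliptic_coefficients \<Omega> A c"
proof
  obtain T where T: "finite T" "\<forall>K\<in>T. polytope K" "\<Omega> = interior (\<Union>T)"
    using \<Omega> unfolding polyhedral_domain_def by blast
  show "open \<Omega>" by (simp add: T(3))
  have "bounded (\<Union>T)" using T(1,2) polytope_imp_bounded by (intro bounded_Union) blast+
  then show "bounded \<Omega>" using bounded_subset[OF _ interior_subset] by (simp add: T(3))
  show "(\<lambda>x. A x $ i $ j) \<in> Linf \<Omega>" for i j
    using A unfolding elliptic_matrix_def W1inf_def by blast
  show "c \<in> Linf \<Omega>" "AE x in lebesgue_on \<Omega>. 0 \<le> c x" by fact+
  show "AE x in lebesgue_on \<Omega>. transpose (A x) = A x"
    using A unfolding elliptic_matrix_def by blast
  show ell: "\<exists>\<theta>>0. AE x in lebesgue_on \<Omega>. \<forall>\<xi>. \<theta> * (norm \<xi>)\<^sup>2 \<le> \<xi> \<bullet> (A x *v \<xi>)"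
    using A unfolding elliptic_matrix_def by blast
  then obtain \<theta> where \<theta>: "0 < \<theta>" "AE x in lebesgue_on \<Omega>. \<forall>\<xi>. \<theta> * (norm \<xi>)\<^sup>2 \<le> \<xi> \<bullet> (A x *v \<xi>)"
    by blast
  show "AE x in lebesgue_on \<Omega>. \<forall>\<xi>. 0 \<le> \<xi> \<bullet> (A x *v \<xi>)"
    using \<theta>(2)
  proof (rule eventually_mono, intro allI)
    fix x and \<xi> :: "real ^ 'd" assume "\<forall>\<xi>. \<theta> * (norm \<xi>)\<^sup>2 \<le> \<xi> \<bullet> (A x *v \<xi>)"
    moreover have "0 \<le> \<theta> * (norm \<xi>)\<^sup>2" using \<theta>(1) by simp
    ultimately show "0 \<le> \<xi> \<bullet> (A x *v \<xi>)" by (meson order_trans)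
  qed
qed

theorem theorem3p3:
  fixes \<Omega> :: "(real ^ 'd::finite) set"
    and A :: "real ^ 'd \<Rightarrow> real ^ 'd ^ 'd"
    and c yd :: "real ^ 'd \<Rightarrow> real"
    and \<alpha> a b :: real
    and \<F> :: "(real ^ 'd) set set set"
  assumes "CARD('d) \<in> {2, 3}"
    and "polyhedral_domain \<Omega>"
    and "elliptic_matrix \<Omega> A"
    and "c \<in> Linf \<Omega>" and "AE x in lebesgue_on \<Omega>. 0 \<le> c x"
    and "\<alpha> > 0" and "yd \<in> L2 \<Omega>" and "a < b"
    and "\<forall>\<T>\<in>\<F>. triangulation_of \<Omega> \<T>" and "uniformly_shape_regular \<F>"
  shows "\<exists>h0>0. \<exists>C. \<forall>\<T>\<in>\<F>. mesh_size \<T> \<in> {0<..<h0} \<longrightarrow>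
    (\<forall>u y p uh yh ph.
       ocp_solution \<Omega> A c \<alpha> yd a b u y p \<and>
       discrete_solution \<Omega> A c \<alpha> yd a b \<T> uh yh ph \<longrightarrow>
       (let norm_a = energy_norm \<Omega> A c;
            y_aux = sol_op \<Omega> A c uh;
            p_aux = adj_sol_op \<Omega> A c (\<lambda>x. yh x - yd x);
            err = norm_a (\<lambda>x. y x - yh x) + norm_a (\<lambda>x. p x - ph x)
        in (\<exists>r. \<bar>r\<bar> \<le> C * kappa \<Omega> A c \<T> \<and>
                norm_a (\<lambda>x. y x - yh x) = norm_a (\<lambda>x. y_aux x - yh x) + r * err) \<and>
           (\<exists>r. \<bar>r\<bar> \<le> C * kappa \<Omega> A c \<T> \<and>
                norm_a (\<lambda>x. p x - ph x) = norm_a (\<lambda>x. p_aux x - ph x) + r * err)))"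
proof -
  interpret elliptic_coefficients \<Omega> A c
    using assms(2-5) by (rule elliptic_coefficientsI)
  have ne: "\<Omega> \<noteq> {}" using assms(2) by (simp add: polyhedral_domain_def)
  define C1 where "C1 = 1 + embedding_const\<^sup>2 / \<alpha> + embedding_const\<^sup>2"
  define C2 where "C2 = (1 + embedding_const\<^sup>2) * C1 / \<alpha>"
  define C3 where "C3 = embedding_const\<^sup>2 * C2 + C1"
  \<comment> \<open>The sum of two nonnegative constants dominates both, so a single
    \<open>C\<close>, fixed before any mesh is chosen, serves the state and the adjoint
    estimate.\<close>
  define C where "C = embedding_const * C2 + embedding_const * C3"
  have nonneg: "0 \<le> C1" "0 \<le> C2" "0 \<le> C3"
    using assms(6) by (simp_all add: C1_def C2_def C3_def)
  have C: "embedding_const * C2 \<le> C" "embedding_const * C3 \<le> C" "0 \<le> C"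
    using nonneg embedding_const(1) by (simp_all add: C_def)
  have main: "let norm_a = energy_norm \<Omega> A c;
        y_aux = sol_op \<Omega> A c uh;
        p_aux = adj_sol_op \<Omega> A c (\<lambda>x. yh x - yd x);
        err = norm_a (\<lambda>x. y x - yh x) + norm_a (\<lambda>x. p x - ph x)
    in (\<exists>r. \<bar>r\<bar> \<le> C * kappa \<Omega> A c \<T> \<and>
            norm_a (\<lambda>x. y x - yh x) = norm_a (\<lambda>x. y_aux x - yh x) + r * err) \<and>
       (\<exists>r. \<bar>r\<bar> \<le> C * kappa \<Omega> A c \<T> \<and>
            norm_a (\<lambda>x. p x - ph x) = norm_a (\<lambda>x. p_aux x - ph x) + r * err)"
    if sol: "ocp_solution \<Omega> A c \<alpha> yd a b u y p"
      and disc: "discrete_solution \<Omega> A c \<alpha> yd a b \<T> uh yh ph"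
    for \<T> u y p uh yh ph
  proof -
    let ?err = "energy_norm \<Omega> A c (\<lambda>x. y x - yh x) + energy_norm \<Omega> A c (\<lambda>x. p x - ph x)"
    have H10: "y \<in> H10 \<Omega>" "p \<in> H10 \<Omega>" "yh \<in> H10 \<Omega>" "ph \<in> H10 \<Omega>"
      using sol disc unfolding ocp_solution_def discrete_solution_def adjoint_state_iff
      by (simp_all add: is_state_def FE_space_def)
    have err: "0 \<le> ?err"
      using en_nonneg[OF H10_diff[OF H10(1,3)]] en_nonneg[OF H10_diff[OF H10(2,4)]] by simp
    note \<kappa> = kappa_nonneg[OF ne, of \<T>]
    have up: "k * kappa \<Omega> A c \<T> * ?err \<le> C * kappa \<Omega> A c \<T> * ?err" if "k \<le> C" for k
      using that \<kappa> err by (intro mult_right_mono)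
    note est = energy_error_estimates[OF ne assms(6,7) sol disc, folded C1_def, folded C2_def, folded C3_def]
    show ?thesis
      unfolding Let_def adj_sol_op_eq
      using ex_relative_remainder[OF order_trans[OF est(1) up[OF C(1)]] mult_nonneg_nonneg[OF C(3) \<kappa>] err]
        ex_relative_remainder[OF order_trans[OF est(2) up[OF C(2)]] mult_nonneg_nonneg[OF C(3) \<kappa>] err]
      by (rule conjI)
  qed
  show ?thesis
    \<comment> \<open>As \<open>main\<close> is uniform over the meshes, \<open>1\<close> is taken
      as the threshold \<open>h0\<close>.\<close>
    by (rule exI[of _ 1], rule conjI[OF zero_less_one], rule exI[of _ C], intro ballI impI allI, elim conjE)
      (rule main)
qed

end
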